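(* The Kähler structure $(\mathbb{J},\Omega,\mathbb{G})$, defined on the open set $\mathbb{U}\subset\mathbb{L}(\mathbb{H}^3)$, is defined on (extends to) the whole of the space $\mathbb{L}(\mathbb{H}^3)$ of oriented geodesics of hyperbolic 3-space. The metric $\mathbb{G}$ is of neutral signature $(++--)$, is conformally flat and is scalar flat (its scalar curvature vanishes identically).
   Context: A Kähler structure on a 4-manifold is a triple $(\mathbb{J},\Omega,\mathbb{G})$ with $\mathbb{J}$ a complex structure, $\Omega$ a symplectic 2-form and $\mathbb{G}$ a (possibly indefinite, nondegenerate) metric with $\Omega(\mathbb{J}\cdot,\mathbb{J}\cdot)=\Omega(\cdot,\cdot)$ and $\mathbb{G}(\cdot,\cdot)=\Omega(\mathbb{J}\cdot,\cdot)$. Hyperbolic 3-space $\mathbb{H}^3$ is the upper half-space $\{(x^0,x^1,x^2)\in\mathbb{R}^3: x^0>0\}$ with metric $g=((dx^0)^2+(dx^1)^2+(dx^2)^2)/(x^0)^2$; put $t=x^0$, $z=x^1+ix^2$; orient it by $dx^0\wedge dx^1\wedge dx^2$. $\mathbb{L}(\mathbb{H}^3)$ is the smooth 4-manifold of oriented geodesics of $\mathbb{H}^3$ (the quotient of the unit tangent bundle by the geodesic flow). $\mathbb{U}\subset\mathbb{L}(\mathbb{H}^3)$ is the open set of oriented geodesics not parallel to the $x^0$-axis in the upper half-space model. It has global coordinates $(\xi,\eta)\in(\mathbb{C}-\{0\})\times\mathbb{C}$: the oriented geodesic $(\xi,\eta)$ is parameterised by arc length $r\in\mathbb{R}$ as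 $$t=\frac{1}{|\xi|\cosh r},\qquad z=\eta+\frac{\tanh r}{\bar\xi}.$$ $\Phi:\mathbb{U}\times\mathbb{R}\to\mathbb{H}^3$ is the map $(\xi,\eta,r)\mapsto(t,z)$ so defined. For an oriented geodesic $\gamma$, $\mathcal{J}^\perp(\gamma)$ is the 4-dimensional real vector space of Jacobi fields along $\gamma$ orthogonal to $\gamma$, and $Pr_\gamma$ is orthogonal projection onto the plane orthogonal to $\dot\gamma$. For $\gamma\in\mathbb{U}$, $h=Pr_\gamma\circ D\Phi$ sends $\mathbb{X}\in T_\gamma\mathbb{U}$ to the vector field $r\mapsto Pr_\gamma(D\Phi_{(\gamma,r)}(\mathbb{X}))$ along $\gamma$; it is an isomorphism $T_\gamma\mathbb{U}\to\mathcal{J}^\perp(\gamma)$. $\mathcal{R}_\gamma$ is rotation through $+90^\circ$ about $\dot\gamma$ (so $(\dot\gamma,v,\mathcal{R}_\gamma v)$ is positively oriented for unit $v\perp\dot\gamma$); it maps $\mathcal{J}^\perp(\gamma)$ to itself. On $\mathbb{U}$ define $$\mathbb{J}=h^{-1}\circ\mathcal{R}_\gamma\circ h,\qquad \Omega(\mathbb{X},\mathbb{Y})=g(h(\mathbb{X}),\nabla_{\dot\gamma}h(\mathbb{Y}))-g(h(\mathbb{Y}),\nabla_{\dot\gamma}h(\mathbb{X})),\qquad \mathbb{G}(\cdot,\cdot)=\Omega(\mathbb{J}\cdot,\cdot)$$ (the expression for $\Omega$ is constant along $\gamma$). *)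

theory Defs
  imports "HOL-Analysis.Analysis"
begin

section \<open>Smooth maps between Euclidean spaces\<close>

text \<open>Only used for open sets.\<close>

primrec Ck_on :: "nat \<Rightarrow> 'a::euclidean_space set \<Rightarrow> ('a \<Rightarrow> 'b::real_normed_vector) \<Rightarrow> bool" where
  "Ck_on 0 S f \<longleftrightarrow> continuous_on S f"
| "Ck_on (Suc k) S f \<longleftrightarrow>
     f differentiable_on S \<and> (\<forall>v. Ck_on k S (\<lambda>x. frechet_derivative f (at x) v))"

definition smooth_on :: "'a::euclidean_space set \<Rightarrow> ('a \<Rightarrow> 'b::real_normed_vector) \<Rightarrow> bool" where
  "smooth_on S f \<longleftrightarrow> (\<forall>k. Ck_on k S f)"

abbreviation ddir :: "('a::euclidean_space \<Rightarrow> 'b::real_normed_vector) \<Rightarrow> 'a \<Rightarrow> 'a \<Rightarrow> 'b" where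
  "ddir f x v \<equiv> frechet_derivative f (at x) v"


section \<open>Pseudo-Riemannian geometry in a coordinate domain\<close>

text \<open>
  A metric on an open subset of a Euclidean space is given by g x v w, the value at the point x
  on the tangent vectors v and w.  Constant vectors u, v, w are read as coordinate vector fields;
  they commute, so the Koszul formula below has no bracket terms.
\<close>

definition sharp :: "('a::euclidean_space \<Rightarrow> 'a \<Rightarrow> 'a \<Rightarrow> real) \<Rightarrow> 'a \<Rightarrow> ('a \<Rightarrow> real) \<Rightarrow> 'a" where
  "sharp g x \<alpha> = (THE z. \<forall>w. g x z w = \<alpha> w)"

definition christoffel :: "('a::euclidean_space \<Rightarrow> 'a \<Rightarrow> 'a \<Rightarrow> real) \<Rightarrow> 'a \<Rightarrow> 'a \<Rightarrow> 'a \<Rightarrow> 'a" where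
  "christoffel g x u v = sharp g x (\<lambda>w.
     (ddir (\<lambda>y. g y v w) x u + ddir (\<lambda>y. g y u w) x v - ddir (\<lambda>y. g y u v) x w) / 2)"

definition riemann ::
  "('a::euclidean_space \<Rightarrow> 'a \<Rightarrow> 'a \<Rightarrow> real) \<Rightarrow> 'a \<Rightarrow> 'a \<Rightarrow> 'a \<Rightarrow> 'a \<Rightarrow> 'a" where
  "riemann g x u v w =
     ddir (\<lambda>y. christoffel g y v w) x u - ddir (\<lambda>y. christoffel g y u w) x v
     + christoffel g x u (christoffel g x v w) - christoffel g x v (christoffel g x u w)"

definition ricci :: "('a::euclidean_space \<Rightarrow> 'a \<Rightarrow> 'a \<Rightarrow> real) \<Rightarrow> 'a \<Rightarrow> 'a \<Rightarrow> 'a \<Rightarrow> real" where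
  "ricci g x v w = (\<Sum>b\<in>Basis. riemann g x b v w \<bullet> b)"

definition scalar_curvature :: "('a::euclidean_space \<Rightarrow> 'a \<Rightarrow> 'a \<Rightarrow> real) \<Rightarrow> 'a \<Rightarrow> real" where
  "scalar_curvature g x = (\<Sum>b\<in>Basis. sharp g x (ricci g x b) \<bullet> b)"

definition velocity :: "(real \<Rightarrow> 'a::euclidean_space) \<Rightarrow> real \<Rightarrow> 'a" where
  "velocity c r = vector_derivative c (at r)"

text \<open>Covariant derivative of the vector field V along the curve c.\<close>

definition cov_deriv ::
  "('a::euclidean_space \<Rightarrow> 'a \<Rightarrow> 'a \<Rightarrow> real) \<Rightarrow> (real \<Rightarrow> 'a) \<Rightarrow> (real \<Rightarrow> 'a) \<Rightarrow> real \<Rightarrow> 'a" where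
  "cov_deriv g c V r =
     vector_derivative V (at r) + christoffel g (c r) (velocity c r) (V r)"

definition complete_geodesic ::
  "('a::euclidean_space \<Rightarrow> 'a \<Rightarrow> 'a \<Rightarrow> real) \<Rightarrow> 'a set \<Rightarrow> (real \<Rightarrow> 'a) \<Rightarrow> bool" where
  "complete_geodesic g S c \<longleftrightarrow>
     (\<forall>r. c r \<in> S \<and> c differentiable (at r) \<and> velocity c differentiable (at r)
          \<and> cov_deriv g c (velocity c) r = 0)"

definition nondegenerate :: "('a::euclidean_space \<Rightarrow> 'a \<Rightarrow> real) \<Rightarrow> bool" where
  "nondegenerate B \<longleftrightarrow> (\<forall>v. (\<forall>w. B v w = 0) \<longrightarrow> v = 0)"

definition has_signature :: "('a::euclidean_space \<Rightarrow> 'a \<Rightarrow> real) \<Rightarrow> nat \<Rightarrow> nat \<Rightarrow> bool" where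
  "has_signature B p q \<longleftrightarrow> p + q = DIM('a) \<and>
     (\<exists>e :: nat \<Rightarrow> 'a. \<forall>i<p+q. \<forall>j<p+q.
        B (e i) (e j) = (if i \<noteq> j then 0 else if i < p then 1 else - 1))"


section \<open>Manifolds and tensor fields\<close>

text \<open>
  A chart is an open domain in the manifold together with a coordinate map, whose values outside
  the domain are irrelevant.  A tensor field is the family of its components in the charts of
  the atlas, subject to the transformation law under changes of charts.
\<close>

type_synonym ('m, 'e) chart = "'m set \<times> ('m \<Rightarrow> 'e)"
type_synonym ('m, 'e) endo_field = "('m, 'e) chart \<Rightarrow> 'e \<Rightarrow> 'e \<Rightarrow> 'e"
type_synonym ('m, 'e) form_field = "('m, 'e) chart \<Rightarrow> 'e \<Rightarrow> 'e \<Rightarrow> 'e \<Rightarrow> real"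

abbreviation cdom :: "('m, 'e) chart \<Rightarrow> 'm set" where
  "cdom c \<equiv> fst c"

abbreviation cmap :: "('m, 'e) chart \<Rightarrow> 'm \<Rightarrow> 'e" where
  "cmap c \<equiv> snd c"

abbreviation cimg :: "('m, 'e) chart \<Rightarrow> 'e set" where
  "cimg c \<equiv> cmap c ` cdom c"

definition transition :: "('m, 'e) chart \<Rightarrow> ('m, 'e) chart \<Rightarrow> 'e \<Rightarrow> 'e" where
  "transition c c' = cmap c' \<circ> inv_into (cdom c) (cmap c)"

definition smooth_atlas :: "'m set \<Rightarrow> ('m, 'e::euclidean_space) chart set \<Rightarrow> bool" where
  "smooth_atlas M A \<longleftrightarrow>
     M = (\<Union>c\<in>A. cdom c) \<and>
     (\<forall>c\<in>A. inj_on (cmap c) (cdom c) \<and> open (cimg c)) \<and>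
     (\<forall>c\<in>A. \<forall>c'\<in>A. open (cmap c ` (cdom c \<inter> cdom c')) \<and>
        smooth_on (cmap c ` (cdom c \<inter> cdom c')) (transition c c'))"

definition endo_tensor ::
  "('m, 'e::euclidean_space) chart set \<Rightarrow> ('m, 'e) endo_field \<Rightarrow> bool" where
  "endo_tensor A J \<longleftrightarrow>
     (\<forall>c\<in>A. (\<forall>x\<in>cimg c. linear (J c x)) \<and> (\<forall>v. smooth_on (cimg c) (\<lambda>x. J c x v))) \<and>
     (\<forall>c\<in>A. \<forall>c'\<in>A. \<forall>p\<in>cdom c \<inter> cdom c'. \<forall>v.
        J c' (cmap c' p) (ddir (transition c c') (cmap c p) v)
        = ddir (transition c c') (cmap c p) (J c (cmap c p) v))"

definition form_tensor ::
  "('m, 'e::euclidean_space) chart set \<Rightarrow> ('m, 'e) form_field \<Rightarrow> bool" where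
  "form_tensor A B \<longleftrightarrow>
     (\<forall>c\<in>A. (\<forall>x\<in>cimg c. bilinear (B c x)) \<and> (\<forall>v w. smooth_on (cimg c) (\<lambda>x. B c x v w))) \<and>
     (\<forall>c\<in>A. \<forall>c'\<in>A. \<forall>p\<in>cdom c \<inter> cdom c'. \<forall>v w.
        B c' (cmap c' p) (ddir (transition c c') (cmap c p) v)
                         (ddir (transition c c') (cmap c p) w)
        = B c (cmap c p) v w)"

text \<open>
  A complex structure on a 4-manifold: around each point there are smooth coordinates in
  C x C for which J is multiplication by the imaginary unit.
\<close>

definition complex_structure ::
  "('m, complex \<times> complex) chart set \<Rightarrow> ('m, complex \<times> complex) endo_field \<Rightarrow> bool" where
  "complex_structure A J \<longleftrightarrow> endo_tensor A J \<and>
     (\<forall>c\<in>A. \<forall>p\<in>cdom c. \<exists>d\<in>A. p \<in> cdom d \<and>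
        (\<forall>x\<in>cimg d. \<forall>v. J d x v = (\<i> * fst v, \<i> * snd v)))"

definition symplectic_form ::
  "('m, 'e::euclidean_space) chart set \<Rightarrow> ('m, 'e) form_field \<Rightarrow> bool" where
  "symplectic_form A Om \<longleftrightarrow> form_tensor A Om \<and>
     (\<forall>c\<in>A. \<forall>x\<in>cimg c.
        (\<forall>v w. Om c x v w = - Om c x w v) \<and>
        nondegenerate (Om c x) \<and>
        (\<forall>u v w. ddir (\<lambda>y. Om c y v w) x u + ddir (\<lambda>y. Om c y w u) x v
                 + ddir (\<lambda>y. Om c y u v) x w = 0))"

definition pseudo_metric ::
  "('m, 'e::euclidean_space) chart set \<Rightarrow> ('m, 'e) form_field \<Rightarrow> bool" where
  "pseudo_metric A G \<longleftrightarrow> form_tensor A G \<and>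
     (\<forall>c\<in>A. \<forall>x\<in>cimg c. (\<forall>v w. G c x v w = G c x w v) \<and> nondegenerate (G c x))"

definition kaehler_structure ::
  "'m set \<Rightarrow> ('m, complex \<times> complex) chart set \<Rightarrow> ('m, complex \<times> complex) endo_field
   \<Rightarrow> ('m, complex \<times> complex) form_field \<Rightarrow> ('m, complex \<times> complex) form_field \<Rightarrow> bool" where
  "kaehler_structure M A J Om G \<longleftrightarrow>
     smooth_atlas M A \<and> complex_structure A J \<and> symplectic_form A Om \<and> pseudo_metric A G \<and>
     (\<forall>c\<in>A. \<forall>x\<in>cimg c. \<forall>v w.
        Om c x (J c x v) (J c x w) = Om c x v w \<and> G c x v w = Om c x (J c x v) w)"

definition neutral_metric ::
  "('m, complex \<times> complex) chart set \<Rightarrow> ('m, complex \<times> complex) form_field \<Rightarrow> bool" where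
  "neutral_metric A G \<longleftrightarrow> (\<forall>c\<in>A. \<forall>x\<in>cimg c. has_signature (G c x) 2 2)"

text \<open>
  Around each point there are coordinates in which the metric is a positive function times
  a flat metric with constant components.
\<close>

definition conformally_flat ::
  "('m, 'e::euclidean_space) chart set \<Rightarrow> ('m, 'e) form_field \<Rightarrow> bool" where
  "conformally_flat A G \<longleftrightarrow>
     (\<forall>c\<in>A. \<forall>p\<in>cdom c. \<exists>d\<in>A. p \<in> cdom d \<and>
        (\<exists>lam B. smooth_on (cimg d) lam \<and> (\<forall>x\<in>cimg d. 0 < lam x) \<and>
           bilinear B \<and> (\<forall>v w. B v w = B w v) \<and> nondegenerate B \<and>
           (\<forall>x\<in>cimg d. \<forall>v w. G d x v w = lam x * B v w)))"

definition scalar_flat ::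
  "('m, 'e::euclidean_space) chart set \<Rightarrow> ('m, 'e) form_field \<Rightarrow> bool" where
  "scalar_flat A G \<longleftrightarrow> (\<forall>c\<in>A. \<forall>x\<in>cimg c. scalar_curvature (G c) x = 0)"


section \<open>Hyperbolic 3-space and its oriented geodesics\<close>

text \<open>A point of the upper half-space is a pair (t, z).\<close>

type_synonym hvec = "real \<times> complex"

definition H3 :: "hvec set" where
  "H3 = {p. 0 < fst p}"

definition hyp :: "hvec \<Rightarrow> hvec \<Rightarrow> hvec \<Rightarrow> real" where
  "hyp p v w = (v \<bullet> w) / (fst p)\<^sup>2"

definition unit_tangent :: "(hvec \<times> hvec) set" where
  "unit_tangent = {(p, v). p \<in> H3 \<and> hyp p v v = 1}"

text \<open>Two unit tangent vectors are related if they lie on the same orbit of the geodesic flow.\<close>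

definition flow_rel :: "((hvec \<times> hvec) \<times> (hvec \<times> hvec)) set" where
  "flow_rel = {(a, b). a \<in> unit_tangent \<and> b \<in> unit_tangent \<and>
     (\<exists>c r. complete_geodesic hyp H3 c \<and> (c 0, velocity c 0) = a \<and> (c r, velocity c r) = b)}"

type_synonym ogeod = "(hvec \<times> hvec) set"

definition LH3 :: "ogeod set" where
  "LH3 = unit_tangent // flow_rel"

definition flow_proj :: "hvec \<times> hvec \<Rightarrow> ogeod" where
  "flow_proj a = flow_rel `` {a}"

text \<open>
  The quotient smooth structure is the one for which the projection of the unit tangent bundle
  is a smooth submersion.  Smoothness on the unit tangent bundle is tested on the bundle of
  nonzero tangent vectors, an open subset of a Euclidean space, by composing with the smooth
  retraction that normalizes vectors.  So the charts are the injective coordinate maps on open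
  sets W whose composite with this projection is a smooth submersion.
\<close>

definition slit_tangent :: "(hvec \<times> hvec) set" where
  "slit_tangent = {(p, v). p \<in> H3 \<and> v \<noteq> 0}"

definition slit_proj :: "hvec \<times> hvec \<Rightarrow> ogeod" where
  "slit_proj = (\<lambda>(p, v). flow_proj (p, (1 / sqrt (hyp p v v)) *\<^sub>R v))"

definition LH3_atlas :: "(ogeod, complex \<times> complex) chart set" where
  "LH3_atlas = {(W, \<phi>). W \<subseteq> LH3 \<and> inj_on \<phi> W \<and>
     (let P = {a \<in> slit_tangent. slit_proj a \<in> W}; f = \<phi> \<circ> slit_proj in
        open P \<and> smooth_on P f \<and> (\<forall>a\<in>P. surj (frechet_derivative f (at a))))}"


section \<open>The structure on the geodesics that are not vertical\<close>

definition Phi :: "complex \<times> complex \<Rightarrow> real \<Rightarrow> hvec" where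
  "Phi = (\<lambda>(\<xi>, \<eta>) r. (1 / (cmod \<xi> * cosh r), \<eta> + of_real (tanh r) / cnj \<xi>))"

definition geod_of :: "complex \<times> complex \<Rightarrow> ogeod" where
  "geod_of a = flow_proj (Phi a 0, velocity (Phi a) 0)"

definition U_set :: "ogeod set" where
  "U_set = {\<gamma> \<in> LH3. \<not> (\<forall>(p, v)\<in>\<gamma>. snd v = 0)}"

definition coord_range :: "(complex \<times> complex) set" where
  "coord_range = (UNIV - {0}) \<times> UNIV"

definition U_chart :: "(ogeod, complex \<times> complex) chart" where
  "U_chart = (U_set, inv_into coord_range geod_of)"

definition perp_proj :: "hvec \<Rightarrow> hvec \<Rightarrow> hvec \<Rightarrow> hvec" where
  "perp_proj p u v = v - (hyp p v u / hyp p u u) *\<^sub>R u"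

definition coord3 :: "hvec \<Rightarrow> real^3" where
  "coord3 v = vector [fst v, Re (snd v), Im (snd v)]"

text \<open>Rotation by +90 degrees about u in the plane orthogonal to u.\<close>

definition rot90 :: "hvec \<Rightarrow> hvec \<Rightarrow> hvec \<Rightarrow> hvec" where
  "rot90 p u v = (THE w. hyp p w u = 0 \<and> hyp p w v = 0 \<and> hyp p w w = hyp p v v \<and>
     (v \<noteq> 0 \<longrightarrow> det (vector [coord3 u, coord3 v, coord3 w] :: real^3^3) > 0))"

definition h_map :: "complex \<times> complex \<Rightarrow> complex \<times> complex \<Rightarrow> real \<Rightarrow> hvec" where
  "h_map a X r = perp_proj (Phi a r) (velocity (Phi a) r) (ddir (\<lambda>b. Phi b r) a X)"

definition J_U :: "complex \<times> complex \<Rightarrow> complex \<times> complex \<Rightarrow> complex \<times> complex" where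
  "J_U a X = inv (h_map a) (\<lambda>r. rot90 (Phi a r) (velocity (Phi a) r) (h_map a X r))"

text \<open>The expression in the following definition does not depend on r.\<close>

definition Omega_U :: "complex \<times> complex \<Rightarrow> complex \<times> complex \<Rightarrow> complex \<times> complex \<Rightarrow> real" where
  "Omega_U a X Y = (THE k. \<forall>r.
     k = hyp (Phi a r) (h_map a X r) (cov_deriv hyp (Phi a) (h_map a Y) r)
       - hyp (Phi a r) (h_map a Y r) (cov_deriv hyp (Phi a) (h_map a X) r))"

definition G_U :: "complex \<times> complex \<Rightarrow> complex \<times> complex \<Rightarrow> complex \<times> complex \<Rightarrow> real" where
  "G_U a X Y = Omega_U a (J_U a X) Y"

definition extends_from_U ::
  "(ogeod, complex \<times> complex) endo_field \<Rightarrow> (ogeod, complex \<times> complex) form_field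
   \<Rightarrow> (ogeod, complex \<times> complex) form_field \<Rightarrow> bool" where
  "extends_from_U J Om G \<longleftrightarrow>
     U_chart \<in> LH3_atlas \<and> bij_betw (cmap U_chart) U_set coord_range \<and>
     (\<forall>a\<in>coord_range. \<forall>X Y.
        J U_chart a X = J_U a X \<and> Om U_chart a X Y = Omega_U a X Y \<and> G U_chart a X Y = G_U a X Y)"

end

theory Submission
  imports Defs
begin

text \<open>
  The infinitesimal translation along an oriented geodesic identifies L(H3) with the complex quadric
  \<open>a\<^sup>2 - b c = 1\<close> in sl(2, C) = C^3.  At a point X of the quadric, J is the map \<open>Y \<mapsto> i [X, Y] / 2\<close>
  on tangent vectors, and G is the imaginary part of the quadratic form.  Since the imaginary part
  vanishes at X itself, the quadric lies in the null cone of a flat metric of signature (3, 3), which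
  makes G conformally flat.  The Gauss equation for an arbitrary local parametrisation gives
  \<open>R(u, v) w = q(v, w) u - q(u, w) v\<close> with the complex form q, so the Ricci form is 2 Re q, which
  corresponds to the trace free endomorphism 2 i with respect to G = Im q.
\<close>

section \<open>Calculus of smooth maps\<close>

text \<open>\<open>LH3_atlas\<close> contains every chart compatible with the quotient, and each
  tensor property is demanded in each of them, so no single convenient coordinate system is enough.
  The fields are therefore pulled back from the quadric: local claims are proved once, for an
  arbitrary immersion of an open set, and transformation laws become instances of the chain rule.
  This needs the moment to separate geodesics. It is conserved along the flow, and two unit vectors
  with equal moment are shown to lie on a common explicit arc. Two families of arcs occur because
  the half-space model singles out the point at infinity: \<open>e = 1\<close> misses the geodesics
  that start there, \<open>e = - 1\<close> those that end there. Special charts enter only where an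
  existential quantifier asks for them: end points with one of them conjugated for the complex
  structure, a rescaled section of the null cone for conformal flatness. The Jacobi field definition
  over \<open>U_set\<close> is evaluated separately in a parallel frame and matched with the pulled
  back fields.\<close>

lemma Ck_on_cong:
  assumes "open S" "\<And>x. x \<in> S \<Longrightarrow> f x = g x"
  shows "Ck_on k S f \<longleftrightarrow> Ck_on k S g"
  using assms(2)
proof (induction k arbitrary: f g)
  case 0
  then show ?case by (simp cong: continuous_on_cong)
next
  case (Suc k)
  have d: "f differentiable_on S \<longleftrightarrow> g differentiable_on S"
    using Suc.prems by (metis differentiable_on_def differentiable_transform_within zero_less_one)
  have "Ck_on k S (\<lambda>x. ddir f x v) \<longleftrightarrow> Ck_on k S (\<lambda>x. ddir g x v)" if "f differentiable_on S" for v
  proof (rule Suc.IH)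
    fix x assume x: "x \<in> S"
    have "f differentiable at x"
      using that x assms(1) by (meson differentiable_on_eq_differentiable_at)
    then show "ddir f x v = ddir g x v"
      using frechet_derivative_transform_within_open[OF _ assms(1) x] Suc.prems by metis
  qed
  with d show ?case by auto
qed

lemma Ck_on_subset: "Ck_on k S f \<Longrightarrow> T \<subseteq> S \<Longrightarrow> Ck_on k T f"
  by (induction k arbitrary: f) (auto intro: continuous_on_subset differentiable_on_subset)

lemma Ck_on_Suc: "Ck_on (Suc k) S f \<Longrightarrow> Ck_on k S f"
proof (induction k arbitrary: f)
  case 0
  then show ?case by (simp add: differentiable_imp_continuous_on)
next
  case (Suc k)
  then show ?case by (metis Ck_on.simps(2))
qed

lemma Ck_on_SucI:
  assumes "open S" "\<And>x. x \<in> S \<Longrightarrow> (f has_derivative f' x) (at x)"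
    and "\<And>v. Ck_on k S (\<lambda>x. f' x v)"
  shows "Ck_on (Suc k) S f"
proof -
  have "f differentiable_on S"
    using assms(1,2) by (meson differentiableI differentiable_on_eq_differentiable_at)
  moreover have "Ck_on k S (\<lambda>x. ddir f x v)" for v
    using assms(3)[of v] Ck_on_cong[OF assms(1), of "\<lambda>x. ddir f x v" "\<lambda>x. f' x v" k]
      frechet_derivative_at[OF assms(2)] by simp
  ultimately show ?thesis by simp
qed

lemma Ck_on_Suc_has_derivative:
  assumes "open S" "Ck_on (Suc k) S f" "x \<in> S"
  shows "(f has_derivative ddir f x) (at x)"
  using assms by (simp add: differentiable_on_eq_differentiable_at frechet_derivative_works)

lemma Ck_on_const: "Ck_on k S (\<lambda>x. c)"
proof (induction k arbitrary: c)
  case (Suc k)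
  have "frechet_derivative (\<lambda>x. c) (at x) v = 0" for x v
    by (simp add: frechet_derivative_const)
  with Suc[of 0] show ?case by simp
qed simp

lemma Ck_on_linear:
  assumes "open S" "bounded_linear f" shows "Ck_on k S f"
proof (cases k)
  case 0
  then show ?thesis using assms by (simp add: linear_continuous_on)
next
  case (Suc n)
  show ?thesis unfolding Suc
    by (rule Ck_on_SucI[OF assms(1) bounded_linear_imp_has_derivative[OF assms(2)] Ck_on_const])
qed

lemma Ck_on_add:
  assumes "open S" "Ck_on k S f" "Ck_on k S g" shows "Ck_on k S (\<lambda>x. f x + g x)"
  using assms(2,3)
proof (induction k arbitrary: f g)
  case 0
  then show ?case by (simp add: continuous_on_add)
next
  case (Suc k)
  show ?case
  proof (rule Ck_on_SucI[OF assms(1)])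
    show "((\<lambda>x. f x + g x) has_derivative (\<lambda>v. ddir f x v + ddir g x v)) (at x)" if "x \<in> S" for x
      by (intro has_derivative_add Ck_on_Suc_has_derivative[OF assms(1) Suc.prems(1) that]
          Ck_on_Suc_has_derivative[OF assms(1) Suc.prems(2) that])
    show "Ck_on k S (\<lambda>x. ddir f x v + ddir g x v)" for v
      using Suc.prems by (intro Suc.IH) auto
  qed
qed

lemma Ck_on_sum:
  assumes "open S" "\<And>i. i \<in> I \<Longrightarrow> Ck_on k S (f i)" shows "Ck_on k S (\<lambda>x. \<Sum>i\<in>I. f i x)"
  using assms(2) by (induction I rule: infinite_finite_induct) (auto intro!: Ck_on_add Ck_on_const assms(1))

lemma (in bounded_bilinear) Ck_on:
  assumes "open S" "Ck_on k S f" "Ck_on k S g" shows "Ck_on k S (\<lambda>x. prod (f x) (g x))"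
  using assms(2,3)
proof (induction k arbitrary: f g)
  case 0
  then show ?case by (simp add: continuous_on)
next
  case (Suc k)
  show ?case
  proof (rule Ck_on_SucI[OF assms(1)])
    show "((\<lambda>x. prod (f x) (g x)) has_derivative
            (\<lambda>v. prod (f x) (ddir g x v) + prod (ddir f x v) (g x))) (at x)" if "x \<in> S" for x
      by (intro FDERIV Ck_on_Suc_has_derivative[OF assms(1) Suc.prems(1) that]
          Ck_on_Suc_has_derivative[OF assms(1) Suc.prems(2) that])
    show "Ck_on k S (\<lambda>x. prod (f x) (ddir g x v) + prod (ddir f x v) (g x))" for v
      using Suc.prems Ck_on_Suc[OF Suc.prems(1)] Ck_on_Suc[OF Suc.prems(2)]
      by (intro Ck_on_add assms(1) Suc.IH) auto
  qed
qed

lemma (in bounded_linear) Ck_on: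
  assumes "open S" "Ck_on k S g" shows "Ck_on k S (\<lambda>x. f (g x))"
  using assms(2)
proof (induction k arbitrary: g)
  case 0
  then show ?case by (simp add: continuous_on)
next
  case (Suc k)
  show ?case
  proof (rule Ck_on_SucI[OF assms(1)])
    show "((\<lambda>x. f (g x)) has_derivative (\<lambda>v. f (ddir g x v))) (at x)" if "x \<in> S" for x
      by (intro has_derivative Ck_on_Suc_has_derivative[OF assms(1) Suc.prems that])
    show "Ck_on k S (\<lambda>x. f (ddir g x v))" for v
      using Suc.prems by (intro Suc.IH) auto
  qed
qed

lemma linear_basis_expansion:
  fixes f :: "'a::euclidean_space \<Rightarrow> 'b::real_vector"
  assumes "linear f" shows "f x = (\<Sum>b\<in>Basis. (x \<bullet> b) *\<^sub>R f b)"
proof -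
  have "f x = f (\<Sum>b\<in>Basis. (x \<bullet> b) *\<^sub>R b)" by (simp add: euclidean_representation)
  then show ?thesis using assms by (simp add: linear_sum linear_cmul)
qed

text \<open>The chain rule differentiates \<open>g\<close> in the direction
  \<open>ddir f x v\<close>, which moves with \<open>x\<close>, whereas \<open>Ck_on\<close> speaks
  of fixed directions only. Expanding the direction in the basis bridges the gap.\<close>

lemma Ck_on_compose:
  fixes f :: "'a::euclidean_space \<Rightarrow> 'b::euclidean_space"
  assumes "open S" "open T" "f ` S \<subseteq> T" "Ck_on k S f" "Ck_on k T g"
  shows "Ck_on k S (\<lambda>x. g (f x))"
  using assms(4,5)
proof (induction k arbitrary: g)
  case 0
  then show ?case using assms(3) by (auto intro: continuous_on_compose2)
next
  case (Suc k)
  have df: "(f has_derivative ddir f x) (at x)" if "x \<in> S" for x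
    by (rule Ck_on_Suc_has_derivative[OF assms(1) Suc.prems(1) that])
  have dg: "(g has_derivative ddir g y) (at y)" if "y \<in> T" for y
    by (rule Ck_on_Suc_has_derivative[OF assms(2) Suc.prems(2) that])
  show ?case
  proof (rule Ck_on_SucI[OF assms(1)])
    fix x assume x: "x \<in> S"
    have "linear (ddir g (f x))" using dg x assms(3) by (blast intro: has_derivative_linear)
    then have "ddir g (f x) (ddir f x v) = (\<Sum>b\<in>Basis. (ddir f x v \<bullet> b) *\<^sub>R ddir g (f x) b)" for v
      by (rule linear_basis_expansion)
    then show "((\<lambda>x. g (f x)) has_derivative
        (\<lambda>v. \<Sum>b\<in>Basis. (ddir f x v \<bullet> b) *\<^sub>R ddir g (f x) b)) (at x)"
      using has_derivative_compose[OF df[OF x] dg] x assms(3) by auto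
  next
    fix v
    show "Ck_on k S (\<lambda>x. \<Sum>b\<in>Basis. (ddir f x v \<bullet> b) *\<^sub>R ddir g (f x) b)"
      using Suc.prems Ck_on_Suc[OF Suc.prems(1)]
      by (intro Ck_on_sum assms(1) bounded_bilinear.Ck_on[OF bounded_bilinear_scaleR]
          bounded_linear.Ck_on[OF bounded_linear_inner_left] Suc.IH) auto
  qed
qed

text \<open>The derivative of the reciprocal is a polynomial in the reciprocal and the derivative of
  \<open>f\<close>, so the regularity already reached yields the next order.\<close>

lemma Ck_on_inverse:
  fixes f :: "'a::euclidean_space \<Rightarrow> 'b::real_normed_field"
  assumes "open S" "Ck_on k S f" "\<And>x. x \<in> S \<Longrightarrow> f x \<noteq> 0"
  shows "Ck_on k S (\<lambda>x. inverse (f x))"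
  using assms(2)
proof (induction k)
  case 0
  then show ?case using assms(3) by (auto intro: continuous_on_inverse)
next
  case (Suc k)
  have i: "Ck_on k S (\<lambda>x. inverse (f x))" by (rule Suc.IH[OF Ck_on_Suc[OF Suc.prems]])
  show ?case
  proof (rule Ck_on_SucI[OF assms(1)])
    show "((\<lambda>x. inverse (f x)) has_derivative
            (\<lambda>v. - (inverse (f x) * ddir f x v * inverse (f x)))) (at x)" if "x \<in> S" for x
      by (intro Deriv.has_derivative_inverse Ck_on_Suc_has_derivative[OF assms(1) Suc.prems that] assms(3) that)
    show "Ck_on k S (\<lambda>x. - (inverse (f x) * ddir f x v * inverse (f x)))" for v
      using Suc.prems i
      by (intro bounded_linear.Ck_on[OF bounded_linear_minus[OF bounded_linear_ident]] assms(1)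
          bounded_bilinear.Ck_on[OF bounded_bilinear_mult]) auto
  qed
qed

lemma Ck_on_sqrt:
  assumes "open S" "Ck_on k S f" "\<And>x. x \<in> S \<Longrightarrow> f x > 0"
  shows "Ck_on k S (\<lambda>x. sqrt (f x))"
  using assms(2)
proof (induction k)
  case 0
  then show ?case by (auto intro: continuous_on_real_sqrt)
next
  case (Suc k)
  have i: "Ck_on k S (\<lambda>x. sqrt (f x))" by (rule Suc.IH[OF Ck_on_Suc[OF Suc.prems]])
  show ?case
  proof (rule Ck_on_SucI[OF assms(1)])
    show "((\<lambda>x. sqrt (f x)) has_derivative (\<lambda>v. ddir f x v * (inverse (sqrt (f x)) * (1/2)))) (at x)"
      if x: "x \<in> S" for x
      using has_derivative_real_sqrt[OF assms(3)[OF x] Ck_on_Suc_has_derivative[OF assms(1) Suc.prems x]]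
      by (simp add: field_simps)
    show "Ck_on k S (\<lambda>x. ddir f x v * (inverse (sqrt (f x)) * (1/2)))" for v
      using Suc.prems i assms(3)
      by (intro assms(1) bounded_bilinear.Ck_on[OF bounded_bilinear_mult] Ck_on_inverse Ck_on_const) force+
  qed
qed

lemma Ck_on_local:
  assumes "open S" "\<And>x. x \<in> S \<Longrightarrow> \<exists>T. open T \<and> x \<in> T \<and> Ck_on k T f"
  shows "Ck_on k S f"
  using assms(2)
proof (induction k arbitrary: f)
  case 0
  then show ?case
    by (metis Ck_on.simps(1) continuous_at_imp_continuous_on continuous_on_eq_continuous_at)
next
  case (Suc k)
  have "f differentiable at x" if "x \<in> S" for x
    using Suc.prems[OF that] by (auto simp: differentiable_on_eq_differentiable_at)
  then have "f differentiable_on S"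
    using assms(1) by (simp add: differentiable_on_eq_differentiable_at)
  moreover have "Ck_on k S (\<lambda>x. ddir f x v)" for v
    using Suc.prems by (intro Suc.IH) (metis Ck_on.simps(2))
  ultimately show ?case by simp
qed

lemma smooth_on_cong: "open S \<Longrightarrow> (\<And>x. x \<in> S \<Longrightarrow> f x = g x) \<Longrightarrow> smooth_on S f \<longleftrightarrow> smooth_on S g"
  unfolding smooth_on_def using Ck_on_cong by metis

lemma smooth_on_subset: "smooth_on S f \<Longrightarrow> T \<subseteq> S \<Longrightarrow> smooth_on T f"
  unfolding smooth_on_def using Ck_on_subset by metis

lemma smooth_on_const: "smooth_on S (\<lambda>x. c)"
  by (simp add: smooth_on_def Ck_on_const)

lemma smooth_on_linear: "open S \<Longrightarrow> bounded_linear f \<Longrightarrow> smooth_on S f"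
  by (simp add: smooth_on_def Ck_on_linear)

lemma smooth_on_add:
  "open S \<Longrightarrow> smooth_on S f \<Longrightarrow> smooth_on S g \<Longrightarrow> smooth_on S (\<lambda>x. f x + g x)"
  by (simp add: smooth_on_def Ck_on_add)

lemma smooth_on_sum:
  "open S \<Longrightarrow> (\<And>i. i \<in> I \<Longrightarrow> smooth_on S (f i)) \<Longrightarrow> smooth_on S (\<lambda>x. \<Sum>i\<in>I. f i x)"
  by (simp add: smooth_on_def Ck_on_sum)

lemma (in bounded_bilinear) smooth_on:
  "open S \<Longrightarrow> smooth_on S f \<Longrightarrow> smooth_on S g \<Longrightarrow> smooth_on S (\<lambda>x. prod (f x) (g x))"
  by (simp add: smooth_on_def Ck_on)

lemma (in bounded_linear) smooth_on:
  "open S \<Longrightarrow> smooth_on S g \<Longrightarrow> smooth_on S (\<lambda>x. f (g x))"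
  by (simp add: smooth_on_def Ck_on)

lemma smooth_on_compose:
  fixes f :: "'a::euclidean_space \<Rightarrow> 'b::euclidean_space"
  shows "open S \<Longrightarrow> open T \<Longrightarrow> f ` S \<subseteq> T \<Longrightarrow> smooth_on S f \<Longrightarrow> smooth_on T g \<Longrightarrow> smooth_on S (\<lambda>x. g (f x))"
  unfolding smooth_on_def by (blast intro: Ck_on_compose)

lemma smooth_on_inverse:
  fixes f :: "'a::euclidean_space \<Rightarrow> 'b::real_normed_field"
  shows "open S \<Longrightarrow> smooth_on S f \<Longrightarrow> (\<And>x. x \<in> S \<Longrightarrow> f x \<noteq> 0) \<Longrightarrow> smooth_on S (\<lambda>x. inverse (f x))"
  by (simp add: smooth_on_def Ck_on_inverse)

lemma smooth_on_sqrt: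
  "open S \<Longrightarrow> smooth_on S f \<Longrightarrow> (\<And>x. x \<in> S \<Longrightarrow> f x > 0) \<Longrightarrow> smooth_on S (\<lambda>x. sqrt (f x))"
  by (simp add: smooth_on_def Ck_on_sqrt)

lemma smooth_on_local:
  "open S \<Longrightarrow> (\<And>x. x \<in> S \<Longrightarrow> \<exists>T. open T \<and> x \<in> T \<and> smooth_on T f) \<Longrightarrow> smooth_on S f"
  unfolding smooth_on_def by (intro allI Ck_on_local) blast+

lemma smooth_on_has_derivative:
  "open S \<Longrightarrow> smooth_on S f \<Longrightarrow> x \<in> S \<Longrightarrow> (f has_derivative ddir f x) (at x)"
  unfolding smooth_on_def using Ck_on_Suc_has_derivative by blast

lemma smooth_on_ddir: "smooth_on S f \<Longrightarrow> smooth_on S (\<lambda>x. ddir f x v)"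
  unfolding smooth_on_def by (metis Ck_on.simps(2))

lemma smooth_on_continuous: "smooth_on S f \<Longrightarrow> continuous_on S f"
  unfolding smooth_on_def by (metis Ck_on.simps(1))

lemma smooth_on_mult:
  fixes f :: "'a::euclidean_space \<Rightarrow> 'b::real_normed_algebra"
  shows "open S \<Longrightarrow> smooth_on S f \<Longrightarrow> smooth_on S g \<Longrightarrow> smooth_on S (\<lambda>x. f x * g x)"
  by (rule bounded_bilinear.smooth_on[OF bounded_bilinear_mult])

lemma smooth_on_scaleR:
  "open S \<Longrightarrow> smooth_on S f \<Longrightarrow> smooth_on S g \<Longrightarrow> smooth_on S (\<lambda>x. f x *\<^sub>R g x)"
  by (rule bounded_bilinear.smooth_on[OF bounded_bilinear_scaleR])

lemma smooth_on_inner: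
  "open S \<Longrightarrow> smooth_on S f \<Longrightarrow> smooth_on S g \<Longrightarrow> smooth_on S (\<lambda>x. f x \<bullet> g x)"
  by (rule bounded_bilinear.smooth_on[OF bounded_bilinear_inner])

lemma smooth_on_minus: "open S \<Longrightarrow> smooth_on S f \<Longrightarrow> smooth_on S (\<lambda>x. - f x)"
  by (rule bounded_linear.smooth_on[OF bounded_linear_minus[OF bounded_linear_ident]])

lemma smooth_on_diff:
  "open S \<Longrightarrow> smooth_on S f \<Longrightarrow> smooth_on S g \<Longrightarrow> smooth_on S (\<lambda>x. f x - g x)"
  using smooth_on_add[of S f "\<lambda>x. - g x"] smooth_on_minus[of S g] by simp

lemma smooth_on_divide:
  fixes f :: "'a::euclidean_space \<Rightarrow> 'b::real_normed_field"
  shows "open S \<Longrightarrow> smooth_on S f \<Longrightarrow> smooth_on S g \<Longrightarrow> (\<And>x. x \<in> S \<Longrightarrow> g x \<noteq> 0) \<Longrightarrow>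
    smooth_on S (\<lambda>x. f x / g x)"
  unfolding divide_inverse by (intro smooth_on_mult smooth_on_inverse)

lemma smooth_on_power:
  fixes f :: "'a::euclidean_space \<Rightarrow> 'b::real_normed_field"
  shows "open S \<Longrightarrow> smooth_on S f \<Longrightarrow> smooth_on S (\<lambda>x. f x ^ n)"
  by (induction n) (auto intro: smooth_on_mult smooth_on_const)

lemma smooth_on_ident: "open S \<Longrightarrow> smooth_on S (\<lambda>x. x)"
  by (rule smooth_on_linear[OF _ bounded_linear_ident])

lemma smooth_on_Pair:
  assumes "open S" "smooth_on S f" "smooth_on S g"
  shows "smooth_on S (\<lambda>x. (f x, g x))"
proof -
  have "smooth_on S (\<lambda>x. (f x, 0) + (0, g x))"
    using assms
    by (intro smooth_on_add bounded_linear.smooth_on[OF bounded_linear_Pair[OF bounded_linear_ident bounded_linear_zero]]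
        bounded_linear.smooth_on[OF bounded_linear_Pair[OF bounded_linear_zero bounded_linear_ident]])
  then show ?thesis by simp
qed

lemmas smooth_on_fst = bounded_linear.smooth_on[OF bounded_linear_fst]
lemmas smooth_on_snd = bounded_linear.smooth_on[OF bounded_linear_snd]
lemmas smooth_on_Re = bounded_linear.smooth_on[OF bounded_linear_Re]
lemmas smooth_on_Im = bounded_linear.smooth_on[OF bounded_linear_Im]
lemmas smooth_on_cnj = bounded_linear.smooth_on[OF bounded_linear_cnj]
lemmas smooth_on_of_real = bounded_linear.smooth_on[OF bounded_linear_of_real]

lemmas smooth_intros =
  smooth_on_const smooth_on_ident smooth_on_add smooth_on_diff smooth_on_minus smooth_on_sum
  smooth_on_mult smooth_on_divide smooth_on_power smooth_on_scaleR smooth_on_inner smooth_on_Pair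
  smooth_on_fst smooth_on_snd smooth_on_Re smooth_on_Im smooth_on_cnj smooth_on_of_real

subsection \<open>Symmetry of second derivatives\<close>

text \<open>The mean value theorem is applied along \<open>u\<close> to a difference in
  \<open>v\<close>, then along \<open>v\<close> to the resulting difference of derivatives. The
  second difference is symmetric in \<open>u\<close> and \<open>v\<close>, which is what the
  symmetry proof exploits.\<close>

lemma second_difference_mean_value:
  fixes f :: "'a::euclidean_space \<Rightarrow> real"
  assumes "open S" "Ck_on 2 S f" "h > 0"
    and in_S: "\<And>s t. 0 \<le> s \<Longrightarrow> s \<le> h \<Longrightarrow> 0 \<le> t \<Longrightarrow> t \<le> h \<Longrightarrow> x + s *\<^sub>R u + t *\<^sub>R v \<in> S"
  shows "\<exists>s t. 0 < s \<and> s < h \<and> 0 < t \<and> t < h \<and>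
    f (x + h *\<^sub>R u + h *\<^sub>R v) - f (x + h *\<^sub>R u) - f (x + h *\<^sub>R v) + f x
    = h * h * ddir (\<lambda>y. ddir f y u) (x + s *\<^sub>R u + t *\<^sub>R v) v"
proof -
  have k2: "Ck_on (Suc (Suc 0)) S f" using assms(2) by (simp add: numeral_2_eq_2)
  have df: "(f has_derivative ddir f y) (at y)" if "y \<in> S" for y
    by (rule Ck_on_Suc_has_derivative[OF assms(1) k2 that])
  have "Ck_on (Suc 0) S (\<lambda>y. ddir f y u)" using k2 by simp
  then have ddf: "((\<lambda>y. ddir f y u) has_derivative ddir (\<lambda>y. ddir f y u) y) (at y)" if "y \<in> S" for y
    by (rule Ck_on_Suc_has_derivative[OF assms(1) _ that])
  have d1: "((\<lambda>s. f (x + s *\<^sub>R u + t *\<^sub>R v)) has_real_derivative ddir f (x + s *\<^sub>R u + t *\<^sub>R v) u) (at s)"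
    if "0 \<le> s" "s \<le> h" "0 \<le> t" "t \<le> h" for s t
  proof -
    have "((\<lambda>s. x + s *\<^sub>R u + t *\<^sub>R v) has_derivative (\<lambda>a. a *\<^sub>R u)) (at s)"
      by (auto intro!: derivative_eq_intros)
    from has_derivative_compose[OF this df[OF in_S[OF that]]]
    have "((\<lambda>s. f (x + s *\<^sub>R u + t *\<^sub>R v)) has_derivative (\<lambda>a. ddir f (x + s *\<^sub>R u + t *\<^sub>R v) (a *\<^sub>R u))) (at s)" .
    moreover have "linear (ddir f (x + s *\<^sub>R u + t *\<^sub>R v))"
      using df[OF in_S[OF that]] by (rule has_derivative_linear)
    ultimately show ?thesis by (simp add: has_field_derivative_def linear_cmul mult.commute[of _ "ddir _ _ _"])
  qed
  have d2: "((\<lambda>t. ddir f (x + s *\<^sub>R u + t *\<^sub>R v) u) has_real_derivative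
      ddir (\<lambda>y. ddir f y u) (x + s *\<^sub>R u + t *\<^sub>R v) v) (at t)"
    if "0 \<le> s" "s \<le> h" "0 \<le> t" "t \<le> h" for s t
  proof -
    have "((\<lambda>t. x + s *\<^sub>R u + t *\<^sub>R v) has_derivative (\<lambda>a. a *\<^sub>R v)) (at t)"
      by (auto intro!: derivative_eq_intros)
    from has_derivative_compose[OF this ddf[OF in_S[OF that]]]
    have "((\<lambda>t. ddir f (x + s *\<^sub>R u + t *\<^sub>R v) u) has_derivative
       (\<lambda>a. ddir (\<lambda>y. ddir f y u) (x + s *\<^sub>R u + t *\<^sub>R v) (a *\<^sub>R v))) (at t)" .
    moreover have "linear (ddir (\<lambda>y. ddir f y u) (x + s *\<^sub>R u + t *\<^sub>R v))"
      using ddf[OF in_S[OF that]] by (rule has_derivative_linear)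
    ultimately show ?thesis
      by (simp add: has_field_derivative_def linear_cmul mult.commute[of _ "frechet_derivative _ _ _"])
  qed
  have "\<exists>s>0. s < h \<and>
     (f (x + h *\<^sub>R u + h *\<^sub>R v) - f (x + h *\<^sub>R u + 0 *\<^sub>R v)) - (f (x + 0 *\<^sub>R u + h *\<^sub>R v) - f (x + 0 *\<^sub>R u + 0 *\<^sub>R v))
     = (h - 0) * (ddir f (x + s *\<^sub>R u + h *\<^sub>R v) u - ddir f (x + s *\<^sub>R u + 0 *\<^sub>R v) u)"
    using assms(3) by (intro MVT2 DERIV_diff d1) auto
  then obtain s where s: "0 < s" "s < h"
    "(f (x + h *\<^sub>R u + h *\<^sub>R v) - f (x + h *\<^sub>R u)) - (f (x + h *\<^sub>R v) - f x)
     = h * (ddir f (x + s *\<^sub>R u + h *\<^sub>R v) u - ddir f (x + s *\<^sub>R u + 0 *\<^sub>R v) u)"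
    by auto
  have "\<exists>t>0. t < h \<and> ddir f (x + s *\<^sub>R u + h *\<^sub>R v) u - ddir f (x + s *\<^sub>R u + 0 *\<^sub>R v) u
     = (h - 0) * ddir (\<lambda>y. ddir f y u) (x + s *\<^sub>R u + t *\<^sub>R v) v"
    using assms(3) s by (intro MVT2 d2) auto
  then obtain t where "0 < t" "t < h"
    "ddir f (x + s *\<^sub>R u + h *\<^sub>R v) u - ddir f (x + s *\<^sub>R u + 0 *\<^sub>R v) u
     = h * ddir (\<lambda>y. ddir f y u) (x + s *\<^sub>R u + t *\<^sub>R v) v" by auto
  with s show ?thesis by (intro exI[of _ s] exI[of _ t]) (simp add: algebra_simps)
qed

text \<open>Schwarz's theorem: one and the same second difference over a small parallelogram is
  \<open>h * h\<close> times either mixed derivative at a nearby point, and both are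
  continuous.\<close>

lemma second_derivative_symmetric_real:
  fixes f :: "'a::euclidean_space \<Rightarrow> real"
  assumes "open S" "Ck_on 2 S f" "x \<in> S"
  shows "ddir (\<lambda>y. ddir f y u) x v = ddir (\<lambda>y. ddir f y v) x u"
proof (rule ccontr)
  let ?A = "\<lambda>y. ddir (\<lambda>y. ddir f y u) y v" and ?B = "\<lambda>y. ddir (\<lambda>y. ddir f y v) y u"
  assume ne: "?A x \<noteq> ?B x"
  define e where "e = dist (?A x) (?B x) / 2"
  have e: "e > 0" using ne by (simp add: e_def)
  have k2: "Ck_on (Suc (Suc 0)) S f" using assms(2) by (simp add: numeral_2_eq_2)
  then have cA: "continuous_on S ?A" and cB: "continuous_on S ?B" by auto
  obtain a where a: "a > 0" "ball x a \<subseteq> S" using assms(1,3) openE by blast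
  obtain b where b: "b > 0" "\<And>y. y \<in> S \<Longrightarrow> dist y x < b \<Longrightarrow> dist (?A y) (?A x) < e"
    using cA assms(3) e unfolding continuous_on_iff by metis
  obtain c where c: "c > 0" "\<And>y. y \<in> S \<Longrightarrow> dist y x < c \<Longrightarrow> dist (?B y) (?B x) < e"
    using cB assms(3) e unfolding continuous_on_iff by metis
  define d where "d = min a (min b c)"
  \<comment> \<open>The summand 1 prevents division by zero; the parallelogram with sides
    \<open>h *\<^sub>R u\<close> and \<open>h *\<^sub>R v\<close> then stays within
    \<open>d / 2\<close> of \<open>x\<close>.\<close>
  define h where "h = d / (2 * (norm u + norm v + 1))"
  have d: "d > 0" using a b c by (simp add: d_def)
  have n1: "norm u + norm v + 1 > 0" by (simp add: add_nonneg_pos)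
  have h: "h > 0" using d n1 by (simp add: h_def)
  have near: "dist (x + s *\<^sub>R p + t *\<^sub>R q) x < d"
    if "0 \<le> s" "s \<le> h" "0 \<le> t" "t \<le> h" "norm p + norm q \<le> norm u + norm v" for s t p q
  proof -
    have "dist (x + s *\<^sub>R p + t *\<^sub>R q) x \<le> s * norm p + t * norm q"
      using norm_triangle_ineq[of "s *\<^sub>R p" "t *\<^sub>R q"] that by (simp add: dist_norm algebra_simps)
    also have "\<dots> \<le> h * norm p + h * norm q"
      using that by (intro add_mono mult_right_mono) auto
    also have "\<dots> \<le> h * (norm u + norm v + 1)"
      using that h by (simp add: distrib_left[symmetric])
    also have "\<dots> = d / 2" using n1 by (simp add: h_def field_simps)
    finally show ?thesis using d by simp
  qed
  have inS: "x + s *\<^sub>R p + t *\<^sub>R q \<in> S"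
    if "0 \<le> s" "s \<le> h" "0 \<le> t" "t \<le> h" "norm p + norm q \<le> norm u + norm v" for s t p q
    using near[OF that] a(2) by (auto simp: d_def dist_commute)
  obtain s t where st: "0 < s" "s < h" "0 < t" "t < h"
    "f (x + h *\<^sub>R u + h *\<^sub>R v) - f (x + h *\<^sub>R u) - f (x + h *\<^sub>R v) + f x = h * h * ?A (x + s *\<^sub>R u + t *\<^sub>R v)"
    using second_difference_mean_value[OF assms(1,2) h, of x u v] inS by auto
  obtain s' t' where st': "0 < s'" "s' < h" "0 < t'" "t' < h"
    "f (x + h *\<^sub>R v + h *\<^sub>R u) - f (x + h *\<^sub>R v) - f (x + h *\<^sub>R u) + f x = h * h * ?B (x + s' *\<^sub>R v + t' *\<^sub>R u)"
    using second_difference_mean_value[OF assms(1,2) h, of x v u] inS by (auto simp: add.commute)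
  have "h * h * ?A (x + s *\<^sub>R u + t *\<^sub>R v) = h * h * ?B (x + s' *\<^sub>R v + t' *\<^sub>R u)"
    using st(5) st'(5) by (simp add: algebra_simps)
  then have eq: "?A (x + s *\<^sub>R u + t *\<^sub>R v) = ?B (x + s' *\<^sub>R v + t' *\<^sub>R u)" using h by simp
  have "dist (?A (x + s *\<^sub>R u + t *\<^sub>R v)) (?A x) < e"
    using near[of s t u v] inS[of s t u v] st by (intro b) (auto simp: d_def)
  moreover have "dist (?B (x + s' *\<^sub>R v + t' *\<^sub>R u)) (?B x) < e"
    using near[of s' t' v u] inS[of s' t' v u] st' by (intro c) (auto simp: d_def)
  ultimately have "dist (?A x) (?B x) < e + e"
    using dist_triangle[of "?A x" "?B x" "?A (x + s *\<^sub>R u + t *\<^sub>R v)"] eq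
    by (simp add: dist_commute)
  then show False by (simp add: e_def)
qed

lemma second_derivative_symmetric:
  fixes f :: "'a::euclidean_space \<Rightarrow> 'b::euclidean_space"
  assumes S: "open S" and f: "smooth_on S f" and x: "x \<in> S"
  shows "ddir (\<lambda>y. ddir f y u) x v = ddir (\<lambda>y. ddir f y v) x u"
proof (rule euclidean_eqI)
  fix b :: 'b assume "b \<in> Basis"
  have i: "ddir (\<lambda>y. g y \<bullet> b) y w = ddir g y w \<bullet> b" if "smooth_on S g" "y \<in> S" for g :: "'a \<Rightarrow> 'b" and y w
    by (rule frechet_derivative_at[THEN fun_cong, symmetric])
       (rule bounded_linear.has_derivative[OF bounded_linear_inner_left smooth_on_has_derivative[OF S that]])
  have ii: "ddir (\<lambda>y. ddir (\<lambda>y. f y \<bullet> b) y w) x z = ddir (\<lambda>y. ddir f y w) x z \<bullet> b" for w z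
  proof -
    have sm: "smooth_on S (\<lambda>y. ddir f y w)" by (rule smooth_on_ddir[OF f])
    have "ddir (\<lambda>y. ddir f y w \<bullet> b) x z = ddir (\<lambda>y. ddir (\<lambda>y. f y \<bullet> b) y w) x z"
      using frechet_derivative_transform_within_open[OF _ S x, of "\<lambda>y. ddir f y w \<bullet> b" "\<lambda>y. ddir (\<lambda>y. f y \<bullet> b) y w"]
        i[OF f] bounded_linear.has_derivative[OF bounded_linear_inner_left[of b] smooth_on_has_derivative[OF S sm x]]
      by (metis differentiableI)
    with i[OF sm x] show ?thesis by simp
  qed
  have "smooth_on S (\<lambda>y. f y \<bullet> b)" by (intro smooth_intros S f)
  then show "ddir (\<lambda>y. ddir f y u) x v \<bullet> b = ddir (\<lambda>y. ddir f y v) x u \<bullet> b"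
    using second_derivative_symmetric_real[OF S _ x] ii unfolding smooth_on_def by metis
qed

subsection \<open>Smooth families of linear isomorphisms and inverse functions\<close>

lemma Ck_on_prod:
  fixes f :: "'i \<Rightarrow> 'a::euclidean_space \<Rightarrow> 'b::real_normed_field"
  shows "open S \<Longrightarrow> (\<And>i. i \<in> I \<Longrightarrow> Ck_on k S (f i)) \<Longrightarrow> Ck_on k S (\<lambda>x. \<Prod>i\<in>I. f i x)"
  by (induction I rule: infinite_finite_induct)
     (auto intro: bounded_bilinear.Ck_on[OF bounded_bilinear_mult] Ck_on_const)

lemma Ck_on_det:
  fixes M :: "'a::euclidean_space \<Rightarrow> real^'n^'n"
  assumes "open S" "\<And>i j. Ck_on k S (\<lambda>x. M x $ i $ j)"
  shows "Ck_on k S (\<lambda>x. det (M x))"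
  unfolding det_def
  by (intro Ck_on_sum Ck_on_prod bounded_bilinear.Ck_on[OF bounded_bilinear_mult] Ck_on_const assms)

text \<open>Cramer's rule; the index type 'n only enumerates the basis.\<close>

lemma Ck_on_inv_linear_aux:
  fixes A :: "'c::euclidean_space \<Rightarrow> 'a::euclidean_space \<Rightarrow> 'a" and e :: "'n::finite \<Rightarrow> 'a"
  assumes e: "bij_betw e UNIV Basis" and S: "open S"
    and lin: "\<And>y. y \<in> S \<Longrightarrow> linear (A y)" and inj: "\<And>y. y \<in> S \<Longrightarrow> inj (A y)"
    and A: "\<And>v. Ck_on k S (\<lambda>y. A y v)" and w: "Ck_on k S w"
  shows "Ck_on k S (\<lambda>y. inv (A y) (w y))"
proof -
  define M where "M y = (\<chi> i j. A y (e j) \<bullet> e i)" for y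
  define W where "W y = (\<chi> i. w y \<bullet> e i)" for y
  define D where "D y j = (\<chi> i l. if l = j then W y $ i else M y $ i $ l)" for y j
  have eb: "e i \<in> Basis" for i using e by (auto simp: bij_betw_def)
  have ee: "e i \<bullet> e j = (if i = j then 1 else 0)" for i j
    using e eb by (auto simp: inner_Basis bij_betw_def dest: injD)
  have Mv: "(M y *v z) $ i = A y (\<Sum>j\<in>UNIV. z $ j *\<^sub>R e j) \<bullet> e i" if "y \<in> S" for y z i
    using lin[OF that]
    by (simp add: M_def matrix_vector_mult_def linear_sum linear_cmul inner_sum_left mult.commute)
  have eqI: "p = q" if "\<And>i. p \<bullet> e i = q \<bullet> e i" for p q
  proof (rule euclidean_eqI)
    fix b :: 'a assume "b \<in> Basis"
    then obtain i where "b = e i" using bij_betw_imp_surj_on[OF e] by auto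
    then show "p \<bullet> b = q \<bullet> b" by (simp add: that)
  qed
  have detM: "det (M y) \<noteq> 0" if y: "y \<in> S" for y
  proof -
    have "z = 0" if "M y *v z = 0" for z
    proof -
      have "A y (\<Sum>j\<in>UNIV. z $ j *\<^sub>R e j) = 0"
        using Mv[OF y, of z] that by (intro eqI) simp
      then have s0: "(\<Sum>j\<in>UNIV. z $ j *\<^sub>R e j) = 0"
        using injD[OF inj[OF y], of _ 0] linear_0[OF lin[OF y]] by simp
      have "z $ i = 0" for i
      proof -
        have "(\<Sum>j\<in>UNIV. z $ j *\<^sub>R e j) \<bullet> e i = z $ i" by (simp add: inner_sum_left ee if_distrib cong: if_cong)
        with s0 show ?thesis by simp
      qed
      then show ?thesis by (simp add: vec_eq_iff)
    qed
    then show ?thesis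
      by (metis invertible_det_nz invertible_left_inverse matrix_left_invertible_ker)
  qed
  have sol: "inv (A y) (w y) = (\<Sum>j\<in>UNIV. (det (D y j) * inverse (det (M y))) *\<^sub>R e j)" if y: "y \<in> S" for y
  proof -
    have "M y *v (\<chi> j. det (D y j) / det (M y)) = W y"
      using cramer[OF detM[OF y]] by (simp add: D_def)
    then have "A y (\<Sum>j\<in>UNIV. (det (D y j) / det (M y)) *\<^sub>R e j) \<bullet> e i = w y \<bullet> e i" for i
      using Mv[OF y, of "\<chi> j. det (D y j) / det (M y)" i] by (simp add: W_def)
    then have "A y (\<Sum>j\<in>UNIV. (det (D y j) / det (M y)) *\<^sub>R e j) = w y"
      by (rule eqI)
    from inv_f_eq[OF inj[OF y] this] show ?thesis by (simp add: divide_inverse)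
  qed
  have cM: "Ck_on k S (\<lambda>y. M y $ i $ j)" for i j
    unfolding M_def by (simp, intro bounded_linear.Ck_on[OF bounded_linear_inner_left] S A)
  have cW: "Ck_on k S (\<lambda>y. W y $ i)" for i
    unfolding W_def by (simp, intro bounded_linear.Ck_on[OF bounded_linear_inner_left] S w)
  have cD: "Ck_on k S (\<lambda>y. D y j $ i $ l)" for i j l
    unfolding D_def using cM cW by (cases "l = j") auto
  have "Ck_on k S (\<lambda>y. inv (A y) (w y)) \<longleftrightarrow>
      Ck_on k S (\<lambda>y. \<Sum>j\<in>UNIV. (det (D y j) * inverse (det (M y))) *\<^sub>R e j)"
    by (rule Ck_on_cong[OF S]) (rule sol)
  moreover have "Ck_on k S (\<lambda>y. \<Sum>j\<in>UNIV. (det (D y j) * inverse (det (M y))) *\<^sub>R e j)"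
    by (intro Ck_on_sum S bounded_bilinear.Ck_on[OF bounded_bilinear_scaleR]
        bounded_bilinear.Ck_on[OF bounded_bilinear_mult] Ck_on_const Ck_on_inverse[OF S _ detM] Ck_on_det cD cM)
  ultimately show ?thesis by blast
qed

lemma Ck_on_inv_linear:
  fixes A :: "'c::euclidean_space \<Rightarrow> complex \<times> complex \<Rightarrow> complex \<times> complex"
  assumes "open S" "\<And>y. y \<in> S \<Longrightarrow> linear (A y)" "\<And>y. y \<in> S \<Longrightarrow> inj (A y)"
    and "\<And>v. Ck_on k S (\<lambda>y. A y v)" "Ck_on k S w"
  shows "Ck_on k S (\<lambda>y. inv (A y) (w y))"
proof -
  \<comment> \<open>The real dimension is four, so the numeral type \<open>4\<close> can enumerate
    the basis.\<close>
  have "card (UNIV :: 4 set) = card (Basis :: (complex \<times> complex) set)"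
    by simp
  then obtain e :: "4 \<Rightarrow> complex \<times> complex" where "bij_betw e UNIV Basis"
    using finite_same_card_bij[OF finite finite_Basis] by blast
  from Ck_on_inv_linear_aux[OF this assms] show ?thesis .
qed

lemma smooth_on_inv_linear:
  fixes A :: "'c::euclidean_space \<Rightarrow> complex \<times> complex \<Rightarrow> complex \<times> complex"
  assumes "open S" "\<And>y. y \<in> S \<Longrightarrow> linear (A y)" "\<And>y. y \<in> S \<Longrightarrow> inj (A y)"
    and "\<And>v. smooth_on S (\<lambda>y. A y v)" "smooth_on S w"
  shows "smooth_on S (\<lambda>y. inv (A y) (w y))"
  using assms(4,5) unfolding smooth_on_def
  by (intro allI Ck_on_inv_linear[OF assms(1,2,3)]) auto

text \<open>Openness of the image is invariance of domain. Smoothness is a bootstrap: the derivative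
  of the inverse function at \<open>y\<close> inverts \<open>ddir f (?g y)\<close>, and by Cramer's
  rule it is as regular as \<open>?g\<close> itself.\<close>

lemma smooth_inverse_function:
  fixes f :: "complex \<times> complex \<Rightarrow> complex \<times> complex"
  assumes S: "open S" and f: "smooth_on S f" and inj: "inj_on f S"
    and surj: "\<And>x. x \<in> S \<Longrightarrow> surj (ddir f x)"
  shows "open (f ` S)" and "smooth_on (f ` S) (inv_into S f)"
    and "\<And>x. x \<in> S \<Longrightarrow> (inv_into S f has_derivative inv (ddir f x)) (at (f x))"
proof -
  let ?g = "inv_into S f"
  have df: "(f has_derivative ddir f x) (at x)" if "x \<in> S" for x
    by (rule smooth_on_has_derivative[OF S f that])
  have lin: "linear (ddir f x)" if "x \<in> S" for x
    using df[OF that] by (rule has_derivative_linear)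
  have injd: "inj (ddir f x)" if "x \<in> S" for x
    using linear_surjective_imp_injective[OF lin[OF that]] surj[OF that] by blast
  show op: "open (f ` S)"
    by (rule invariance_of_domain[OF smooth_on_continuous[OF f] S inj])
  show dg: "(?g has_derivative inv (ddir f x)) (at (f x))" if x: "x \<in> S" for x
  proof (rule has_derivative_inverse_strong[OF S x smooth_on_continuous[OF f] _ df[OF x]])
    show "?g (f x) = x" if "x \<in> S" for x using inj that by simp
    show "ddir f x \<circ> inv (ddir f x) = id" using surj[OF x] surj_iff by blast
  qed
  then have dg': "(?g has_derivative inv (ddir f (?g y))) (at y)" if "y \<in> f ` S" for y
    using that inj by auto
  have gS: "?g ` f ` S \<subseteq> S" using inv_into_into[of _ f S] by blast
  have "Ck_on k (f ` S) ?g" for k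
  proof (induction k)
    case 0
    show ?case unfolding Ck_on.simps
      by (blast intro: continuous_at_imp_continuous_on has_derivative_continuous[OF dg'])
  next
    case (Suc k)
    have "Ck_on k S (\<lambda>x. ddir f x v)" for v using f unfolding smooth_on_def by (metis Ck_on.simps(2))
    then have "Ck_on k (f ` S) (\<lambda>y. ddir f (?g y) v)" for v
      by (intro Ck_on_compose[OF op S gS Suc])
    then have "Ck_on k (f ` S) (\<lambda>y. inv (ddir f (?g y)) v)" for v
      using gS by (intro Ck_on_inv_linear op lin injd Ck_on_const) auto
    then show ?case by (intro Ck_on_SucI[OF op dg'])
  qed
  then show "smooth_on (f ` S) ?g" by (simp add: smooth_on_def)
qed

section \<open>Immersions into the complex quadric\<close>

text \<open>
  The triple (a, b, c) stands for the traceless matrix with rows (a, b) and (-c, -a); the quadratic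
  form is minus the determinant, and \<open>ccross\<close> is half the commutator.
\<close>

declare split_paired_All [simp del]

type_synonym cvec = "(complex \<times> complex) \<times> complex"

definition qform :: "cvec \<Rightarrow> cvec \<Rightarrow> complex" where
  "qform X Y = fst (fst X) * fst (fst Y) - (snd (fst X) * snd Y + snd (fst Y) * snd X) / 2"

definition cscale :: "complex \<Rightarrow> cvec \<Rightarrow> cvec" where
  "cscale l X = ((l * fst (fst X), l * snd (fst X)), l * snd X)"

definition ccross :: "cvec \<Rightarrow> cvec \<Rightarrow> cvec" where
  "ccross X Y = (((snd (fst Y) * snd X - snd (fst X) * snd Y) / 2,
     fst (fst X) * snd (fst Y) - fst (fst Y) * snd (fst X)),
     snd X * fst (fst Y) - snd Y * fst (fst X))"

lemma bounded_bilinearI_euclidean: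
  fixes f :: "'a::euclidean_space \<Rightarrow> 'b::euclidean_space \<Rightarrow> 'c::real_normed_vector"
  assumes "\<And>x y z. f (x + y) z = f x z + f y z" "\<And>x y z. f x (y + z) = f x y + f x z"
    "\<And>r x y. f (r *\<^sub>R x) y = r *\<^sub>R f x y" "\<And>r x y. f x (r *\<^sub>R y) = r *\<^sub>R f x y"
  shows "bounded_bilinear f"
  unfolding bilinear_conv_bounded_bilinear[symmetric] bilinear_def
  using assms by (simp add: linear_iff)

interpretation qform: bounded_bilinear qform
  by (rule bounded_bilinearI_euclidean) (simp_all add: qform_def algebra_simps scaleR_conv_of_real add_divide_distrib)

interpretation cscale: bounded_bilinear cscale
  by (rule bounded_bilinearI_euclidean) (simp_all add: cscale_def algebra_simps prod_eq_iff)

interpretation ccross: bounded_bilinear ccross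
  by (rule bounded_bilinearI_euclidean)
     (simp_all add: ccross_def algebra_simps prod_eq_iff add_divide_distrib diff_divide_distrib scaleR_conv_of_real)

lemma qform_commute: "qform X Y = qform Y X"
  by (simp add: qform_def algebra_simps)

lemma qform_cscale [simp]: "qform (cscale l X) Y = l * qform X Y" "qform X (cscale l Y) = l * qform X Y"
  by (simp_all add: qform_def cscale_def field_simps)

lemma cscale_cscale [simp]: "cscale l (cscale m X) = cscale (l * m) X"
  by (simp add: cscale_def mult.assoc)

lemma cscale_of_real: "cscale (of_real r) X = r *\<^sub>R X"
  by (simp add: cscale_def prod_eq_iff scaleR_conv_of_real)

lemma cscale_1 [simp]: "cscale 1 X = X"
  by (simp add: cscale_def)

lemma cscale_eq_0_iff [simp]: "cscale l X = 0 \<longleftrightarrow> l = 0 \<or> X = 0"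
  by (auto simp: cscale_def prod_eq_iff)

lemma ccross_cscale [simp]: "ccross X (cscale l Y) = cscale l (ccross X Y)"
  by (simp add: ccross_def cscale_def prod_eq_iff field_simps)

text \<open>The triple product identity. At a point with \<open>qform X X = 1\<close> it makes
  \<open>ccross X\<close> an involution on tangent vectors, so its multiple by \<open>\<i>\<close>
  squares to -1.\<close>

lemma ccross_ccross: "ccross X (ccross X Y) = cscale (qform X X) Y - cscale (qform X Y) X"
  by (simp add: ccross_def cscale_def qform_def prod_eq_iff field_simps)

lemma qform_ccross_left: "qform X (ccross X Y) = 0"
  by (simp add: ccross_def qform_def field_simps)

text \<open>Invariance of the trace form of sl(2, C): \<open>ccross X\<close> is skew for
  \<open>qform\<close>.\<close>

lemma qform_ccross_swap: "qform (ccross X Y) Z = - qform (ccross X Z) Y"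
  by (simp add: ccross_def qform_def field_simps)

lemma qform_ccross_same [simp]: "qform (ccross X Y) Y = 0"
  by (simp add: ccross_def qform_def field_simps)

lemma qform_nondegenerate: "(\<And>Y. qform X Y = 0) \<Longrightarrow> X = 0"
  using qform_def[of X "((1,0),0)"] qform_def[of X "((0,1),0)"] qform_def[of X "((0,0),1)"]
  by (simp add: prod_eq_iff)

text \<open>The product of two tangent vectors commutes with \<open>X\<close>, hence is a multiple
  of \<open>X\<close> and orthogonal to the third vector. Closedness of the symplectic form rests on
  this.\<close>

lemma triple_product_orthogonal:
  assumes "qform X X = 1" "qform X U = 0" "qform X V = 0" "qform X W = 0"
  shows "qform (ccross U V) W = 0"
proof -
  have "ccross X (ccross U V) = cscale (qform X U) V - cscale (qform X V) U"
    by (simp add: ccross_def cscale_def qform_def prod_eq_iff field_simps)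
  then have "ccross X (ccross U V) = 0" using assms by (simp add: cscale.zero_left)
  with ccross_ccross[of X "ccross U V"] have "ccross U V = cscale (qform X (ccross U V)) X"
    by (simp add: assms ccross.zero_right)
  then have "qform (ccross U V) W = qform X (ccross U V) * qform X W" by (metis qform_cscale(1))
  then show ?thesis by (simp add: assms)
qed

lemma trace_commute:
  fixes f g :: "'a::euclidean_space \<Rightarrow> 'a"
  assumes "linear f" "linear g"
  shows "(\<Sum>b\<in>Basis. f (g b) \<bullet> b) = (\<Sum>b\<in>Basis. g (f b) \<bullet> b)"
proof -
  have *: "f (g b) \<bullet> b = (\<Sum>c\<in>Basis. (g b \<bullet> c) * (f c \<bullet> b))" if "linear f" for f g :: "'a \<Rightarrow> 'a" and b
    by (subst linear_basis_expansion[OF that]) (simp add: inner_sum_left)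
  have "(\<Sum>b\<in>Basis. f (g b) \<bullet> b) = (\<Sum>b\<in>Basis. \<Sum>c\<in>Basis. (g b \<bullet> c) * (f c \<bullet> b))"
    by (simp add: *[OF assms(1)])
  also have "\<dots> = (\<Sum>c\<in>Basis. \<Sum>b\<in>Basis. (f c \<bullet> b) * (g b \<bullet> c))"
    by (subst sum.swap) (simp add: mult.commute)
  also have "\<dots> = (\<Sum>b\<in>Basis. g (f b) \<bullet> b)" by (simp add: *[OF assms(2)])
  finally show ?thesis .
qed

lemma sum_Basis_Pair:
  "(\<Sum>b\<in>(Basis :: ('a::euclidean_space \<times> 'b::euclidean_space) set). g b)
     = (\<Sum>b\<in>Basis. g (b, 0)) + (\<Sum>b\<in>Basis. g (0, b))"
proof -
  have "inj_on (\<lambda>u. (u::'a, 0::'b)) Basis" "inj_on (\<lambda>u. (0::'a, u::'b)) Basis"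
    by (auto simp: inj_on_def)
  then show ?thesis
    unfolding Basis_prod_def
    by (subst sum.union_disjoint) (auto simp: sum.reindex)
qed

lemma trace_cscale_ii: "(\<Sum>b\<in>Basis. cscale \<i> b \<bullet> b) = 0"
  by (simp add: sum_Basis_Pair Basis_complex_def cscale_def)

lemma sharp_eqI:
  assumes "\<And>w. g x z w = \<alpha> w" "nondegenerate (g x)" "\<And>w. linear (\<lambda>v. g x v w)"
  shows "sharp g x \<alpha> = z"
  unfolding sharp_def
proof (rule the_equality)
  fix y assume "\<forall>w. g x y w = \<alpha> w"
  then have "g x (y - z) w = 0" for w using assms(1) linear_diff[OF assms(3)] by simp
  then have "y - z = 0" using assms(2) unfolding nondegenerate_def by blast
  then show "y = z" by simp
qed (use assms(1) in simp)

definition induced_metric :: "(complex \<times> complex \<Rightarrow> cvec) \<Rightarrow> complex \<times> complex \<Rightarrow> complex \<times> complex \<Rightarrow> complex \<times> complex \<Rightarrow> real"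
  where "induced_metric X x v w = Im (qform (ddir X x v) (ddir X x w))"

text \<open>The sign is the one for which inserting \<open>induced_J\<close> into the first argument
  produces \<open>induced_metric\<close>.\<close>

definition induced_form :: "(complex \<times> complex \<Rightarrow> cvec) \<Rightarrow> complex \<times> complex \<Rightarrow> complex \<times> complex \<Rightarrow> complex \<times> complex \<Rightarrow> real"
  where "induced_form X x v w = - Re (qform (ccross (X x) (ddir X x v)) (ddir X x w))"

definition induced_J :: "(complex \<times> complex \<Rightarrow> cvec) \<Rightarrow> complex \<times> complex \<Rightarrow> complex \<times> complex \<Rightarrow> complex \<times> complex"
  where "induced_J X x v = inv (ddir X x) (cscale \<i> (ccross (X x) (ddir X x v)))"

text \<open>The quadric has complex dimension 2, so four real parameters and an injective derivative
  make \<open>X\<close> a local parametrisation of it.\<close>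

locale quadric_immersion =
  fixes S :: "(complex \<times> complex) set" and X :: "complex \<times> complex \<Rightarrow> cvec"
  assumes open_S: "open S" and smooth_X: "smooth_on S X"
    and unit: "x \<in> S \<Longrightarrow> qform (X x) (X x) = 1"
    and inj_DX: "x \<in> S \<Longrightarrow> inj (ddir X x)"
begin

abbreviation "q x v w \<equiv> qform (ddir X x v) (ddir X x w)"
abbreviation "D2 x u v \<equiv> ddir (\<lambda>y. ddir X y v) x u"
abbreviation "D3 x u v w \<equiv> ddir (\<lambda>y. D2 y v w) x u"
abbreviation "pull x Y \<equiv> inv (ddir X x) Y"

lemma DX: "x \<in> S \<Longrightarrow> (X has_derivative ddir X x) (at x)"
  by (rule smooth_on_has_derivative[OF open_S smooth_X])

lemma linear_DX: "x \<in> S \<Longrightarrow> linear (ddir X x)"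
  using DX by (rule has_derivative_linear)

lemma smooth_DX: "smooth_on S (\<lambda>x. ddir X x v)"
  by (rule smooth_on_ddir[OF smooth_X])

lemma DDX: "x \<in> S \<Longrightarrow> ((\<lambda>y. ddir X y v) has_derivative (\<lambda>u. D2 x u v)) (at x)"
  by (rule smooth_on_has_derivative[OF open_S smooth_DX])

lemma smooth_D2: "smooth_on S (\<lambda>x. D2 x u v)"
  by (rule smooth_on_ddir[OF smooth_DX])

lemma D2_commute: "x \<in> S \<Longrightarrow> D2 x u v = D2 x v u"
  by (rule second_derivative_symmetric[OF open_S smooth_X])

lemma D3_commute: "x \<in> S \<Longrightarrow> D3 x u v w = D3 x v u w"
  by (rule second_derivative_symmetric[OF open_S smooth_DX])

lemma constant_on_open_derivative:
  assumes "x \<in> S" "\<And>y. y \<in> S \<Longrightarrow> f y = c" "(f has_derivative f') (at x)"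
  shows "f' v = 0"
proof -
  have "((\<lambda>y. c) has_derivative f') (at x)"
    by (rule has_derivative_transform_within_open[OF assms(3) open_S assms(1) assms(2)])
  then have "f' = (\<lambda>v. 0)" using has_derivative_unique has_derivative_const by blast
  then show ?thesis by simp
qed

lemma qform_X_DX: assumes "x \<in> S" shows "qform (X x) (ddir X x v) = 0"
proof -
  have "((\<lambda>y. qform (X y) (X y)) has_derivative (\<lambda>v. qform (X x) (ddir X x v) + qform (ddir X x v) (X x))) (at x)"
    by (rule qform.FDERIV[OF DX DX]) fact+
  from constant_on_open_derivative[OF assms unit this] show ?thesis by (simp add: qform_commute)
qed

lemma qform_X_D2: assumes "x \<in> S" shows "qform (X x) (D2 x u v) = - q x u v"
proof -
  have "((\<lambda>y. qform (X y) (ddir X y v)) has_derivative (\<lambda>u. qform (X x) (D2 x u v) + q x u v)) (at x)"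
    by (rule qform.FDERIV[OF DX DDX]) fact+
  from constant_on_open_derivative[OF assms qform_X_DX this, of u] show ?thesis by (simp add: eq_neg_iff_add_eq_0)
qed

text \<open>Splits C^3 into the tangent space and the complex line through \<open>X x\<close>.
  Domain and target have the same six-dimensional type, so injectivity implies surjectivity and
  traces can be transported.\<close>

definition "frame x = (\<lambda>(v, l). ddir X x v + cscale l (X x))"

lemma linear_frame: assumes "x \<in> S" shows "linear (frame x)"
proof (rule linearI)
  show "frame x (p + p') = frame x p + frame x p'" for p p'
    using linear_DX[OF assms] by (simp add: frame_def split_beta linear_add cscale.add_left)
  show "frame x (r *\<^sub>R p) = r *\<^sub>R frame x p" for r p
    using linear_DX[OF assms] by (simp add: frame_def split_beta linear_cmul cscale.scaleR_left scaleR_add_right)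
qed

lemma qform_X_frame: assumes "x \<in> S" shows "qform (X x) (frame x p) = snd p"
  by (simp add: frame_def split_beta qform.add_right qform_X_DX unit assms)

lemma inj_frame: assumes "x \<in> S" shows "inj (frame x)"
  unfolding linear_injective_0[OF linear_frame[OF assms]]
proof (intro allI impI)
  fix p assume p: "frame x p = 0"
  then have "snd p = 0" using qform_X_frame[OF assms, of p] by (simp add: qform.zero_right)
  moreover from this p have "ddir X x (fst p) = 0" by (simp add: frame_def split_beta cscale.zero_left)
  then have "fst p = 0" using injD[OF inj_DX[OF assms]] linear_0[OF linear_DX[OF assms]] by metis
  ultimately show "p = 0" by (simp add: prod_eq_iff)
qed

lemma surj_frame: "x \<in> S \<Longrightarrow> surj (frame x)"
  by (rule linear_injective_imp_surjective) (auto intro: linear_frame inj_frame)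

text \<open>The image of the derivative is the whole orthogonal complement of \<open>X x\<close>,
  hence a complex subspace, although \<open>X\<close> is only real differentiable. This allows
  tangent vectors to be multiplied by \<open>\<i>\<close>.\<close>

lemma tangent_in_range:
  assumes "x \<in> S" "qform (X x) Y = 0" obtains v where "Y = ddir X x v"
proof -
  obtain p where p: "Y = frame x p" using surj_frame[OF assms(1)] by (rule surjE)
  then have "snd p = 0" using qform_X_frame[OF assms(1), of p] assms(2) by simp
  with p have "Y = ddir X x (fst p)" by (simp add: frame_def split_beta cscale.zero_left)
  then show ?thesis by (rule that)
qed

lemma DX_pull: "x \<in> S \<Longrightarrow> qform (X x) Y = 0 \<Longrightarrow> ddir X x (pull x Y) = Y"
  by (metis tangent_in_range f_inv_into_f rangeI)

lemma DX_eq_iff: "x \<in> S \<Longrightarrow> ddir X x v = ddir X x w \<longleftrightarrow> v = w"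
  using inj_DX by (simp add: inj_eq)

lemma metric_left_linear: "x \<in> S \<Longrightarrow> linear (\<lambda>v. induced_metric X x v w)"
  unfolding induced_metric_def using linear_DX
  by (intro linearI) (simp_all add: linear_add linear_cmul qform.add_left qform.scaleR_left)

lemma metric_sym: "induced_metric X x v w = induced_metric X x w v"
  by (simp add: induced_metric_def qform_commute)

lemma metric_bilinear: assumes "x \<in> S" shows "bilinear (induced_metric X x)"
proof -
  have "linear (induced_metric X x v)" for v
  proof -
    have "induced_metric X x v = (\<lambda>w. induced_metric X x w v)" by (intro ext metric_sym)
    then show ?thesis using metric_left_linear[OF assms, of v] by simp
  qed
  then show ?thesis by (simp add: bilinear_def metric_left_linear assms)
qed

text \<open>Testing against \<open>w\<close> and \<open>i w\<close> recovers the complex form from its imaginary part.\<close>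

lemma Im_qform_tangent_0:
  assumes "x \<in> S" "qform (X x) Y = 0" "\<And>w. Im (qform Y (ddir X x w)) = 0"
  shows "Y = 0"
proof (rule qform_nondegenerate)
  fix Z
  obtain p where p: "Z = frame x p" using surj_frame[OF assms(1)] by (rule surjE)
  let ?W = "ddir X x (fst p)"
  have "Re (qform Y ?W) = 0"
  proof -
    have "qform (X x) (cscale \<i> ?W) = 0" by (simp add: qform_X_DX assms(1))
    then obtain w where "cscale \<i> ?W = ddir X x w" using tangent_in_range[OF assms(1)] by metis
    then have "Im (qform Y (cscale \<i> ?W)) = 0" using assms(3) by simp
    then show ?thesis by simp
  qed
  with assms(3) have "qform Y ?W = 0" by (simp add: complex_eq_iff)
  then show "qform Y Z = 0"
    using assms(2) by (simp add: p frame_def split_beta qform.add_right qform_commute[of Y "X x"])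
qed

lemma metric_nondegenerate: assumes "x \<in> S" shows "nondegenerate (induced_metric X x)"
  unfolding nondegenerate_def induced_metric_def
proof (intro allI impI)
  fix v assume "\<forall>w. Im (q x v w) = 0"
  then have "ddir X x v = 0" by (intro Im_qform_tangent_0[OF assms] qform_X_DX assms) blast
  then show "v = 0" using DX_eq_iff[OF assms, of v 0] linear_0[OF linear_DX[OF assms]] by simp
qed

lemma smooth_metric: "smooth_on S (\<lambda>x. induced_metric X x v w)"
  unfolding induced_metric_def
  by (intro smooth_intros open_S qform.smooth_on smooth_DX)

text \<open>The derivative of \<open>X\<close> maps four real dimensions into six and cannot be
  inverted by \<open>smooth_on_inv_linear\<close>. Pairing the equation for the preimage with the
  basis replaces it by one for the Gram matrix \<open>A\<close>, which is square, smooth and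
  injective by nondegeneracy.\<close>

lemma smooth_pull:
  assumes Y: "smooth_on S Y" and t: "\<And>x. x \<in> S \<Longrightarrow> qform (X x) (Y x) = 0"
  shows "smooth_on S (\<lambda>x. pull x (Y x))"
proof -
  define A where "A x v = (\<Sum>b\<in>Basis. induced_metric X x v b *\<^sub>R b)" for x v
  define y where "y x = (\<Sum>b\<in>Basis. Im (qform (Y x) (ddir X x b)) *\<^sub>R b)" for x
  have lA: "linear (A x)" if "x \<in> S" for x
    unfolding A_def using metric_left_linear[OF that]
    by (intro linear_compose_sum ballI) (auto intro: linear_compose[OF _ bounded_linear.linear[OF bounded_linear_scaleR_left], unfolded o_def])
  have A_inner: "A x v \<bullet> w = induced_metric X x v w" if "x \<in> S" for x v w
  proof -
    have "linear (induced_metric X x v)" using metric_bilinear[OF that] by (simp add: bilinear_def)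
    from linear_basis_expansion[OF this, of w] show ?thesis
      by (simp add: A_def inner_sum_left inner_commute[of w] mult.commute)
  qed
  have y_inner: "y x = A x (pull x (Y x))" if "x \<in> S" for x
    by (simp add: y_def A_def induced_metric_def DX_pull[OF that t[OF that]])
  have iA: "inj (A x)" if "x \<in> S" for x
    unfolding linear_injective_0[OF lA[OF that]]
  proof (intro allI impI)
    fix v assume "A x v = 0"
    then have "induced_metric X x v w = 0" for w using A_inner[OF that, of v w] by simp
    then show "v = 0" using metric_nondegenerate[OF that] by (simp add: nondegenerate_def)
  qed
  have "smooth_on S (\<lambda>x. inv (A x) (y x))"
  proof (rule smooth_on_inv_linear[OF open_S lA iA])
    show "smooth_on S (\<lambda>x. A x v)" for v
      unfolding A_def by (intro smooth_intros open_S smooth_metric)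
    show "smooth_on S y"
      unfolding y_def by (intro smooth_intros open_S qform.smooth_on smooth_DX Y)
  qed
  moreover have "inv (A x) (y x) = pull x (Y x)" if "x \<in> S" for x
    using y_inner[OF that] iA[OF that] by (simp add: inv_f_f)
  ultimately show ?thesis
    using smooth_on_cong[OF open_S, of "\<lambda>x. inv (A x) (y x)" "\<lambda>x. pull x (Y x)"] by simp
qed

subsection \<open>The induced complex structure and symplectic form\<close>

lemma DX_J: "x \<in> S \<Longrightarrow> ddir X x (induced_J X x v) = cscale \<i> (ccross (X x) (ddir X x v))"
  unfolding induced_J_def by (rule DX_pull) (simp_all add: qform_ccross_left)

lemma smooth_J: "smooth_on S (\<lambda>x. induced_J X x v)"
  unfolding induced_J_def
  by (rule smooth_pull)
     (intro open_S cscale.smooth_on ccross.smooth_on smooth_on_const smooth_X smooth_DX, simp add: qform_ccross_left)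

lemma linear_J: assumes "x \<in> S" shows "linear (induced_J X x)"
proof (rule linearI)
  note [simp] = DX_J[OF assms] linear_add[OF linear_DX[OF assms]] linear_cmul[OF linear_DX[OF assms]]
  show "induced_J X x (v + w) = induced_J X x v + induced_J X x w" for v w
    unfolding DX_eq_iff[OF assms, symmetric] by (simp add: ccross.add_right cscale.add_right)
  show "induced_J X x (r *\<^sub>R v) = r *\<^sub>R induced_J X x v" for r v
    unfolding DX_eq_iff[OF assms, symmetric] by (simp add: ccross.scaleR_right cscale.scaleR_right)
qed

lemma ccross_X_ccross_X_DX: "x \<in> S \<Longrightarrow> ccross (X x) (ccross (X x) (ddir X x v)) = ddir X x v"
  by (simp add: ccross_ccross unit qform_X_DX cscale.zero_left)

lemma form_eq: "x \<in> S \<Longrightarrow> induced_form X x v w = - induced_metric X x (induced_J X x v) w"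
  by (simp add: induced_form_def induced_metric_def DX_J)

lemma metric_eq: "x \<in> S \<Longrightarrow> induced_metric X x v w = induced_form X x (induced_J X x v) w"
  by (simp add: induced_form_def induced_metric_def DX_J ccross_X_ccross_X_DX)

lemma form_J_J: assumes "x \<in> S" shows "induced_form X x (induced_J X x v) (induced_J X x w) = induced_form X x v w"
  using qform_ccross_swap[of "X x" "ccross (X x) (ddir X x w)" "ddir X x v"]
  by (simp add: induced_form_def DX_J assms ccross_X_ccross_X_DX qform_commute[of "ddir X x v"]
      qform_ccross_swap[of "X x" "ddir X x v"])

lemma form_antisym: "induced_form X x v w = - induced_form X x w v"
  by (simp add: induced_form_def qform_ccross_swap[of "X x" "ddir X x v"])

lemma form_bilinear: assumes "x \<in> S" shows "bilinear (induced_form X x)"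
proof -
  have "linear (\<lambda>v. induced_form X x v w)" for w
    unfolding induced_form_def using linear_DX[OF assms]
    by (intro linearI) (simp_all add: linear_add linear_cmul ccross.add_right ccross.scaleR_right qform.add_left qform.scaleR_left)
  moreover have "linear (induced_form X x v)" for v
    unfolding induced_form_def[abs_def] using linear_DX[OF assms]
    by (intro linearI) (simp_all add: linear_add linear_cmul qform.add_right qform.scaleR_right)
  ultimately show ?thesis by (simp add: bilinear_def)
qed

lemma form_nondegenerate: assumes "x \<in> S" shows "nondegenerate (induced_form X x)"
  unfolding nondegenerate_def
proof (intro allI impI)
  fix v assume v: "\<forall>w. induced_form X x v w = 0"
  then have "induced_J X x v = 0"
    using metric_nondegenerate[OF assms] by (simp add: form_eq[OF assms] nondegenerate_def)
  then have "ddir X x (induced_J X x (induced_J X x v)) = 0"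
    using linear_0[OF linear_J[OF assms]] linear_0[OF linear_DX[OF assms]] by simp
  then have "cscale (- 1) (ddir X x v) = 0"
    by (simp add: DX_J[OF assms] ccross_X_ccross_X_DX[OF assms])
  then have "ddir X x v = 0" by simp
  then show "v = 0" using DX_eq_iff[OF assms, of v 0] linear_0[OF linear_DX[OF assms]] by simp
qed

lemma smooth_form: "smooth_on S (\<lambda>x. induced_form X x v w)"
  unfolding induced_form_def
  by (intro smooth_intros open_S qform.smooth_on ccross.smooth_on smooth_DX smooth_X)

lemma form_derivative:
  assumes "x \<in> S"
  shows "ddir (\<lambda>y. induced_form X y v w) x u =
    - Re (qform (ccross (ddir X x u) (ddir X x v)) (ddir X x w) + qform (ccross (X x) (D2 x u v)) (ddir X x w)
        + qform (ccross (X x) (ddir X x v)) (D2 x u w))"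
proof -
  have "((\<lambda>y. induced_form X y v w) has_derivative
     (\<lambda>u. - Re (qform (ccross (X x) (ddir X x v)) (D2 x u w)
        + qform (ccross (X x) (D2 x u v) + ccross (ddir X x u) (ddir X x v)) (ddir X x w)))) (at x)"
    unfolding induced_form_def
    by (intro has_derivative_minus bounded_linear.has_derivative[OF bounded_linear_Re]
        qform.FDERIV ccross.FDERIV DX DDX assms)
  from frechet_derivative_at[OF this, symmetric] show ?thesis by (simp add: qform.add_left add_ac)
qed

text \<open>Differentiating the factor \<open>X\<close> leaves triple products of tangent vectors,
  which vanish. The terms with second derivatives cancel in pairs, because \<open>D2\<close> is
  symmetric and \<open>ccross (X x)\<close> is skew.\<close>

lemma form_closed:
  assumes "x \<in> S"
  shows "ddir (\<lambda>y. induced_form X y v w) x u + ddir (\<lambda>y. induced_form X y w u) x v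
     + ddir (\<lambda>y. induced_form X y u v) x w = 0"
proof -
  note 0 = triple_product_orthogonal[OF unit[OF assms] qform_X_DX[OF assms] qform_X_DX[OF assms] qform_X_DX[OF assms]]
  have sw: "qform (ccross (X x) (D2 x a b)) (ddir X x c) = - qform (ccross (X x) (ddir X x c)) (D2 x b a)" for a b c
    using qform_ccross_swap D2_commute[OF assms] by metis
  show ?thesis unfolding form_derivative[OF assms] by (simp add: 0 sw)
qed

subsection \<open>Neutral signature\<close>

text \<open>On an orthogonal complex basis \<open>Y\<close>, \<open>Z\<close> of the tangent space
  with value \<open>\<i>\<close> on both, the imaginary part is 1; on the multiples of
  \<open>Y\<close> and \<open>Z\<close> by \<open>\<i>\<close> it is -1.\<close>

lemma metric_signature: assumes "x \<in> S" shows "has_signature (induced_metric X x) 2 2"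
proof -
  note x = assms
  \<comment> \<open>If the diagonal vanished, polarisation would kill the whole form, against
    nondegeneracy of its imaginary part.\<close>
  have "\<exists>v. q x v v \<noteq> 0"
  proof (rule ccontr)
    assume "\<not> ?thesis"
    then have z: "q x v v = 0" for v by blast
    have "q x v w = 0" for v w
    proof -
      have "q x (v + w) (v + w) = q x v v + q x w w + 2 * q x v w"
        using qform_commute[of "ddir X x w" "ddir X x v"]
        by (simp add: linear_add[OF linear_DX[OF x]] qform.add_left qform.add_right)
      then show ?thesis using z by simp
    qed
    then have "induced_metric X x v w = 0" for v w by (simp add: induced_metric_def)
    then have "v = 0" for v :: "complex \<times> complex" using metric_nondegenerate[OF x] by (auto simp: nondegenerate_def)
    from this[of "(1, 1)"] show False by (simp add: zero_prod_def)
  qed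
  then obtain v where v: "q x v v \<noteq> 0" ..
  define Y where "Y = cscale (csqrt (\<i> / q x v v)) (ddir X x v)"
  have "qform Y Y = (csqrt (\<i> / q x v v))\<^sup>2 * q x v v" by (simp add: Y_def power2_eq_square)
  then have YY: "qform Y Y = \<i>" using v by simp
  have XY: "qform (X x) Y = 0" by (simp add: Y_def qform_X_DX x)
  \<comment> \<open>By skewness the square of \<open>ccross (X x) Y\<close> is minus that of
    \<open>Y\<close>; the factor \<open>\<i>\<close> restores the sign.\<close>
  define Z where "Z = cscale \<i> (ccross (X x) Y)"
  have XZ: "qform (X x) Z = 0" by (simp add: Z_def qform_ccross_left)
  have ZY: "qform Z Y = 0" by (simp add: Z_def)
  then have YZ: "qform Y Z = 0" by (simp add: qform_commute)
  have "ccross (X x) (ccross (X x) Y) = Y" by (simp add: ccross_ccross unit x XY cscale.zero_left)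
  then have ZZ: "qform Z Z = \<i>"
    using qform_ccross_swap[of "X x" Y "ccross (X x) Y"] by (simp add: Z_def YY)
  define e where "e i = pull x (if i = 0 then Y else if i = 1 then Z else if i = (2::nat) then cscale \<i> Y else cscale \<i> Z)" for i
  have De: "ddir X x (e i) = (if i = 0 then Y else if i = 1 then Z else if i = (2::nat) then cscale \<i> Y else cscale \<i> Z)" for i
    unfolding e_def by (rule DX_pull[OF x]) (simp add: XY XZ)
  have "\<forall>i<2+2. \<forall>j<2+2. induced_metric X x (e i) (e j) = (if i \<noteq> j then 0 else if i < 2 then 1 else - 1)"
    unfolding induced_metric_def De
    by (auto simp: numeral_eq_Suc less_Suc_eq YY ZZ YZ ZY)
  then show ?thesis unfolding has_signature_def by (intro conjI exI[of _ e]) simp_all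
qed

subsection \<open>Curvature\<close>

text \<open>
  The Gauss formula.  Complex multiples of \<open>X\<close> are normal for the imaginary part of the quadratic
  form, and the second fundamental form is \<open>- q X\<close>.
\<close>

definition "Gam x u v = pull x (D2 x u v + cscale (q x u v) (X x))"

lemma gauss_tangent: "x \<in> S \<Longrightarrow> qform (X x) (D2 x u v + cscale (q x u v) (X x)) = 0"
  by (simp add: qform.add_right qform_X_D2 unit)

lemma DX_Gam: "x \<in> S \<Longrightarrow> ddir X x (Gam x u v) = D2 x u v + cscale (q x u v) (X x)"
  unfolding Gam_def by (rule DX_pull[OF _ gauss_tangent])

lemma smooth_Gam: "smooth_on S (\<lambda>x. Gam x u v)"
  unfolding Gam_def
  by (rule smooth_pull)
     (intro smooth_on_add open_S smooth_D2 cscale.smooth_on qform.smooth_on smooth_DX smooth_X, rule gauss_tangent)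

lemma q_derivative:
  assumes "x \<in> S"
  shows "((\<lambda>y. q y v w) has_derivative (\<lambda>u. qform (ddir X x v) (D2 x u w) + qform (D2 x u v) (ddir X x w))) (at x)"
  by (intro qform.FDERIV DDX assms)

lemma metric_derivative:
  assumes "x \<in> S"
  shows "ddir (\<lambda>y. induced_metric X y v w) x u = Im (qform (D2 x u v) (ddir X x w) + qform (D2 x u w) (ddir X x v))"
proof -
  have "((\<lambda>y. induced_metric X y v w) has_derivative
      (\<lambda>u. Im (qform (ddir X x v) (D2 x u w) + qform (D2 x u v) (ddir X x w)))) (at x)"
    unfolding induced_metric_def
    by (intro bounded_linear.has_derivative[OF bounded_linear_Im] q_derivative assms)
  from frechet_derivative_at[OF this, symmetric] show ?thesis
    by (simp add: qform_commute[of "ddir X x v"])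
qed

lemma christoffel_eq: assumes "x \<in> S" shows "christoffel (induced_metric X) x u v = Gam x u v"
  unfolding christoffel_def
proof (rule sharp_eqI[where z = "Gam x u v" and g = "induced_metric X"])
  fix w
  have "qform (X x) (ddir X x w) = 0" by (rule qform_X_DX[OF assms])
  then show "induced_metric X x (Gam x u v) w =
     (ddir (\<lambda>y. induced_metric X y v w) x u + ddir (\<lambda>y. induced_metric X y u w) x v
        - ddir (\<lambda>y. induced_metric X y u v) x w) / 2"
    unfolding metric_derivative[OF assms]
    by (simp add: induced_metric_def DX_Gam[OF assms] qform.add_left D2_commute[OF assms, of v u]
        D2_commute[OF assms, of w u] D2_commute[OF assms, of w v])
qed (rule metric_nondegenerate[OF assms] metric_left_linear[OF assms])+

text \<open>Product rule for a direction that moves with the point; \<open>DDX\<close> covers fixed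
  directions only, hence the basis expansion.\<close>

lemma DX_varying:
  assumes "x \<in> S" "(z has_derivative z') (at x)"
  shows "((\<lambda>y. ddir X y (z y)) has_derivative (\<lambda>u. D2 x u (z x) + ddir X x (z' u))) (at x)"
proof -
  have "((\<lambda>y. \<Sum>b\<in>Basis. (z y \<bullet> b) *\<^sub>R ddir X y b) has_derivative
      (\<lambda>u. \<Sum>b\<in>Basis. (z x \<bullet> b) *\<^sub>R D2 x u b + (z' u \<bullet> b) *\<^sub>R ddir X x b)) (at x)"
    by (intro has_derivative_sum has_derivative_scaleR DDX assms bounded_linear.has_derivative[OF bounded_linear_inner_left])
  then have "((\<lambda>y. ddir X y (z y)) has_derivative
      (\<lambda>u. \<Sum>b\<in>Basis. (z x \<bullet> b) *\<^sub>R D2 x u b + (z' u \<bullet> b) *\<^sub>R ddir X x b)) (at x)"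
    by (rule has_derivative_transform_within_open[OF _ open_S assms(1)])
       (rule linear_basis_expansion[OF linear_DX, symmetric])
  moreover have "(\<Sum>b\<in>Basis. (z x \<bullet> b) *\<^sub>R D2 x u b + (z' u \<bullet> b) *\<^sub>R ddir X x b) = D2 x u (z x) + ddir X x (z' u)" for u
  proof -
    have "(\<lambda>v. D2 x u v) = (\<lambda>v. D2 x v u)" by (intro ext D2_commute[OF assms(1)])
    with has_derivative_linear[OF DDX[OF assms(1), of u]] have l: "linear (\<lambda>v. D2 x u v)" by simp
    show ?thesis
      using linear_basis_expansion[OF l, of "z x"] linear_basis_expansion[OF linear_DX[OF assms(1)], of "z' u"]
      by (simp add: sum.distrib)
  qed
  ultimately show ?thesis by simp
qed

text \<open>Differentiates the Gauss formula \<open>DX_Gam\<close> along \<open>u\<close>; the left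
  side is built from the terms that occur in \<open>riemann\<close>.\<close>

lemma gauss_differentiated:
  assumes "x \<in> S"
  shows "ddir X x (ddir (\<lambda>y. Gam y v w) x u + Gam x u (Gam x v w)) =
     D3 x u v w + cscale (q x v w) (ddir X x u)
      + cscale (qform (ddir X x v) (D2 x u w) + qform (D2 x u v) (ddir X x w) + q x u (Gam x v w)) (X x)"
proof -
  let ?dq = "\<lambda>u. qform (ddir X x v) (D2 x u w) + qform (D2 x u v) (ddir X x w)"
  let ?R = "\<lambda>u. D3 x u v w + (cscale (q x v w) (ddir X x u) + cscale (?dq u) (X x))"
  have "((\<lambda>y. ddir X y (Gam y v w)) has_derivative
      (\<lambda>u. D2 x u (Gam x v w) + ddir X x (ddir (\<lambda>y. Gam y v w) x u))) (at x)"
    by (rule DX_varying[OF assms smooth_on_has_derivative[OF open_S smooth_Gam assms]])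
  moreover have "((\<lambda>y. ddir X y (Gam y v w)) has_derivative
      ?R) (at x)"
  proof (rule has_derivative_transform_within_open[OF _ open_S assms])
    show "((\<lambda>y. D2 y v w + cscale (q y v w) (X y)) has_derivative
      ?R) (at x)"
      by (intro has_derivative_add cscale.FDERIV q_derivative DX assms
          smooth_on_has_derivative[OF open_S smooth_D2])
  qed (simp add: DX_Gam)
  ultimately have "D2 x u (Gam x v w) + ddir X x (ddir (\<lambda>y. Gam y v w) x u) = ?R u"
    by (auto dest: has_derivative_unique fun_cong[where x = u])
  then show ?thesis
    using DX_Gam[OF assms, of u "Gam x v w"]
    by (simp add: linear_add[OF linear_DX[OF assms]] cscale.add_left algebra_simps)
qed

text \<open>The third derivatives cancel by symmetry. What remains besides the claim is a multiple
  of \<open>X x\<close> with coefficient \<open>l\<close>, and this vanishes because the left side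
  is tangent.\<close>

lemma DX_riemann:
  assumes "x \<in> S"
  shows "ddir X x (riemann (induced_metric X) x u v w) = cscale (q x v w) (ddir X x u) - cscale (q x u w) (ddir X x v)"
proof -
  have ch: "ddir (\<lambda>y. christoffel (induced_metric X) y v w) x u = ddir (\<lambda>y. Gam y v w) x u" for u v w
  proof -
    have "((\<lambda>y. christoffel (induced_metric X) y v w) has_derivative ddir (\<lambda>y. Gam y v w) x) (at x)"
      by (rule has_derivative_transform_within_open[OF smooth_on_has_derivative[OF open_S smooth_Gam assms] open_S assms])
         (simp add: christoffel_eq)
    then show ?thesis by (simp add: frechet_derivative_at[symmetric])
  qed
  let ?R = "riemann (induced_metric X) x u v w"
  have R: "?R = (ddir (\<lambda>y. Gam y v w) x u + Gam x u (Gam x v w)) - (ddir (\<lambda>y. Gam y u w) x v + Gam x v (Gam x u w))"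
    by (simp add: riemann_def ch christoffel_eq[OF assms])
  define l where "l = (qform (ddir X x v) (D2 x u w) + qform (D2 x u v) (ddir X x w) + q x u (Gam x v w))
       - (qform (ddir X x u) (D2 x v w) + qform (D2 x v u) (ddir X x w) + q x v (Gam x u w))"
  have "D3 x u v w = D3 x v u w" by (rule D3_commute[OF assms])
  then have l: "ddir X x ?R = cscale (q x v w) (ddir X x u) - cscale (q x u w) (ddir X x v) + cscale l (X x)"
    unfolding R linear_diff[OF linear_DX[OF assms]] gauss_differentiated[OF assms]
      l_def cscale.diff_left by simp
  have "qform (X x) (ddir X x ?R) = l"
    unfolding l by (simp add: qform.add_right qform.diff_right qform_X_DX unit assms)
  then have "l = 0" by (simp add: qform_X_DX assms)
  with l show ?thesis by (simp add: cscale.zero_left)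
qed

text \<open>Scalar multiplication by \<open>\<i>\<close> in C^3 restricted to tangent vectors, a
  structure different from \<open>induced_J\<close>. It is symmetric for the metric and turns the
  imaginary part of the form into its real part.\<close>

definition "I x v = pull x (cscale \<i> (ddir X x v))"

lemma DX_I: "x \<in> S \<Longrightarrow> ddir X x (I x v) = cscale \<i> (ddir X x v)"
  unfolding I_def by (rule DX_pull) (simp_all add: qform_X_DX)

lemma cscale_DX: assumes "x \<in> S" shows "cscale l (ddir X x v) = ddir X x (Re l *\<^sub>R v + Im l *\<^sub>R I x v)"
proof -
  have "cscale l Y = cscale (of_real (Re l)) Y + cscale (of_real (Im l)) (cscale \<i> Y)" for Y
    unfolding cscale_cscale cscale.add_left[symmetric] by (metis complex_eq mult.commute)
  then have "cscale l Y = Re l *\<^sub>R Y + Im l *\<^sub>R cscale \<i> Y" for Y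
    by (simp only: cscale_of_real)
  then show ?thesis
    by (simp add: linear_add[OF linear_DX[OF assms]] linear_cmul[OF linear_DX[OF assms]] DX_I[OF assms])
qed

lemma riemann_eq:
  assumes "x \<in> S"
  shows "riemann (induced_metric X) x u v w =
     (Re (q x v w) *\<^sub>R u + Im (q x v w) *\<^sub>R I x u) - (Re (q x u w) *\<^sub>R v + Im (q x u w) *\<^sub>R I x v)"
  unfolding DX_eq_iff[OF assms, symmetric] linear_diff[OF linear_DX[OF assms]] cscale_DX[OF assms, symmetric]
  by (rule DX_riemann[OF assms])

text \<open>Multiplication by \<open>\<i>\<close> has real trace 0 on C^3 and on the line through
  \<open>X x\<close>; conjugation with \<open>frame\<close> leaves trace 0 for the tangential
  part.\<close>

lemma trace_I: assumes "x \<in> S" shows "(\<Sum>b\<in>Basis. I x b \<bullet> b) = 0"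
proof -
  define T :: "cvec \<Rightarrow> cvec" where "T = (\<lambda>(v, l). (I x v, \<i> * l))"
  let ?F = "frame x" and ?G = "inv (frame x)"
  have FT: "?F (T p) = cscale \<i> (?F p)" for p
    by (cases p) (simp add: frame_def T_def DX_I[OF assms] cscale.add_right)
  have GF: "?G (?F p) = p" for p by (rule inv_f_f[OF inj_frame[OF assms]])
  have FG: "?F (?G Y) = Y" for Y by (rule surj_f_inv_f[OF surj_frame[OF assms]])
  have lG: "linear ?G"
    by (rule right_inverse_linear[OF linear_frame[OF assms]]) (auto simp: FG)
  have lF: "linear (\<lambda>p. cscale \<i> (?F p))"
    using linear_frame[OF assms] by (intro linearI) (simp_all add: linear_add linear_cmul cscale.add_right cscale.scaleR_right)
  have "(\<Sum>b\<in>Basis. T b \<bullet> b) = (\<Sum>b\<in>Basis. ?G (cscale \<i> (?F b)) \<bullet> b)"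
    by (simp add: FT[symmetric] GF)
  also have "\<dots> = (\<Sum>b\<in>Basis. cscale \<i> (?F (?G b)) \<bullet> b)" by (rule trace_commute[OF lG lF])
  also have "\<dots> = 0" by (simp add: FG trace_cscale_ii)
  finally have "(\<Sum>b\<in>Basis. T b \<bullet> b) = 0" .
  moreover have "(\<Sum>b\<in>Basis. T b \<bullet> b) = (\<Sum>b\<in>Basis. I x b \<bullet> b) + (\<Sum>b\<in>Basis. (\<i> * b) \<bullet> b)"
    by (subst sum_Basis_Pair) (simp add: T_def)
  ultimately show ?thesis by (simp add: Basis_complex_def)
qed

text \<open>The trace of \<open>u\<close> contributes 4 Re q and the term with \<open>I x u\<close>
  nothing, by \<open>trace_I\<close>. The subtracted part contributes Re q twice, once directly and
  once as the imaginary part of q at \<open>I x v\<close>; thus 4 - 1 - 1 = 2.\<close>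

lemma ricci_eq: assumes "x \<in> S" shows "ricci (induced_metric X) x v w = 2 * Re (q x v w)"
proof -
  have l: "linear (\<lambda>v. Re (q x v w))" "linear (\<lambda>v. Im (q x v w))"
  proof -
    have "linear (\<lambda>v. q x v w)"
      using linear_compose[OF linear_DX[OF assms] bounded_linear.linear[OF qform.bounded_linear_left]] by (simp add: o_def)
    then show "linear (\<lambda>v. Re (q x v w))" "linear (\<lambda>v. Im (q x v w))"
      using linear_compose[OF _ bounded_linear.linear[OF bounded_linear_Re]]
        linear_compose[OF _ bounded_linear.linear[OF bounded_linear_Im]] by (auto simp: o_def)
  qed
  have 1: "(\<Sum>b\<in>Basis. Re (q x b w) * (v \<bullet> b)) = Re (q x v w)"
    using linear_basis_expansion[OF l(1), of v] by (simp add: mult.commute)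
  have 2: "(\<Sum>b\<in>Basis. Im (q x b w) * (I x v \<bullet> b)) = Re (q x v w)"
    using linear_basis_expansion[OF l(2), of "I x v"] by (simp add: mult.commute DX_I[OF assms])
  have "ricci (induced_metric X) x v w = (\<Sum>b\<in>(Basis :: (complex \<times> complex) set). Re (q x v w) * (b \<bullet> b)) + Im (q x v w) * (\<Sum>b\<in>Basis. I x b \<bullet> b)
      - ((\<Sum>b\<in>Basis. Re (q x b w) * (v \<bullet> b)) + (\<Sum>b\<in>Basis. Im (q x b w) * (I x v \<bullet> b)))"
    unfolding ricci_def riemann_eq[OF assms]
    by (simp add: inner_diff_left inner_add_left sum.distrib sum_subtractf sum_distrib_left)
  also have "(\<Sum>b\<in>(Basis :: (complex \<times> complex) set). Re (q x v w) * (b \<bullet> b)) = 4 * Re (q x v w)"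
    by (simp add: sum_Basis_Pair Basis_complex_def)
  finally show ?thesis by (simp add: 1 2 trace_I[OF assms])
qed

theorem scalar_curvature_0: assumes "x \<in> S" shows "scalar_curvature (induced_metric X) x = 0"
proof -
  have "sharp (induced_metric X) x (ricci (induced_metric X) x b) = 2 *\<^sub>R I x b" for b
  proof (rule sharp_eqI[where g = "induced_metric X"])
    show "induced_metric X x (2 *\<^sub>R I x b) w = ricci (induced_metric X) x b w" for w
      by (simp add: ricci_eq[OF assms] induced_metric_def linear_cmul[OF linear_DX[OF assms]] DX_I[OF assms] qform.scaleR_left)
  qed (rule metric_nondegenerate[OF assms] metric_left_linear[OF assms])+
  then have "scalar_curvature (induced_metric X) x = 2 * (\<Sum>b\<in>Basis. I x b \<bullet> b)"
    by (simp add: scalar_curvature_def sum_distrib_left)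
  then show ?thesis by (simp add: trace_I[OF assms])
qed

end

section \<open>Geodesics of hyperbolic space and their moments\<close>

lemma hyp_nondegenerate: "p \<in> H3 \<Longrightarrow> nondegenerate (hyp p)"
  unfolding nondegenerate_def hyp_def H3_def by (auto dest: spec[where x = "v" for v])

lemma hyp_linear: "linear (\<lambda>v. hyp p v w)"
  unfolding hyp_def by (intro linearI) (simp_all add: inner_add_left add_divide_distrib)

lemma hyp_derivative:
  assumes "p \<in> H3" shows "ddir (\<lambda>y. hyp y v w) p u = - 2 * (v \<bullet> w) * fst u / fst p ^ 3"
proof -
  have "fst p \<noteq> 0" using assms by (simp add: H3_def)
  then have "((\<lambda>y. hyp y v w) has_derivative (\<lambda>u. - 2 * (v \<bullet> w) * fst u / fst p ^ 3)) (at p)"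
    unfolding hyp_def
    by (auto intro!: derivative_eq_intros simp: field_simps power2_eq_square power3_eq_cube)
  from frechet_derivative_at[OF this, symmetric] show ?thesis by simp
qed

lemma christoffel_hyp:
  assumes "p \<in> H3"
  shows "christoffel hyp p u v = (1 / fst p) *\<^sub>R ((u \<bullet> v) *\<^sub>R (1, 0) - fst u *\<^sub>R v - fst v *\<^sub>R u)"
  unfolding christoffel_def
proof (rule sharp_eqI[where g = hyp])
  fix w :: hvec
  have t: "fst p \<noteq> 0" using assms by (simp add: H3_def)
  have e: "(1, 0) \<bullet> w = fst w" by (cases w) simp
  show "hyp p ((1 / fst p) *\<^sub>R ((u \<bullet> v) *\<^sub>R (1, 0) - fst u *\<^sub>R v - fst v *\<^sub>R u)) w =
     (ddir (\<lambda>y. hyp y v w) p u + ddir (\<lambda>y. hyp y u w) p v - ddir (\<lambda>y. hyp y u v) p w) / 2"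
    unfolding hyp_derivative[OF assms] unfolding hyp_def inner_scaleR_left inner_diff_left e using t
    by (simp add: field_simps power2_eq_square power3_eq_cube)
qed (rule hyp_nondegenerate[OF assms] hyp_linear)+

text \<open>
  The moment of a tangent vector is the infinitesimal isometry, as an element of sl(2, C),
  that translates along its geodesic.
\<close>

definition moment :: "hvec \<times> hvec \<Rightarrow> cvec" where
  "moment = (\<lambda>((t, z), (\<tau>, \<zeta>)).
     ((z * (cnj \<zeta> / of_real (t\<^sup>2)) + of_real (\<tau> / t),
       z\<^sup>2 * (cnj \<zeta> / of_real (t\<^sup>2)) + 2 * z * of_real (\<tau> / t) - \<zeta>), cnj \<zeta> / of_real (t\<^sup>2)))"

lemma complete_geodesic_derivatives:
  assumes "complete_geodesic hyp H3 c"
  shows "c r \<in> H3" "(c has_vector_derivative velocity c r) (at r)"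
    "(velocity c has_vector_derivative (1 / fst (c r)) *\<^sub>R
       ((2 * fst (velocity c r)) *\<^sub>R velocity c r - (velocity c r \<bullet> velocity c r) *\<^sub>R (1, 0))) (at r)"
proof -
  from assms have g: "c r \<in> H3" "c differentiable (at r)" "velocity c differentiable (at r)"
    "vector_derivative (velocity c) (at r) = - christoffel hyp (c r) (velocity c r) (velocity c r)"
    by (auto simp: complete_geodesic_def cov_deriv_def add_eq_0_iff)
  show "c r \<in> H3" by fact
  show "(c has_vector_derivative velocity c r) (at r)"
    using g(2) unfolding velocity_def by (simp add: vector_derivative_works)
  have "- christoffel hyp (c r) (velocity c r) (velocity c r) = (1 / fst (c r)) *\<^sub>R
       ((2 * fst (velocity c r)) *\<^sub>R velocity c r - (velocity c r \<bullet> velocity c r) *\<^sub>R (1, 0))"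
    unfolding christoffel_hyp[OF g(1)] by (simp add: prod_eq_iff complex_eq_iff field_simps)
  with g(3,4) show "(velocity c has_vector_derivative (1 / fst (c r)) *\<^sub>R
       ((2 * fst (velocity c r)) *\<^sub>R velocity c r - (velocity c r \<bullet> velocity c r) *\<^sub>R (1, 0))) (at r)"
    by (simp add: vector_derivative_works)
qed

text \<open>The geodesic equation makes \<open>C\<close> constant and gives \<open>s\<close> the
  derivative \<open>- (\<zeta> r * C r)\<close>; with these, the derivatives of the other two
  entries cancel.\<close>

lemma moment_constant:
  assumes c: "complete_geodesic hyp H3 c"
  shows "moment (c r, velocity c r) = moment (c r', velocity c r')"
proof -
  define t z \<tau> \<zeta> where "t = (\<lambda>r. fst (c r))" and "z = (\<lambda>r. snd (c r))"
    and "\<tau> = (\<lambda>r. fst (velocity c r))" and "\<zeta> = (\<lambda>r. snd (velocity c r))"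
  have t0: "t r \<noteq> 0" for r using complete_geodesic_derivatives(1)[OF c, of r] by (simp add: t_def H3_def)
  note d = complete_geodesic_derivatives(2,3)[OF c]
  have vv: "velocity c r \<bullet> velocity c r = (\<tau> r)\<^sup>2 + (cmod (\<zeta> r))\<^sup>2" for r
    by (simp add: \<tau>_def \<zeta>_def inner_prod_def dot_square_norm power2_eq_square[of "fst _"])
  have dt: "(t has_real_derivative \<tau> r) (at r)" for r
    using bounded_linear.has_vector_derivative[OF bounded_linear_fst d(1), of r]
    by (simp add: t_def \<tau>_def has_real_derivative_iff_has_vector_derivative[symmetric])
  have dz: "(z has_vector_derivative \<zeta> r) (at r)" for r
    using bounded_linear.has_vector_derivative[OF bounded_linear_snd d(1), of r] by (simp add: z_def \<zeta>_def)
  have d\<tau>: "(\<tau> has_real_derivative (((\<tau> r)\<^sup>2 - (cmod (\<zeta> r))\<^sup>2) / t r)) (at r)" for r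
    using bounded_linear.has_vector_derivative[OF bounded_linear_fst d(2), of r] unfolding vv
    by (simp add: t_def \<tau>_def \<zeta>_def has_real_derivative_iff_has_vector_derivative[symmetric] power2_eq_square
        algebra_simps diff_divide_distrib)
  have d\<zeta>: "(\<zeta> has_vector_derivative (2 * \<tau> r / t r) *\<^sub>R \<zeta> r) (at r)" for r
    using bounded_linear.has_vector_derivative[OF bounded_linear_snd d(2), of r] by (simp add: t_def \<tau>_def \<zeta>_def)
  define C where "C r = cnj (\<zeta> r) / of_real ((t r)\<^sup>2)" for r
  define s :: "real \<Rightarrow> complex" where "s r = of_real (\<tau> r / t r)" for r
  have dC: "(C has_vector_derivative 0) (at r)" for r
  proof -
    have "((\<lambda>r. inverse ((t r)\<^sup>2) *\<^sub>R cnj (\<zeta> r)) has_vector_derivative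
        inverse ((t r)\<^sup>2) *\<^sub>R cnj ((2 * \<tau> r / t r) *\<^sub>R \<zeta> r) + (- 2 * \<tau> r / (t r)^3) *\<^sub>R cnj (\<zeta> r)) (at r)"
      using t0 by (intro has_vector_derivative_scaleR bounded_linear.has_vector_derivative[OF bounded_linear_cnj] d\<zeta>)
        (auto intro!: derivative_eq_intros dt simp: field_simps power2_eq_square power3_eq_cube)
    moreover have "inverse ((t r)\<^sup>2) *\<^sub>R cnj ((2 * \<tau> r / t r) *\<^sub>R \<zeta> r) + (- 2 * \<tau> r / (t r)^3) *\<^sub>R cnj (\<zeta> r) = 0"
      using t0[of r] by (simp add: scaleR_conv_of_real field_simps power2_eq_square power3_eq_cube)
    moreover have "(\<lambda>r. inverse ((t r)\<^sup>2) *\<^sub>R cnj (\<zeta> r)) = C"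
      by (simp add: C_def fun_eq_iff scaleR_conv_of_real divide_inverse mult.commute)
    ultimately show ?thesis by metis
  qed
  have ds: "(s has_vector_derivative - (\<zeta> r * C r)) (at r)" for r
  proof -
    have "((\<lambda>r. \<tau> r / t r) has_real_derivative - (cmod (\<zeta> r))\<^sup>2 / (t r)\<^sup>2) (at r)"
      using t0[of r] by (auto intro!: derivative_eq_intros dt d\<tau> simp: field_simps power2_eq_square)
    then have "(s has_vector_derivative of_real (- (cmod (\<zeta> r))\<^sup>2 / (t r)\<^sup>2)) (at r)"
      unfolding s_def has_real_derivative_iff_has_vector_derivative
      by (rule bounded_linear.has_vector_derivative[OF bounded_linear_of_real])
    moreover have "complex_of_real (- (cmod (\<zeta> r))\<^sup>2 / (t r)\<^sup>2) = - (\<zeta> r * C r)"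
      by (simp add: C_def complex_norm_square[symmetric])
    ultimately show ?thesis by simp
  qed
  have \<zeta>': "(2 * \<tau> r / t r) *\<^sub>R \<zeta> r = 2 * s r * \<zeta> r" for r
    by (simp add: s_def scaleR_conv_of_real)
  define a where "a r = z r * C r + s r" for r
  define b where "b r = z r * z r * C r + 2 * z r * s r - \<zeta> r" for r
  have "(a has_vector_derivative (z r * 0 + \<zeta> r * C r) + - (\<zeta> r * C r)) (at r)" for r
    unfolding a_def by (intro has_vector_derivative_add has_vector_derivative_mult dz dC ds)
  then have da: "(a has_vector_derivative 0) (at r)" for r by simp
  have "(b has_vector_derivative ((z r * z r) * 0 + (z r * \<zeta> r + \<zeta> r * z r) * C r)
      + ((2 * z r) * - (\<zeta> r * C r) + (2 * \<zeta> r) * s r) - 2 * s r * \<zeta> r) (at r)" for r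
    unfolding b_def \<zeta>'[symmetric]
    by (intro has_vector_derivative_add has_vector_derivative_diff has_vector_derivative_mult
        has_vector_derivative_mult_right dz dC ds d\<zeta>)
  moreover have "((z r * z r) * 0 + (z r * \<zeta> r + \<zeta> r * z r) * C r)
      + ((2 * z r) * - (\<zeta> r * C r) + (2 * \<zeta> r) * s r) - 2 * s r * \<zeta> r = 0" for r
    by (simp add: algebra_simps)
  ultimately have db: "(b has_vector_derivative 0) (at r)" for r by metis
  have const: "f r = f r'" if z: "\<And>r. (f has_vector_derivative 0) (at r)" for f :: "real \<Rightarrow> complex" and r r'
  proof -
    obtain k where "\<And>x. x \<in> UNIV \<Longrightarrow> f x = k"
      by (rule has_vector_derivative_zero_constant[of UNIV f]) (simp_all add: z)
    then show ?thesis by simp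
  qed
  have "moment (c r, velocity c r) = ((a r, b r), C r)" for r
    by (simp add: moment_def a_def b_def C_def s_def t_def z_def \<tau>_def \<zeta>_def split_beta power2_eq_square)
  then show ?thesis using const[OF da, of r r'] const[OF db, of r r'] const[OF dC, of r r'] by simp
qed

subsection \<open>Explicit geodesics\<close>

text \<open>
  Geodesics that do not start at the point at infinity (for \<open>e = 1\<close>; do not end there for
  \<open>e = - 1\<close>), parametrised by their finite end point \<open>q\<close> and by \<open>m\<close>, where \<open>q + 1 / m\<close> is the other
  end point.  They are the images of the vertical geodesic above \<open>q\<close> under the isometry extending
  \<open>w \<mapsto> q + (w - q) / (1 + m * (w - q))\<close>, and \<open>E\<close> is the height before applying it.
\<close>

definition alpha :: "real \<Rightarrow> real \<Rightarrow> real" where "alpha k E = E / (1 + k * E\<^sup>2)"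
definition beta :: "real \<Rightarrow> real \<Rightarrow> real" where "beta k E = E\<^sup>2 / (1 + k * E\<^sup>2)"
text \<open>With respect to \<open>ln E\<close>, \<open>alpha\<close> has derivative
  \<open>alpha * sigma\<close> and \<open>beta\<close> has derivative
  \<open>2 * alpha\<^sup>2\<close>. So for \<open>k\<close> the squared modulus of \<open>m\<close>,
  \<open>alpha\<close> is the height, \<open>beta\<close> the displacement along
  \<open>cnj m\<close>, and \<open>sigma\<close> the logarithmic rate of the height.\<close>

definition sigma :: "real \<Rightarrow> real \<Rightarrow> real" where "sigma k E = (1 - k * E\<^sup>2) / (1 + k * E\<^sup>2)"

text \<open>The second identity expresses unit speed, the fourth recovers the end point
  \<open>q\<close>, and the first and third make the moment independent of \<open>E\<close>.\<close>

lemma alpha_beta_sigma: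
  assumes "k \<ge> 0"
  shows "2 * k * beta k E + sigma k E = 1" "(sigma k E)\<^sup>2 + 4 * k * (alpha k E)\<^sup>2 = 1"
    "beta k E * (k * beta k E + sigma k E) = (alpha k E)\<^sup>2" "beta k E * (1 + sigma k E) = 2 * (alpha k E)\<^sup>2"
    "E > 0 \<Longrightarrow> alpha k E > 0" "1 + sigma k E > 0"
proof -
  define N where "N = 1 + k * E\<^sup>2"
  have N: "N > 0" unfolding N_def using assms by (intro add_pos_nonneg) auto
  have s: "sigma k E = (2 - N) / N" by (simp add: sigma_def N_def)
  have kE: "k * E\<^sup>2 = N - 1" by (simp add: N_def)
  have a: "alpha k E = E / N" and b: "beta k E = E\<^sup>2 / N" by (simp_all add: alpha_def beta_def N_def)
  have kb: "k * beta k E = (N - 1) / N" using kE by (simp add: b)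
  have ka: "k * (alpha k E)\<^sup>2 = (N - 1) / N\<^sup>2" using kE by (simp add: a power_divide)
  show "2 * k * beta k E + sigma k E = 1" using kb N by (simp add: s field_simps)
  show "(sigma k E)\<^sup>2 + 4 * k * (alpha k E)\<^sup>2 = 1" using ka N by (simp add: s field_simps power2_eq_square)
  show "beta k E * (k * beta k E + sigma k E) = (alpha k E)\<^sup>2"
  proof -
    have "k * beta k E + sigma k E = 1 / N" using N by (simp add: kb s field_simps)
    then show ?thesis using N by (simp add: a b field_simps power2_eq_square)
  qed
  show "beta k E * (1 + sigma k E) = 2 * (alpha k E)\<^sup>2" using N by (simp add: s a b field_simps power2_eq_square)
  show "alpha k E > 0" if "E > 0" using that N by (simp add: a)
  show "1 + sigma k E > 0" using N by (simp add: s field_simps)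
qed

text \<open>\<open>E\<close> selects the point on the geodesic and \<open>l\<close> the hyperbolic
  speed. For fixed positive \<open>E\<close> and \<open>l\<close> this is a smooth section of the
  coordinate map \<open>base_coord\<close> below.\<close>

definition sect :: "real \<Rightarrow> real \<Rightarrow> real \<Rightarrow> complex \<times> complex \<Rightarrow> hvec \<times> hvec" where
  "sect e E l = (\<lambda>(m, q). let k = (cmod m)\<^sup>2 in
     ((alpha k E, q + of_real (beta k E) * cnj m),
      (l * e * alpha k E * sigma k E, of_real (2 * l * e * (alpha k E)\<^sup>2) * cnj m)))"

text \<open>On a vertical geodesic \<open>ln E\<close> is arc length, which the isometry preserves;
  \<open>e\<close> decides between running up and running down.\<close>

definition arc :: "real \<Rightarrow> real \<Rightarrow> complex \<times> complex \<Rightarrow> real \<Rightarrow> hvec" where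
  "arc e b y r = fst (sect e (exp (e * r + b)) 1 y)"

lemma arc_geodesic:
  assumes e: "e = 1 \<or> e = - 1"
  shows "complete_geodesic hyp H3 (arc e b y)" "velocity (arc e b y) r = snd (sect e (exp (e * r + b)) 1 y)"
proof -
  obtain m q where y: "y = (m, q)" by (cases y)
  define k where "k = (cmod m)\<^sup>2"
  have k: "k \<ge> 0" by (simp add: k_def)
  have ee: "e * e = 1" "complex_of_real e * complex_of_real e = 1" using e by auto
  define A B S where "A r = alpha k (exp (e * r + b))" and "B r = beta k (exp (e * r + b))"
    and "S r = sigma k (exp (e * r + b))" for r
  note ABS = alpha_beta_sigma[OF k, of "exp (e * r + b)" for r, folded A_def B_def S_def]
  have A0: "A r > 0" for r using ABS(5) by simp
  have N: "1 + k * (exp x)\<^sup>2 \<noteq> 0" for x using k by (metis add_nonneg_pos add.commute less_numeral_extra(1,3) mult_nonneg_nonneg zero_le_power2)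
  have dA: "(A has_real_derivative e * A r * S r) (at r)" for r
    unfolding A_def S_def alpha_def sigma_def using N[of "e * r + b"]
    by (auto intro!: derivative_eq_intros simp: field_simps power2_eq_square)
  have dB: "(B has_real_derivative 2 * e * (A r)\<^sup>2) (at r)" for r
    unfolding B_def A_def alpha_def beta_def using N[of "e * r + b"]
    by (auto intro!: derivative_eq_intros simp: field_simps power2_eq_square)
  have dS: "(S has_real_derivative - 4 * e * k * (A r)\<^sup>2) (at r)" for r
    unfolding S_def A_def alpha_def sigma_def using N[of "e * r + b"]
    by (auto intro!: derivative_eq_intros simp: field_simps power2_eq_square)
  have arc: "arc e b y = (\<lambda>r. (A r *\<^sub>R (1, 0) + B r *\<^sub>R (0, cnj m)) + (0, q))"
    by (simp add: fun_eq_iff arc_def sect_def y Let_def A_def B_def k_def scaleR_conv_of_real add.commute)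
  have dz: "((\<lambda>r. (0::real, cnj m)) has_vector_derivative 0) (at r)" "((\<lambda>r. (1::real, 0::complex)) has_vector_derivative 0) (at r)"
    "((\<lambda>r. (0::real, q)) has_vector_derivative 0) (at r)" for r by (rule has_vector_derivative_const)+
  have d1: "(arc e b y has_vector_derivative
      (A r *\<^sub>R 0 + (e * A r * S r) *\<^sub>R (1, 0)) + (B r *\<^sub>R 0 + (2 * e * (A r)\<^sup>2) *\<^sub>R (0, cnj m)) + 0) (at r)" for r
    unfolding arc by (intro has_vector_derivative_add has_vector_derivative_scaleR dA dB dz)
  then have vel: "velocity (arc e b y) r = (e * A r * S r) *\<^sub>R (1, 0) + (2 * e * (A r)\<^sup>2) *\<^sub>R (0, cnj m)" for r
    unfolding velocity_def by (subst vector_derivative_at[OF d1]) simp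
  show "velocity (arc e b y) r = snd (sect e (exp (e * r + b)) 1 y)"
    unfolding vel by (simp add: sect_def y Let_def A_def S_def k_def scaleR_conv_of_real)
  have "(velocity (arc e b y) has_vector_derivative
      (((e * A r * S r) *\<^sub>R 0 + (A r * (S r)\<^sup>2 - 4 * k * (A r)^3) *\<^sub>R (1, 0))
       + ((2 * e * (A r)\<^sup>2) *\<^sub>R 0 + (4 * (A r)\<^sup>2 * S r) *\<^sub>R (0, cnj m)))) (at r)" for r
    unfolding vel[abs_def]
  proof (intro has_vector_derivative_add has_vector_derivative_scaleR dz)
    have "((\<lambda>r. e * A r * S r) has_real_derivative (e * (e * A r * S r)) * S r + (- 4 * e * k * (A r)\<^sup>2) * (e * A r)) (at r)"
      by (intro DERIV_mult DERIV_cmult dA dS)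
    moreover have "(e * (e * A r * S r)) * S r + (- 4 * e * k * (A r)\<^sup>2) * (e * A r) = (e * e) * (A r * (S r)\<^sup>2 - 4 * k * (A r)^3)"
      by (simp add: algebra_simps power2_eq_square power3_eq_cube)
    ultimately show "((\<lambda>r. e * A r * S r) has_real_derivative A r * (S r)\<^sup>2 - 4 * k * (A r)^3) (at r)"
      by (simp add: ee)
    have "((\<lambda>r. 2 * e * (A r)\<^sup>2) has_real_derivative 2 * e * (2 * A r * (e * A r * S r))) (at r)"
      by (intro DERIV_cmult) (auto intro!: derivative_eq_intros dA)
    moreover have "2 * e * (2 * A r * (e * A r * S r)) = (e * e) * (4 * (A r)\<^sup>2 * S r)"
      by (simp add: algebra_simps power2_eq_square)
    ultimately show "((\<lambda>r. 2 * e * (A r)\<^sup>2) has_real_derivative 4 * (A r)\<^sup>2 * S r) (at r)"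
      by (simp add: ee)
  qed
  then have d2: "(velocity (arc e b y) has_vector_derivative
      (A r * (S r)\<^sup>2 - 4 * k * (A r)^3) *\<^sub>R (1, 0) + (4 * (A r)\<^sup>2 * S r) *\<^sub>R (0, cnj m)) (at r)" for r by simp
  show "complete_geodesic hyp H3 (arc e b y)"
    unfolding complete_geodesic_def
  proof (intro allI conjI)
    fix r
    show H: "arc e b y r \<in> H3" using A0 by (simp add: arc H3_def)
    show "arc e b y differentiable at r" using d1 by (rule differentiableI_vector)
    show "velocity (arc e b y) differentiable at r" using d2 by (rule differentiableI_vector)
    have "velocity (arc e b y) r = (e * A r * S r, (2 * e * (A r)\<^sup>2) *\<^sub>R cnj m)" by (simp add: vel)
    then have "velocity (arc e b y) r \<bullet> velocity (arc e b y) r = (e * e) * (A r * S r)\<^sup>2 + (e * e) * (4 * (A r)^4 * k)"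
      by (simp only: inner_Pair inner_real_def inner_scaleR_left inner_scaleR_right dot_square_norm[of "cnj m"]
          complex_mod_cnj k_def) (simp add: power2_eq_square power4_eq_xxxx)
    then have vv: "velocity (arc e b y) r \<bullet> velocity (arc e b y) r = (A r * S r)\<^sup>2 + 4 * (A r)^4 * k"
      by (simp add: ee)
    have fA: "fst (arc e b y r) = A r" and fv: "fst (velocity (arc e b y) r) = e * A r * S r"
      unfolding vel by (simp_all add: arc)
    show "cov_deriv hyp (arc e b y) (velocity (arc e b y)) r = 0"
      unfolding cov_deriv_def vector_derivative_at[OF d2] christoffel_hyp[OF H] vv fA fv
      using A0[of r] ee
      by (simp add: vel prod_eq_iff scaleR_conv_of_real field_simps power2_eq_square power3_eq_cube power4_eq_xxxx)
  qed
qed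

section \<open>Tangent vectors, their normalisation, and coordinates from the end points\<close>

lemma norm_hvec: "(norm (v :: hvec))\<^sup>2 = (fst v)\<^sup>2 + (cmod (snd v))\<^sup>2"
  by (simp add: norm_prod_def)

lemma hyp_self: "hyp p v v = (norm v / fst p)\<^sup>2"
  by (simp add: hyp_def dot_square_norm power_divide)

lemma unit_tangent_iff: "(p, v) \<in> unit_tangent \<longleftrightarrow> fst p > 0 \<and> norm v = fst p"
proof -
  have "(norm v / fst p)\<^sup>2 = 1 \<longleftrightarrow> norm v = fst p" if "fst p > 0"
    using that by (auto simp: power2_eq_1_iff field_simps dest: order.strict_trans1)
  then show ?thesis by (auto simp: unit_tangent_def H3_def hyp_self)
qed

definition normalize :: "hvec \<times> hvec \<Rightarrow> hvec \<times> hvec" where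
  "normalize a = (fst a, (fst (fst a) / norm (snd a)) *\<^sub>R snd a)"

lemma slit_proj_eq: assumes "a \<in> slit_tangent" shows "slit_proj a = flow_proj (normalize a)"
proof -
  have "sqrt (hyp (fst a) (snd a) (snd a)) = norm (snd a) / fst (fst a)"
    using assms by (auto simp: hyp_self slit_tangent_def H3_def)
  then show ?thesis by (simp add: slit_proj_def normalize_def split_beta)
qed

lemma normalize_unit: "a \<in> slit_tangent \<Longrightarrow> normalize a \<in> unit_tangent"
  by (auto simp: normalize_def unit_tangent_iff slit_tangent_def H3_def)

lemma slit_tangent_iff: "a \<in> slit_tangent \<longleftrightarrow> fst (fst a) > 0 \<and> snd a \<noteq> 0"
  by (cases a) (auto simp: slit_tangent_def H3_def)

lemma unit_subset_slit: "a \<in> unit_tangent \<Longrightarrow> a \<in> slit_tangent"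
  by (cases a) (auto simp: unit_tangent_iff slit_tangent_iff)

lemma normalize_unit_id: "a \<in> unit_tangent \<Longrightarrow> normalize a = a"
  by (cases a) (auto simp: unit_tangent_iff normalize_def)

definition base_dom :: "real \<Rightarrow> (hvec \<times> hvec) set" where
  "base_dom e = {a. fst (fst a) > 0 \<and> snd a \<noteq> 0 \<and> norm (snd a) + e * fst (snd a) \<noteq> 0}"

text \<open>Solves \<open>sect\<close> for \<open>m\<close> and \<open>q\<close>. For nonzero
  vectors the last denominator vanishes exactly at the vertical ones pointing down if
  \<open>e = 1\<close>, up if \<open>e = - 1\<close>.\<close>

definition base_coord :: "real \<Rightarrow> hvec \<times> hvec \<Rightarrow> complex \<times> complex" where
  "base_coord e a =
     (of_real e * cnj (snd (snd a)) / of_real (2 * fst (fst a) * norm (snd a)),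
      snd (fst a) - of_real (e * fst (fst a)) * snd (snd a) / of_real (norm (snd a) + e * fst (snd a)))"

text \<open>For an entry triple (a, b, c) with \<open>e = 1\<close>, the polynomial c w^2 - 2 a w +
  b equals 2 (w - q) (m (w - q) - 1): its roots are the end points, where infinity replaces the
  second root if m = 0. The scale is fixed by a^2 - b c = 1, and \<open>e\<close> records the
  orientation.\<close>

definition base_X :: "real \<Rightarrow> complex \<times> complex \<Rightarrow> cvec" where
  "base_X e = (\<lambda>(m, q). e *\<^sub>R ((1 + 2 * m * q, 2 * q + 2 * m * q\<^sup>2), 2 * m))"

definition base_geod :: "real \<Rightarrow> complex \<times> complex \<Rightarrow> ogeod" where
  "base_geod e y = slit_proj (sect e 1 1 y)"

locale direction =
  fixes e :: real
  assumes e: "e = 1 \<or> e = - 1"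
begin

lemma ee: "e * e = 1" "complex_of_real e * complex_of_real e = 1" "e\<^sup>2 = 1" "e \<noteq> 0" "\<bar>e\<bar> = 1"
  using e by auto

lemma norm_sect:
  assumes "E > 0" "l > 0"
  shows "norm (snd (sect e E l (m, q))) = l * alpha ((cmod m)\<^sup>2) E"
proof -
  define k where "k = (cmod m)\<^sup>2"
  have k: "k \<ge> 0" by (simp add: k_def)
  note a = alpha_beta_sigma[OF k, of E]
  have "(norm (snd (sect e E l (m, q))))\<^sup>2 =
      (l * e * alpha k E * sigma k E)\<^sup>2 + (2 * l * e * (alpha k E)\<^sup>2)\<^sup>2 * k"
    unfolding norm_hvec by (simp add: sect_def k_def[symmetric] norm_mult norm_power power_mult_distrib)
  also have "\<dots> = (e * e) * (l * alpha k E)\<^sup>2 * ((sigma k E)\<^sup>2 + 4 * k * (alpha k E)\<^sup>2)"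
    by (simp add: power2_eq_square algebra_simps)
  also have "\<dots> = (l * alpha k E)\<^sup>2" by (simp add: a(2) ee)
  finally show ?thesis using a(5)[OF assms(1)] assms(2) by (simp add: k_def)
qed

lemma base_coord_sect:
  assumes E: "E > 0" and l: "l > 0"
  shows "sect e E l y \<in> base_dom e" "base_coord e (sect e E l y) = y"
proof -
  obtain m q where y: "y = (m, q)" by (cases y)
  define k where "k = (cmod m)\<^sup>2"
  have k: "k \<ge> 0" by (simp add: k_def)
  define A B S where "A = alpha k E" and "B = beta k E" and "S = sigma k E"
  note ABS = alpha_beta_sigma[OF k, of E, folded A_def B_def S_def]
  have A: "A > 0" using ABS(5) E by simp
  have S: "1 + S > 0" by (rule ABS)
  have n: "norm (snd (sect e E l (m, q))) = l * A" using norm_sect[OF E l] by (simp add: A_def k_def)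
  have s: "sect e E l (m, q) = ((A, q + of_real B * cnj m), (l * e * A * S, of_real (2 * l * e * A\<^sup>2) * cnj m))"
    by (simp add: sect_def Let_def A_def B_def S_def k_def)
  have d: "l * A + e * (l * e * A * S) = l * A * (1 + S)"
  proof -
    have "l * A + e * (l * e * A * S) = l * A * (1 + (e * e) * S)" by (simp add: algebra_simps)
    then show ?thesis by (simp add: ee)
  qed
  have "snd (sect e E l (m, q)) \<noteq> 0" using n l A by (metis mult_pos_pos norm_zero less_irrefl)
  moreover have "l * A * (1 + S) \<noteq> 0" using l A S by simp
  ultimately show "sect e E l y \<in> base_dom e"
    using A d unfolding y base_dom_def mem_Collect_eq n by (simp add: s)
  have "of_real e * cnj (of_real (2 * l * e * A\<^sup>2) * cnj m) / of_real (2 * A * (l * A)) = m"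
    using A l ee by (simp add: power2_eq_square field_simps)
  moreover have "of_real (e * A) * (of_real (2 * l * e * A\<^sup>2) * cnj m) / of_real (l * A * (1 + S)) = of_real B * cnj m"
  proof -
    have "of_real (e * A) * (of_real (2 * l * e * A\<^sup>2) * cnj m) = of_real ((e * e) * (A * l * (2 * A\<^sup>2))) * cnj m"
      by (simp add: algebra_simps)
    also have "(e * e) * (A * l * (2 * A\<^sup>2)) = B * (l * A * (1 + S))" unfolding ee ABS(4)[symmetric] by simp
    finally have "of_real (e * A) * (of_real (2 * l * e * A\<^sup>2) * cnj m) = of_real (B * (l * A * (1 + S))) * cnj m" .
    moreover have "of_real (B * X) * cnj m / of_real X = of_real B * cnj m" if "X \<noteq> 0" for X
      using that by simp
    ultimately show ?thesis using \<open>l * A * (1 + S) \<noteq> 0\<close> by presburger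
  qed
  ultimately show "base_coord e (sect e E l y) = y"
    unfolding y base_coord_def n unfolding s fst_conv snd_conv d by simp
qed

lemma sect_base_coord:
  assumes "a \<in> base_dom e"
  obtains E where "E > 0" "a = sect e E (norm (snd a) / fst (fst a)) (base_coord e a)"
proof -
  obtain t z \<tau> \<zeta> where a: "a = ((t, z), (\<tau>, \<zeta>))" by (metis surj_pair)
  define v :: hvec where "v = (\<tau>, \<zeta>)"
  define n where "n = norm v"
  define D where "D = n + e * \<tau>"
  have t: "t > 0" and n: "n > 0" and D0: "D \<noteq> 0"
    using assms by (auto simp: base_dom_def a v_def n_def D_def)
  have nn: "n\<^sup>2 = \<tau>\<^sup>2 + (cmod \<zeta>)\<^sup>2" by (simp add: n_def v_def norm_hvec)
  then have "\<bar>e * \<tau>\<bar> \<le> n" using n by (simp add: abs_mult ee) (metis abs_le_square_iff abs_of_pos le_add_same_cancel1 zero_le_power2)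
  with D0 have D: "D > 0" unfolding D_def by linarith
  have nn': "(cmod \<zeta>)\<^sup>2 = D * (n - e * \<tau>)"
    using nn ee(3) by (simp add: D_def algebra_simps power2_eq_square)
  define m where "m = of_real e * cnj \<zeta> / of_real (2 * t * n)"
  \<comment> \<open>Forced by the target values: \<open>sigma k E = e * \<tau> / n\<close> gives
    \<open>1 + k * E\<^sup>2 = 2 * n / D\<close>, and then \<open>alpha k E = t\<close> determines
    \<open>E\<close>.\<close>
  define E where "E = 2 * t * n / D"
  define k where "k = (cmod m)\<^sup>2"
  have E: "E > 0" using t n D by (simp add: E_def)
  have "cmod m = cmod \<zeta> / (2 * t * n)"
    using t n by (simp add: m_def norm_divide norm_mult ee)
  then have "k * E\<^sup>2 = (cmod \<zeta>)\<^sup>2 / D\<^sup>2"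
    using t n D by (simp add: k_def E_def power_divide power_mult_distrib)
  then have "k * E\<^sup>2 = D * (n - e * \<tau>) / D\<^sup>2" unfolding nn' .
  then have kE: "k * E\<^sup>2 = (n - e * \<tau>) / D" using D by (simp add: power2_eq_square)
  then have N: "1 + k * E\<^sup>2 = 2 * n / D" using D by (simp add: D_def field_simps)
  have A: "alpha k E = t" unfolding alpha_def N using n D by (simp add: E_def)
  have B: "beta k E = 2 * t\<^sup>2 * n / D"
    unfolding beta_def N using n D by (simp add: E_def power2_eq_square field_simps)
  have S: "sigma k E = e * \<tau> / n"
  proof -
    have "1 - k * E\<^sup>2 = 2 * (e * \<tau>) / D" unfolding kE using D by (simp add: D_def field_simps)
    then show ?thesis unfolding sigma_def N using n D by simp
  qed
  have bc: "base_coord e a = (m, z - of_real (e * t) * \<zeta> / of_real D)"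
    by (simp add: base_coord_def a m_def D_def n_def v_def)
  have cm: "cnj m = of_real e * \<zeta> / of_real (2 * t * n)" by (simp add: m_def)
  have 1: "- (of_real (e * t) * \<zeta> / of_real D) + of_real (2 * t\<^sup>2 * n / D) * cnj m = 0"
    unfolding cm using t n D by (simp add: field_simps power2_eq_square)
  have 2: "n / t * e * t * (e * \<tau> / n) = (e * e) * \<tau>" using t n by simp
  have 3: "of_real (2 * (n / t) * e * t\<^sup>2) * cnj m = (of_real e * of_real e) * \<zeta>"
    unfolding cm using t n by (simp add: field_simps power2_eq_square)
  have "sect e E (n / t) (base_coord e a) = ((t, z), (\<tau>, \<zeta>))"
    unfolding bc sect_def split Let_def k_def[symmetric] A B S 2 3 ee using 1 by (simp add: algebra_simps)
  then show ?thesis using E that[of E] by (simp add: a n_def v_def)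
qed

text \<open>Conservation of the moment in explicit form: the identities for \<open>alpha\<close>,
  \<open>beta\<close> and \<open>sigma\<close> eliminate the position \<open>E\<close>.\<close>

lemma moment_sect:
  assumes "E > 0" shows "moment (sect e E l y) = l *\<^sub>R base_X e y"
proof -
  obtain m q where y: "y = (m, q)" by (cases y)
  define k where "k = (cmod m)\<^sup>2"
  have k: "k \<ge> 0" by (simp add: k_def)
  have mm: "m * cnj m = of_real k" unfolding k_def by (rule complex_norm_square[symmetric])
  define A B S where "A = alpha k E" and "B = beta k E" and "S = sigma k E"
  note ABS = alpha_beta_sigma[OF k, of E, folded A_def B_def S_def]
  have A: "A > 0" using ABS(5) assms by simp
  have 1: "2 * of_real k * of_real B + of_real S = (1 :: complex)"
    using ABS(1) by (metis of_real_1 of_real_add of_real_mult of_real_numeral)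
  have 3: "of_real B * (of_real k * of_real B + of_real S) = (of_real A :: complex)\<^sup>2"
    using ABS(3) by (metis of_real_add of_real_mult of_real_power)
  have s: "sect e E l (m, q) = ((A, q + of_real B * cnj m), (l * e * A * S, of_real (2 * l * e * A\<^sup>2) * cnj m))"
    by (simp add: sect_def Let_def A_def B_def S_def k_def)
  have c: "cnj (of_real (2 * l * e * A\<^sup>2) * cnj m) / of_real (A\<^sup>2) = of_real (l * e) * (2 * m)"
    using A by simp
  have sg: "l * e * A * S / A = l * e * S" using A by simp
  define Bm where "Bm = of_real B * cnj m"
  have Bm: "m * Bm = of_real k * of_real B" by (simp add: Bm_def mm[symmetric])
  have one: "2 * (m * Bm) + of_real S = 1" using 1 by (simp add: Bm mult.assoc)
  have "(q + Bm) * (2 * m) + of_real S = 2 * m * q + (2 * (m * Bm) + of_real S)"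
    by (simp add: algebra_simps)
  then have first: "(q + Bm) * (2 * m) + of_real S = 1 + 2 * m * q" unfolding one by simp
  have "(q + Bm)\<^sup>2 * (2 * m) + 2 * (q + Bm) * of_real S - 2 * of_real (A\<^sup>2) * cnj m
      = 2 * m * q\<^sup>2 + 2 * q * (2 * (m * Bm) + of_real S) + 2 * (Bm * (m * Bm) + Bm * of_real S - of_real (A\<^sup>2) * cnj m)"
    by (simp add: algebra_simps power2_eq_square)
  also have "2 * (m * Bm) + of_real S = 1" by (rule one)
  also have "Bm * (m * Bm) + Bm * of_real S - of_real (A\<^sup>2) * cnj m
      = cnj m * (of_real B * (of_real k * of_real B + of_real S) - (of_real A)\<^sup>2)"
    unfolding Bm by (simp add: Bm_def algebra_simps)
  also have "\<dots> = 0" by (simp add: 3)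
  finally have second: "(q + Bm)\<^sup>2 * (2 * m) + 2 * (q + Bm) * of_real S - 2 * of_real (A\<^sup>2) * cnj m = 2 * q + 2 * m * q\<^sup>2"
    by simp
  have a1: "(q + Bm) * (of_real (l * e) * (2 * m)) + of_real (l * e * S) = of_real (l * e) * (1 + 2 * m * q)"
    unfolding first[symmetric] by (simp add: algebra_simps)
  have a2: "(q + Bm)\<^sup>2 * (of_real (l * e) * (2 * m)) + 2 * (q + Bm) * of_real (l * e * S)
      - of_real (2 * l * e * A\<^sup>2) * cnj m = of_real (l * e) * (2 * q + 2 * m * q\<^sup>2)"
    unfolding second[symmetric] by (simp add: algebra_simps)
  show ?thesis
    unfolding y s moment_def split c sg Bm_def[symmetric] a1 a2
    by (simp add: base_X_def scaleR_conv_of_real)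
qed

text \<open>The third entry gives \<open>m\<close>; then \<open>q\<close> is read off the first
  entry if \<open>m\<close> is nonzero and off the second otherwise.\<close>

lemma inj_base_X: "inj (base_X e)"
proof (rule injI)
  fix y y' assume "base_X e y = base_X e y'"
  then show "y = y'" using ee(4)
    by (cases y, cases y', cases "fst y = 0") (auto simp: base_X_def)
qed

lemma normalize_sect: assumes "E > 0" "l > 0" shows "normalize (sect e E l y) = sect e E 1 y"
proof -
  obtain m q where y: "y = (m, q)" by (cases y)
  have "alpha ((cmod m)\<^sup>2) E > 0" by (rule alpha_beta_sigma) (use assms in auto)
  then show ?thesis
    unfolding normalize_def y norm_sect[OF assms] using assms
    by (simp add: sect_def Let_def scaleR_conv_of_real)
qed

lemma moment_normalize:
  assumes "a \<in> base_dom e" shows "moment (normalize a) = base_X e (base_coord e a)"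
proof -
  obtain E where E: "E > 0" "a = sect e E (norm (snd a) / fst (fst a)) (base_coord e a)"
    using sect_base_coord[OF assms] .
  have "norm (snd a) / fst (fst a) > 0" using assms by (simp add: base_dom_def)
  from normalize_sect[OF E(1) this, of "base_coord e a"] E(2) have "normalize a = sect e E 1 (base_coord e a)" by simp
  then show ?thesis by (simp add: moment_sect E(1))
qed

lemma base_dom_subset: "a \<in> base_dom e \<Longrightarrow> a \<in> slit_tangent"
  by (simp add: base_dom_def slit_tangent_iff)

text \<open>A nonzero vector outside \<open>base_dom e\<close> is vertical, and its moment has first
  entry \<open>- e\<close> and third entry 0, whereas \<open>base_X e\<close> has first entry
  \<open>e\<close> when its third entry is 0.\<close>

lemma base_dom_if_moment:
  assumes a: "a \<in> slit_tangent" and m: "moment (normalize a) = base_X e y"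
  shows "a \<in> base_dom e"
proof (rule ccontr)
  assume "a \<notin> base_dom e"
  with a have n: "norm (snd a) = - e * fst (snd a)" by (auto simp: base_dom_def slit_tangent_iff add_eq_0_iff)
  have "(norm (snd a))\<^sup>2 = (fst (snd a))\<^sup>2" unfolding n by (simp add: power_mult_distrib ee)
  then have z: "snd (snd a) = 0" using norm_hvec[of "snd a"] by simp
  have "fst (snd a) = - (e * norm (snd a))" using n ee(1) by (simp add: mult.assoc[symmetric])
  then have "fst (fst (moment (normalize a))) = - of_real e" "snd (moment (normalize a)) = 0"
    using z a by (simp_all add: moment_def normalize_def split_beta slit_tangent_iff)
  then show False using m ee(4) by (cases y) (auto simp: base_X_def scaleR_conv_of_real)
qed

end

text \<open>The two excluded expressions add up to twice the norm, so they cannot both vanish on a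
  nonzero vector.\<close>

lemma base_dom_cover:
  assumes "a \<in> slit_tangent" obtains e where "direction e" "a \<in> base_dom e"
proof (cases "norm (snd a) + fst (snd a) = 0")
  case True
  then have "norm (snd a) - fst (snd a) \<noteq> 0" using assms by (auto simp: slit_tangent_iff)
  then show ?thesis using assms that[of "- 1"] by (simp add: base_dom_def slit_tangent_iff direction_def)
next
  case False
  then show ?thesis using assms that[of 1] by (simp add: base_dom_def slit_tangent_iff direction_def)
qed

text \<open>The orbits of the geodesic flow are the level sets of the moment. Equal moments force
  equal base coordinates, so both vectors lie on one explicit arc and differ only in the position
  \<open>E\<close>.\<close>

lemma flow_rel_iff:
  "(a, b) \<in> flow_rel \<longleftrightarrow> a \<in> unit_tangent \<and> b \<in> unit_tangent \<and> moment a = moment b"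
proof safe
  assume "(a, b) \<in> flow_rel"
  then obtain c r where c: "complete_geodesic hyp H3 c" "(c 0, velocity c 0) = a" "(c r, velocity c r) = b"
    "a \<in> unit_tangent" "b \<in> unit_tangent"
    by (auto simp: flow_rel_def)
  then show "a \<in> unit_tangent" "b \<in> unit_tangent" by auto
  show "moment a = moment b" using moment_constant[OF c(1), of 0 r] c(2,3) by simp
next
  assume a: "a \<in> unit_tangent" and b: "b \<in> unit_tangent" and m: "moment a = moment b"
  have unit_ratio: "norm (snd x) / fst (fst x) = 1" if "x \<in> unit_tangent" for x
    using that by (cases x) (auto simp: unit_tangent_iff)
  note na = normalize_unit_id[OF a] and nb = normalize_unit_id[OF b]
  obtain e where "direction e" and ad: "a \<in> base_dom e" using base_dom_cover[OF unit_subset_slit[OF a]] .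
  interpret direction e by fact
  have ma: "moment a = base_X e (base_coord e a)" using moment_normalize[OF ad] na by simp
  have bd: "b \<in> base_dom e"
    by (rule base_dom_if_moment[OF unit_subset_slit[OF b], where y = "base_coord e a"]) (simp add: nb ma m[symmetric])
  have "base_coord e a = base_coord e b"
    using moment_normalize[OF bd] nb m ma injD[OF inj_base_X] by metis
  moreover obtain E where E: "E > 0" "a = sect e E 1 (base_coord e a)"
    using sect_base_coord[OF ad] unfolding unit_ratio[OF a] .
  moreover obtain F where F: "F > 0" "b = sect e F 1 (base_coord e b)"
    using sect_base_coord[OF bd] unfolding unit_ratio[OF b] .
  ultimately obtain y where aE: "a = sect e E 1 y" and bF: "b = sect e F 1 y" by metis
  define c where "c = arc e (ln E) y"
  have "complete_geodesic hyp H3 c" unfolding c_def by (rule arc_geodesic[OF e])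
  moreover have "(c 0, velocity c 0) = a"
    unfolding c_def arc_geodesic(2)[OF e] by (simp add: arc_def aE E(1))
  \<comment> \<open>Along the arc \<open>ln E\<close> changes at rate \<open>e\<close>, and
    \<open>e\<close> is its own reciprocal.\<close>
  moreover have "(c (e * (ln F - ln E)), velocity c (e * (ln F - ln E))) = b"
    unfolding c_def arc_geodesic(2)[OF e]
    by (simp add: arc_def bF F(1) mult.assoc[symmetric] ee)
  ultimately show "(a, b) \<in> flow_rel" unfolding flow_rel_def using a b by blast
qed

section \<open>Oriented geodesics as points of the quadric\<close>

lemma flow_proj_eq: "a \<in> unit_tangent \<Longrightarrow> flow_proj a = {b \<in> unit_tangent. moment b = moment a}"
  by (auto simp: flow_proj_def flow_rel_iff)

lemma flow_proj_LH3: "a \<in> unit_tangent \<Longrightarrow> flow_proj a \<in> LH3"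
  by (auto simp: LH3_def flow_proj_def quotient_def)

lemma LH3_eq: "LH3 = flow_proj ` unit_tangent"
  by (auto simp: LH3_def flow_proj_def quotient_def)

text \<open>The representative is immaterial, since the moment is constant on an orbit.\<close>

definition embed :: "ogeod \<Rightarrow> cvec" where
  "embed \<gamma> = moment (SOME a. a \<in> \<gamma>)"

lemma embed_flow_proj: assumes "a \<in> unit_tangent" shows "embed (flow_proj a) = moment a"
proof -
  have "(SOME b. b \<in> flow_proj a) \<in> flow_proj a"
    by (rule someI[of _ a]) (simp add: flow_proj_eq assms)
  then show ?thesis by (simp add: flow_proj_eq assms embed_def)
qed

lemma embed_slit_proj: "a \<in> slit_tangent \<Longrightarrow> embed (slit_proj a) = moment (normalize a)"
  by (simp add: slit_proj_eq embed_flow_proj normalize_unit)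

lemma inj_embed: "inj_on embed LH3"
proof (rule inj_onI)
  fix \<gamma> \<gamma>' assume "\<gamma> \<in> LH3" "\<gamma>' \<in> LH3" and eq: "embed \<gamma> = embed \<gamma>'"
  then obtain a b where ab: "a \<in> unit_tangent" "b \<in> unit_tangent" "\<gamma> = flow_proj a" "\<gamma>' = flow_proj b"
    unfolding LH3_eq by blast
  with eq have "moment a = moment b" by (simp add: embed_flow_proj)
  with ab show "\<gamma> = \<gamma>'" by (simp add: flow_proj_eq)
qed

lemma slit_proj_LH3: "a \<in> slit_tangent \<Longrightarrow> slit_proj a \<in> LH3"
  by (simp add: slit_proj_eq flow_proj_LH3 normalize_unit)

context direction
begin

lemma sect_slit: "E > 0 \<Longrightarrow> l > 0 \<Longrightarrow> sect e E l y \<in> slit_tangent"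
  by (intro base_dom_subset base_coord_sect)

lemma embed_base_geod: "embed (base_geod e y) = base_X e y"
  unfolding base_geod_def by (simp add: embed_slit_proj sect_slit normalize_sect moment_sect)

lemma base_geod_LH3: "base_geod e y \<in> LH3"
  unfolding base_geod_def by (intro slit_proj_LH3 sect_slit) auto

lemma inj_base_geod: "inj (base_geod e)"
  by (rule injI) (metis embed_base_geod inj_base_X injD)

text \<open>In base coordinates the quotient projection becomes \<open>base_coord e\<close>. The
  equivalence also identifies the preimage of a chart domain, as the atlas requires.\<close>

lemma slit_proj_eq_base_geod_iff:
  assumes "a \<in> slit_tangent"
  shows "slit_proj a = base_geod e y \<longleftrightarrow> a \<in> base_dom e \<and> base_coord e a = y"
proof
  assume "slit_proj a = base_geod e y"
  then have m: "moment (normalize a) = base_X e y" using embed_slit_proj[OF assms] embed_base_geod by simp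
  then have "a \<in> base_dom e" by (rule base_dom_if_moment[OF assms])
  with m show "a \<in> base_dom e \<and> base_coord e a = y"
    using moment_normalize inj_base_X by (auto dest: injD)
next
  assume "a \<in> base_dom e \<and> base_coord e a = y"
  then have "embed (slit_proj a) = embed (base_geod e y)"
    by (simp add: embed_slit_proj[OF assms] embed_base_geod moment_normalize)
  then show "slit_proj a = base_geod e y"
    by (rule inj_onD[OF inj_embed]) (simp_all add: slit_proj_LH3 base_geod_LH3 assms)
qed

end

lemma base_geod_cover:
  assumes "\<gamma> \<in> LH3" obtains e y where "direction e" "\<gamma> = base_geod e y"
proof -
  obtain a where a: "a \<in> unit_tangent" "\<gamma> = flow_proj a" using assms by (auto simp: LH3_eq)
  then have s: "a \<in> slit_tangent" by (intro unit_subset_slit)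
  then obtain e where e: "direction e" "a \<in> base_dom e" by (rule base_dom_cover)
  have "\<gamma> = base_geod e (base_coord e a)"
    using direction.slit_proj_eq_base_geod_iff[OF e(1) s] e(2) slit_proj_eq[OF s] a normalize_unit_id by simp
  with e(1) show ?thesis by (rule that)
qed

section \<open>The atlas of the space of oriented geodesics\<close>

lemma smooth_on_transform:
  assumes "smooth_on S f" "open S" "\<And>x. x \<in> S \<Longrightarrow> f x = g x" shows "smooth_on S g"
  using smooth_on_cong[OF assms(2), of f g] assms by simp

lemma surj_compD: "surj (f \<circ> g) \<Longrightarrow> surj f"
  unfolding surj_def comp_def by blast

lemma open_base_dom: "open (base_dom e)"
proof -
  have eq: "base_dom e = {a. 0 < fst (fst a)} \<inter> {a. snd a \<noteq> 0} \<inter> {a. norm (snd a) + e * fst (snd a) \<noteq> 0}"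
    by (auto simp: base_dom_def)
  show ?thesis unfolding eq
    by (intro open_Int open_Collect_less open_Collect_neq continuous_intros)
qed

lemma smooth_base_coord: "smooth_on (base_dom e) (base_coord e)"
proof -
  have n: "smooth_on (base_dom e) (\<lambda>a. norm (snd a))"
    unfolding norm_eq_sqrt_inner
    by (intro smooth_on_sqrt smooth_intros open_base_dom) (auto simp: base_dom_def)
  have pos: "fst (fst a) \<noteq> 0" "norm (snd a) \<noteq> 0" "norm (snd a) + e * fst (snd a) \<noteq> 0" if "a \<in> base_dom e" for a
    using that by (auto simp: base_dom_def)
  have "smooth_on (base_dom e) (\<lambda>a. (of_real e * cnj (snd (snd a)) / of_real (2 * fst (fst a) * norm (snd a)),
      snd (fst a) - of_real (e * fst (fst a)) * snd (snd a) / of_real (norm (snd a) + e * fst (snd a))))"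
    by (intro smooth_intros n open_base_dom; use pos in \<open>simp only: of_real_eq_0_iff mult_eq_0_iff; simp\<close>)
  then show ?thesis unfolding base_coord_def[abs_def] .
qed

lemma smooth_sect: "smooth_on UNIV (sect e E l)"
proof -
  let ?k = "\<lambda>p :: complex \<times> complex. fst p \<bullet> fst p"
  let ?g = "\<lambda>p. ((alpha (?k p) E, snd p + of_real (beta (?k p) E) * cnj (fst p)),
      (l * e * alpha (?k p) E * sigma (?k p) E, of_real (2 * l * e * (alpha (?k p) E)\<^sup>2) * cnj (fst p)))"
  have pos: "1 + (m \<bullet> m) * E\<^sup>2 \<noteq> 0" for m :: complex
    by (metis add_nonneg_pos add.commute inner_ge_zero less_irrefl mult_nonneg_nonneg zero_le_power2 zero_less_one)
  have "smooth_on UNIV (\<lambda>p. alpha (?k p) E)" "smooth_on UNIV (\<lambda>p. beta (?k p) E)" "smooth_on UNIV (\<lambda>p. sigma (?k p) E)"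
    unfolding alpha_def beta_def sigma_def by (intro smooth_intros open_UNIV pos)+
  then have "smooth_on UNIV ?g" by (intro smooth_intros open_UNIV)
  moreover have "sect e E l = ?g"
    by (simp add: sect_def split_beta Let_def dot_square_norm fun_eq_iff)
  ultimately show ?thesis by simp
qed

lemma base_X_has_derivative:
  "(base_X e has_derivative (\<lambda>v. e *\<^sub>R ((2 * (fst y * snd v + snd y * fst v),
      2 * snd v + 4 * fst y * snd y * snd v + 2 * (snd y)\<^sup>2 * fst v), 2 * fst v))) (at y)"
  unfolding base_X_def split_beta
  by (auto intro!: derivative_eq_intros simp: algebra_simps fun_eq_iff)

lemma ddir_base_X:
  "ddir (base_X e) y v = e *\<^sub>R ((2 * (fst y * snd v + snd y * fst v),
      2 * snd v + 4 * fst y * snd y * snd v + 2 * (snd y)\<^sup>2 * fst v), 2 * fst v)"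
  by (simp add: frechet_derivative_at[OF base_X_has_derivative, symmetric])

context direction
begin

lemma base_quadric_immersion: "quadric_immersion UNIV (base_X e)"
proof
  show "open (UNIV :: (complex \<times> complex) set)" by simp
  have "smooth_on UNIV (\<lambda>p :: complex \<times> complex. e *\<^sub>R ((1 + 2 * fst p * snd p, 2 * snd p + 2 * fst p * (snd p)\<^sup>2), 2 * fst p))"
    by (intro smooth_intros open_UNIV)
  then show "smooth_on UNIV (base_X e)" by (simp only: base_X_def split_beta')
  show "qform (base_X e y) (base_X e y) = 1" for y
  proof -
    have "qform (base_X e y) (base_X e y) = of_real (e * e)"
      by (simp add: base_X_def split_beta qform_def scaleR_conv_of_real algebra_simps power2_eq_square)
    then show ?thesis by (simp add: ee)
  qed
  show "inj (ddir (base_X e) y)" for y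
  proof (rule injI)
    fix v w assume "ddir (base_X e) y v = ddir (base_X e) y w"
    then have f: "fst v = fst w" and 1: "fst y * snd v = fst y * snd w"
      and 2: "2 * snd v + 4 * snd y * (fst y * snd v) = 2 * snd w + 4 * snd y * (fst y * snd w)"
      using ee(4) unfolding ddir_base_X by (auto simp: algebra_simps)
    from 2 have "snd v = snd w" unfolding 1 by simp
    with f show "v = w" by (simp add: prod_eq_iff)
  qed
qed

text \<open>On tangent vectors such a chart reads as \<open>g\<close> after
  \<open>base_coord e\<close>. The latter is a submersion because it has a smooth section through
  every point of its domain.\<close>

lemma chart_in_atlas:
  assumes O: "open O'" and g: "smooth_on O' g" and inj: "inj_on g O'"
    and surj: "\<And>y. y \<in> O' \<Longrightarrow> surj (ddir g y)"
    and W: "W = base_geod e ` O'" and \<phi>: "\<And>y. y \<in> O' \<Longrightarrow> \<phi> (base_geod e y) = g y"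
  shows "(W, \<phi>) \<in> LH3_atlas"
proof -
  define P where "P = {a \<in> slit_tangent. slit_proj a \<in> W}"
  have P_iff: "a \<in> P \<longleftrightarrow> a \<in> base_dom e \<and> base_coord e a \<in> O'" for a
  proof (cases "a \<in> slit_tangent")
    case True
    then show ?thesis by (auto simp: P_def W image_iff Bex_def slit_proj_eq_base_geod_iff simp del: split_paired_Ex)
  next
    case False
    then show ?thesis using base_dom_subset by (simp add: P_def) blast
  qed
  then have "P = base_dom e \<inter> base_coord e -` O'" by auto
  then have oP: "open P"
    using continuous_on_open_vimage[OF open_base_dom] smooth_on_continuous[OF smooth_base_coord] O
    by (metis Int_commute)
  have f: "(\<phi> \<circ> slit_proj) a = g (base_coord e a)" if "a \<in> P" for a
  proof -
    from that have a: "a \<in> base_dom e" "base_coord e a \<in> O'" by (simp_all add: P_iff)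
    then have "slit_proj a = base_geod e (base_coord e a)"
      using slit_proj_eq_base_geod_iff[OF base_dom_subset] by blast
    with \<phi>[OF a(2)] show ?thesis by simp
  qed
  have sbc: "smooth_on P (base_coord e)" by (rule smooth_on_subset[OF smooth_base_coord]) (auto simp: P_iff)
  have "smooth_on P (\<lambda>a. g (base_coord e a))"
    by (rule smooth_on_compose[OF oP O _ sbc g]) (auto simp: P_iff)
  then have smf: "smooth_on P (\<phi> \<circ> slit_proj)" by (rule smooth_on_transform[OF _ oP]) (rule f[symmetric])
  have "surj (ddir (\<phi> \<circ> slit_proj) a)" if a: "a \<in> P" for a
  proof -
    have "a \<in> base_dom e" using a by (simp add: P_iff)
    from sect_base_coord[OF this] obtain E
      where E: "E > 0" "a = sect e E (norm (snd a) / fst (fst a)) (base_coord e a)" .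
    \<comment> \<open>With this speed the section \<open>sect e E l\<close> passes through
      \<open>a\<close> itself.\<close>
    define l where "l = norm (snd a) / fst (fst a)"
    have l: "l > 0" using a by (simp add: l_def P_iff base_dom_def)
    let ?y = "base_coord e a"
    have dbc: "(base_coord e has_derivative ddir (base_coord e) a) (at a)"
      by (rule smooth_on_has_derivative[OF oP sbc a])
    have ds: "(sect e E l has_derivative ddir (sect e E l) ?y) (at ?y)"
      by (rule smooth_on_has_derivative[OF open_UNIV smooth_sect UNIV_I])
    have "(base_coord e has_derivative ddir (base_coord e) a) (at (sect e E l ?y))"
      using dbc E(2) by (simp add: l_def)
    from has_derivative_compose[OF ds this]
    have "((\<lambda>y. y) has_derivative (\<lambda>v. ddir (base_coord e) a (ddir (sect e E l) ?y v))) (at ?y)"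
      by (simp add: base_coord_sect(2)[OF E(1) l])
    then have "(\<lambda>v. ddir (base_coord e) a (ddir (sect e E l) ?y v)) = (\<lambda>v. v)"
      using has_derivative_unique has_derivative_ident by blast
    then have s1: "surj (ddir (base_coord e) a)" by (metis surjI)
    have "((\<lambda>a. g (base_coord e a)) has_derivative (\<lambda>v. ddir g ?y (ddir (base_coord e) a v))) (at a)"
      using a by (intro has_derivative_compose[OF dbc] smooth_on_has_derivative[OF O g]) (simp add: P_iff)
    then have "((\<phi> \<circ> slit_proj) has_derivative (\<lambda>v. ddir g ?y (ddir (base_coord e) a v))) (at a)"
      by (rule has_derivative_transform_within_open[OF _ oP a]) (rule f[symmetric])
    then have "ddir (\<phi> \<circ> slit_proj) a = ddir g ?y \<circ> ddir (base_coord e) a"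
      by (simp add: frechet_derivative_at[symmetric] comp_def)
    moreover have "surj (ddir g ?y)" using surj a by (simp add: P_iff)
    ultimately show ?thesis using s1 comp_surj by metis
  qed
  moreover have "inj_on \<phi> W" using inj \<phi> unfolding W by (auto simp: inj_on_def)
  moreover have "W \<subseteq> LH3" using base_geod_LH3 by (auto simp: W)
  ultimately show ?thesis
    using oP smf unfolding LH3_atlas_def by (simp add: P_def Let_def)
qed

definition "in_chart c = {y. base_geod e y \<in> cdom c}"

definition "base_trans c y = cmap c (base_geod e y)"

text \<open>The converse of \<open>chart_in_atlas\<close>. Precomposing the chart with the section
  \<open>sect e 1 1\<close> gives smoothness; factoring it through \<open>base_coord e\<close> shows
  that its surjective derivative factors through that of \<open>base_trans c\<close>.\<close>

lemma chart_base_trans: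
  assumes c: "c \<in> LH3_atlas"
  shows "open (in_chart c)" "smooth_on (in_chart c) (base_trans c)" "inj_on (base_trans c) (in_chart c)"
    "y \<in> in_chart c \<Longrightarrow> surj (ddir (base_trans c) y)"
proof -
  obtain W \<phi> where Wp: "c = (W, \<phi>)" by (cases c)
  define P where "P = {a \<in> slit_tangent. slit_proj a \<in> W}"
  define f where "f = \<phi> \<circ> slit_proj"
  have W: "inj_on \<phi> W" "open P" "smooth_on P f" "\<And>a. a \<in> P \<Longrightarrow> surj (ddir f a)"
    using c unfolding Wp LH3_atlas_def by (simp_all add: P_def f_def Let_def)
  have O_iff: "y \<in> in_chart c \<longleftrightarrow> sect e 1 1 y \<in> P" for y
    by (simp add: in_chart_def Wp P_def base_geod_def sect_slit)
  have T: "base_trans c y = f (sect e 1 1 y)" for y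
    by (simp add: base_trans_def Wp f_def base_geod_def)
  have "in_chart c = sect e 1 1 -` P" using O_iff by auto
  then show O: "open (in_chart c)"
    using smooth_on_continuous[OF smooth_sect] W(2) by (metis continuous_on_open_vimage Int_UNIV_right open_UNIV)
  have ss: "smooth_on (in_chart c) (sect e 1 1)" by (rule smooth_on_subset[OF smooth_sect]) simp
  show sT: "smooth_on (in_chart c) (base_trans c)"
    unfolding T[abs_def] by (rule smooth_on_compose[OF O W(2) _ ss W(3)]) (auto simp: O_iff)
  show "inj_on (base_trans c) (in_chart c)"
    using W(1) inj_base_geod by (auto simp: inj_on_def base_trans_def in_chart_def Wp)
  show "surj (ddir (base_trans c) y)" if y: "y \<in> in_chart c"
  proof -
    let ?a = "sect e 1 1 y"
    define Q where "Q = P \<inter> base_dom e"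
    have oQ: "open Q" using W(2) open_base_dom by (auto simp: Q_def)
    have bd: "?a \<in> base_dom e" and bc: "base_coord e ?a = y" by (intro base_coord_sect; simp)+
    have aQ: "?a \<in> Q" using y bd by (simp add: Q_def O_iff)
    have fT: "base_trans c (base_coord e a) = f a" if "a \<in> Q" for a
    proof -
      have "a \<in> slit_tangent" "a \<in> base_dom e" using that by (auto simp: Q_def P_def)
      then have "slit_proj a = base_geod e (base_coord e a)" using slit_proj_eq_base_geod_iff by blast
      then show ?thesis by (simp add: base_trans_def f_def Wp)
    qed
    have dT: "(base_trans c has_derivative ddir (base_trans c) y) (at (base_coord e ?a))"
      unfolding bc by (rule smooth_on_has_derivative[OF O sT y])
    have "((\<lambda>a. base_trans c (base_coord e a)) has_derivative
        (\<lambda>v. ddir (base_trans c) y (ddir (base_coord e) ?a v))) (at ?a)"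
      by (rule has_derivative_compose[OF smooth_on_has_derivative[OF open_base_dom smooth_base_coord bd] dT])
    then have "(f has_derivative (\<lambda>v. ddir (base_trans c) y (ddir (base_coord e) ?a v))) (at ?a)"
      by (rule has_derivative_transform_within_open[OF _ oQ aQ]) (rule fT)
    then have "ddir f ?a = ddir (base_trans c) y \<circ> ddir (base_coord e) ?a"
      by (simp add: frechet_derivative_at[symmetric] comp_def)
    moreover have "surj (ddir f ?a)" using W(4) y by (simp add: O_iff)
    ultimately show ?thesis using surj_compD by metis
  qed
qed

end

lemma chart_inj: "c \<in> LH3_atlas \<Longrightarrow> inj_on (cmap c) (cdom c)" and chart_LH3: "c \<in> LH3_atlas \<Longrightarrow> cdom c \<subseteq> LH3"
  by (auto simp: LH3_atlas_def)

lemma chart_point: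
  assumes "c \<in> LH3_atlas" "\<gamma> \<in> cdom c"
  obtains e y where "direction e" "y \<in> direction.in_chart e c" "\<gamma> = base_geod e y" "cmap c \<gamma> = direction.base_trans e c y"
proof -
  have "\<gamma> \<in> LH3" using chart_LH3[OF assms(1)] assms(2) by blast
  then obtain e y where de: "direction e" and y: "\<gamma> = base_geod e y" by (rule base_geod_cover)
  interpret direction e by (rule de)
  show ?thesis using that[OF de, of y] y assms(2) by (simp add: in_chart_def base_trans_def)
qed

text \<open>The parametrisation of the quadric by the coordinates of \<open>c\<close>. All three
  tensor fields are induced by it alone.\<close>

definition chart_X :: "(ogeod, complex \<times> complex) chart \<Rightarrow> complex \<times> complex \<Rightarrow> cvec" where
  "chart_X c x = embed (inv_into (cdom c) (cmap c) x)"

lemma chart_X_cmap: "c \<in> LH3_atlas \<Longrightarrow> \<gamma> \<in> cdom c \<Longrightarrow> chart_X c (cmap c \<gamma>) = embed \<gamma>"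
  by (simp add: chart_X_def chart_inj)

context direction
begin

lemma in_chartD: "y \<in> in_chart c \<Longrightarrow> base_trans c y \<in> cimg c"
  by (auto simp: in_chart_def base_trans_def)

lemma chart_X_base_trans: "c \<in> LH3_atlas \<Longrightarrow> y \<in> in_chart c \<Longrightarrow> chart_X c (base_trans c y) = base_X e y"
  by (simp add: base_trans_def in_chart_def chart_X_cmap embed_base_geod)

lemma chart_X_smooth:
  assumes c: "c \<in> LH3_atlas"
  shows "open (base_trans c ` in_chart c)" "smooth_on (base_trans c ` in_chart c) (chart_X c)"
proof -
  note T = chart_base_trans[OF c]
  note inv = smooth_inverse_function[OF T]
  show o: "open (base_trans c ` in_chart c)" by (rule inv(1))
  have A: "smooth_on (base_trans c ` in_chart c) (\<lambda>x. base_X e (inv_into (in_chart c) (base_trans c) x))"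
    by (rule smooth_on_compose[OF o open_UNIV _ inv(2) quadric_immersion.smooth_X[OF base_quadric_immersion]]) auto
  show "smooth_on (base_trans c ` in_chart c) (chart_X c)"
  proof (rule smooth_on_transform[OF A o])
    fix x assume "x \<in> base_trans c ` in_chart c"
    then obtain y where "y \<in> in_chart c" "x = base_trans c y" by blast
    then show "base_X e (inv_into (in_chart c) (base_trans c) x) = chart_X c x"
      by (simp add: chart_X_base_trans[OF c] inv_into_f_f[OF T(3)])
  qed
qed

lemma ddir_chart_X:
  assumes c: "c \<in> LH3_atlas" and y: "y \<in> in_chart c"
  shows "ddir (chart_X c) (base_trans c y) (ddir (base_trans c) y v) = ddir (base_X e) y v"
proof -
  note T = chart_base_trans[OF c]
  have "((\<lambda>y. chart_X c (base_trans c y)) has_derivative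
      (\<lambda>v. ddir (chart_X c) (base_trans c y) (ddir (base_trans c) y v))) (at y)"
    by (rule has_derivative_compose[OF smooth_on_has_derivative[OF T(1,2) y]
          smooth_on_has_derivative[OF chart_X_smooth[OF c]]]) (use y in auto)
  then have "(base_X e has_derivative (\<lambda>v. ddir (chart_X c) (base_trans c y) (ddir (base_trans c) y v))) (at y)"
    by (rule has_derivative_transform_within_open[OF _ T(1) y]) (simp add: chart_X_base_trans[OF c])
  from frechet_derivative_at[OF this, symmetric] show ?thesis by simp
qed

lemma inj_ddir_chart_X:
  assumes c: "c \<in> LH3_atlas" and y: "y \<in> in_chart c"
  shows "inj (ddir (chart_X c) (base_trans c y))"
proof (rule injI)
  fix w w' assume eq: "ddir (chart_X c) (base_trans c y) w = ddir (chart_X c) (base_trans c y) w'"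
  have s: "surj (ddir (base_trans c) y)" by (rule chart_base_trans(4)[OF c y])
  obtain v v' where v: "w = ddir (base_trans c) y v" "w' = ddir (base_trans c) y v'" using s by (metis surjE)
  with eq have "ddir (base_X e) y v = ddir (base_X e) y v'" by (simp add: ddir_chart_X[OF c y])
  then have "v = v'" using quadric_immersion.inj_DX[OF base_quadric_immersion, of y] by (simp add: inj_eq)
  with v show "w = w'" by simp
qed

end

lemma cimg_point:
  assumes "c \<in> LH3_atlas" "x \<in> cimg c"
  obtains e y where "direction e" "y \<in> direction.in_chart e c" "x = direction.base_trans e c y"
proof -
  from assms(2) obtain \<gamma> where "\<gamma> \<in> cdom c" "x = cmap c \<gamma>" by auto
  with assms(1) show ?thesis by (metis chart_point that)
qed

text \<open>The conditions are local, and near each geodesic the chart is a smooth reparametrisation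
  of one of the two maps \<open>base_X e\<close>. This gives every chart access to the results of
  the locale.\<close>

lemma chart_quadric_immersion:
  assumes c: "c \<in> LH3_atlas" shows "quadric_immersion (cimg c) (chart_X c)"
proof
  have nb: "\<exists>T. open T \<and> x \<in> T \<and> T \<subseteq> cimg c \<and> smooth_on T (chart_X c)" if x: "x \<in> cimg c" for x
  proof -
    obtain e y where e: "direction e" and y: "y \<in> direction.in_chart e c" "x = direction.base_trans e c y"
      using cimg_point[OF c x] .
    interpret direction e by (rule e)
    show ?thesis
      using chart_X_smooth[OF c] y in_chartD[of _ c] by blast
  qed
  show o: "open (cimg c)" using nb by (subst open_subopen) blast
  show "smooth_on (cimg c) (chart_X c)" using nb by (intro smooth_on_local o) blast
  fix x assume x: "x \<in> cimg c"
  obtain e y where e: "direction e" and y: "y \<in> direction.in_chart e c" "x = direction.base_trans e c y"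
    using cimg_point[OF c x] .
  interpret direction e by (rule e)
  show "qform (chart_X c x) (chart_X c x) = 1"
    using quadric_immersion.unit[OF base_quadric_immersion] y by (simp add: chart_X_base_trans[OF c])
  show "inj (ddir (chart_X c) x)" using inj_ddir_chart_X[OF c] y by simp
qed

text \<open>Near a common geodesic both charts are smooth in the same base coordinates, so the
  transition is \<open>base_trans c'\<close> after the inverse of
  \<open>base_trans c\<close>.\<close>

lemma overlap_point:
  assumes c: "c \<in> LH3_atlas" and c': "c' \<in> LH3_atlas" and x: "x \<in> cmap c ` (cdom c \<inter> cdom c')"
  shows "\<exists>T. open T \<and> x \<in> T \<and> T \<subseteq> cmap c ` (cdom c \<inter> cdom c') \<and> smooth_on T (transition c c')"
proof -
  from x obtain \<gamma> where \<gamma>: "\<gamma> \<in> cdom c" "\<gamma> \<in> cdom c'" "x = cmap c \<gamma>" by auto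
  obtain e y where e: "direction e" and y: "y \<in> direction.in_chart e c" "\<gamma> = base_geod e y"
    "cmap c \<gamma> = direction.base_trans e c y"
    using chart_point[OF c \<gamma>(1)] .
  interpret direction e by (rule e)
  note T = chart_base_trans[OF c] and T' = chart_base_trans[OF c']
  note inv = smooth_inverse_function[OF T]
  define O' where "O' = in_chart c \<inter> in_chart c'"
  have O: "open O'" using T(1) T'(1) by (auto simp: O'_def)
  have injO: "inj_on (base_trans c) O'" using T(3) by (rule inj_on_subset) (auto simp: O'_def)
  have o: "open (base_trans c ` O')"
    by (rule smooth_inverse_function(1)[OF O smooth_on_subset[OF T(2)] injO]) (auto simp: O'_def T(4))
  have img: "inv_into (in_chart c) (base_trans c) ` base_trans c ` O' \<subseteq> in_chart c'"
    using T(3) by (auto simp: O'_def)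
  have A: "smooth_on (base_trans c ` O') (\<lambda>x. base_trans c' (inv_into (in_chart c) (base_trans c) x))"
    by (rule smooth_on_compose[OF o T'(1) img smooth_on_subset[OF inv(2)] T'(2)]) (auto simp: O'_def)
  have "smooth_on (base_trans c ` O') (transition c c')"
  proof (rule smooth_on_transform[OF A o])
    fix x assume "x \<in> base_trans c ` O'"
    then obtain y where y: "y \<in> in_chart c" "x = base_trans c y" by (auto simp: O'_def)
    then have "inv_into (in_chart c) (base_trans c) x = y" by (simp add: inv_into_f_f[OF T(3)])
    moreover have "inv_into (cdom c) (cmap c) x = base_geod e y"
      using y by (simp add: base_trans_def in_chart_def chart_inj[OF c])
    ultimately show "base_trans c' (inv_into (in_chart c) (base_trans c) x) = transition c c' x"
      by (simp add: transition_def base_trans_def)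
  qed
  moreover have "x \<in> base_trans c ` O'" using y \<gamma> by (auto simp: O'_def in_chart_def)
  moreover have "base_trans c ` O' \<subseteq> cmap c ` (cdom c \<inter> cdom c')"
    by (auto simp: O'_def base_trans_def in_chart_def)
  ultimately show ?thesis using o by blast
qed

lemma overlap_smooth:
  assumes c: "c \<in> LH3_atlas" and c': "c' \<in> LH3_atlas"
  shows "open (cmap c ` (cdom c \<inter> cdom c'))" "smooth_on (cmap c ` (cdom c \<inter> cdom c')) (transition c c')"
proof -
  show o: "open (cmap c ` (cdom c \<inter> cdom c'))"
    using overlap_point[OF assms] by (subst open_subopen) blast
  show "smooth_on (cmap c ` (cdom c \<inter> cdom c')) (transition c c')"
    using overlap_point[OF assms] by (intro smooth_on_local[OF o]) blast
qed

lemma smooth_atlas_LH3: "smooth_atlas LH3 LH3_atlas"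
proof -
  have "\<exists>c\<in>LH3_atlas. \<gamma> \<in> cdom c" if \<gamma>: "\<gamma> \<in> LH3" for \<gamma>
  proof -
    obtain e y where e: "direction e" and y: "\<gamma> = base_geod e y" using base_geod_cover[OF \<gamma>] .
    interpret direction e by (rule e)
    have "(range (base_geod e), inv (base_geod e)) \<in> LH3_atlas"
    proof (rule chart_in_atlas[where g = "\<lambda>y. y" and O' = UNIV])
      show "surj (ddir (\<lambda>y :: complex \<times> complex. y) y)" for y by (simp add: frechet_derivative_ident)
    qed (auto intro: smooth_on_ident simp: inj_base_geod)
    then show ?thesis using y by force
  qed
  then have "LH3 = (\<Union>c\<in>LH3_atlas. cdom c)" using chart_LH3 by blast
  then show ?thesis
    unfolding smooth_atlas_def
    by (intro conjI ballI chart_inj overlap_smooth quadric_immersion.open_S[OF chart_quadric_immersion])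
qed

text \<open>Chain rule for \<open>chart_X c'\<close> after the transition, which is
  \<open>chart_X c\<close>. Being induced by \<open>chart_X\<close>, the three fields inherit their
  transformation laws from it.\<close>

lemma ddir_transition:
  assumes c: "c \<in> LH3_atlas" and c': "c' \<in> LH3_atlas" and p: "p \<in> cdom c \<inter> cdom c'"
  shows "ddir (chart_X c') (cmap c' p) (ddir (transition c c') (cmap c p) v) = ddir (chart_X c) (cmap c p) v"
proof -
  let ?S = "cmap c ` (cdom c \<inter> cdom c')"
  note o = overlap_smooth[OF c c']
  have x: "cmap c p \<in> ?S" using p by auto
  have tr: "transition c c' (cmap c p) = cmap c' p" if "p \<in> cdom c" for p
    using chart_inj[OF c] that by (simp add: transition_def)
  interpret X': quadric_immersion "cimg c'" "chart_X c'" by (rule chart_quadric_immersion[OF c'])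
  have "((\<lambda>x. chart_X c' (transition c c' x)) has_derivative
     (\<lambda>v. ddir (chart_X c') (cmap c' p) (ddir (transition c c') (cmap c p) v))) (at (cmap c p))"
  proof (rule has_derivative_compose[OF smooth_on_has_derivative[OF o x]])
    show "(chart_X c' has_derivative ddir (chart_X c') (cmap c' p)) (at (transition c c' (cmap c p)))"
      using X'.DX[of "cmap c' p"] p by (simp add: tr)
  qed
  then have "(chart_X c has_derivative
     (\<lambda>v. ddir (chart_X c') (cmap c' p) (ddir (transition c c') (cmap c p) v))) (at (cmap c p))"
    by (rule has_derivative_transform_within_open[OF _ o(1) x])
       (use chart_X_cmap[OF c] chart_X_cmap[OF c'] tr in auto)
  from frechet_derivative_at[OF this, symmetric] show ?thesis by simp
qed

section \<open>The global tensor fields and their pointwise properties\<close>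

definition J_field :: "(ogeod, complex \<times> complex) endo_field" where
  "J_field c = induced_J (chart_X c)"
definition Om_field :: "(ogeod, complex \<times> complex) form_field" where
  "Om_field c = induced_form (chart_X c)"
definition G_field :: "(ogeod, complex \<times> complex) form_field" where
  "G_field c = induced_metric (chart_X c)"

lemma endo_tensor_J: "endo_tensor LH3_atlas J_field"
  unfolding endo_tensor_def J_field_def
proof (intro conjI ballI allI)
  fix c assume c: "c \<in> LH3_atlas"
  interpret quadric_immersion "cimg c" "chart_X c" by (rule chart_quadric_immersion[OF c])
  show "linear (induced_J (chart_X c) x)" if "x \<in> cimg c" for x by (rule linear_J[OF that])
  show "smooth_on (cimg c) (\<lambda>x. induced_J (chart_X c) x v)" for v by (rule smooth_J)
  fix c' p v assume c': "c' \<in> LH3_atlas" and p: "p \<in> cdom c \<inter> cdom c'"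
  interpret X': quadric_immersion "cimg c'" "chart_X c'" by (rule chart_quadric_immersion[OF c'])
  have x': "cmap c' p \<in> cimg c'" and x: "cmap c p \<in> cimg c" using p by auto
  have X: "chart_X c' (cmap c' p) = chart_X c (cmap c p)" using p by (simp add: chart_X_cmap c c')
  show "induced_J (chart_X c') (cmap c' p) (ddir (transition c c') (cmap c p) v) =
      ddir (transition c c') (cmap c p) (induced_J (chart_X c) (cmap c p) v)"
    unfolding X'.DX_eq_iff[OF x', symmetric] ddir_transition[OF c c' p] X'.DX_J[OF x'] DX_J[OF x] X ..
qed

lemma form_tensor_Om: "form_tensor LH3_atlas Om_field"
  unfolding form_tensor_def Om_field_def
proof (intro conjI ballI allI)
  fix c assume c: "c \<in> LH3_atlas"
  interpret quadric_immersion "cimg c" "chart_X c" by (rule chart_quadric_immersion[OF c])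
  show "bilinear (induced_form (chart_X c) x)" if "x \<in> cimg c" for x by (rule form_bilinear[OF that])
  show "smooth_on (cimg c) (\<lambda>x. induced_form (chart_X c) x v w)" for v w by (rule smooth_form)
  fix c' p v w assume c': "c' \<in> LH3_atlas" and p: "p \<in> cdom c \<inter> cdom c'"
  have X: "chart_X c' (cmap c' p) = chart_X c (cmap c p)" using p by (simp add: chart_X_cmap c c')
  show "induced_form (chart_X c') (cmap c' p) (ddir (transition c c') (cmap c p) v) (ddir (transition c c') (cmap c p) w) =
      induced_form (chart_X c) (cmap c p) v w"
    unfolding induced_form_def ddir_transition[OF c c' p] X ..
qed

lemma form_tensor_G: "form_tensor LH3_atlas G_field"
  unfolding form_tensor_def G_field_def
proof (intro conjI ballI allI)
  fix c assume c: "c \<in> LH3_atlas"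
  interpret quadric_immersion "cimg c" "chart_X c" by (rule chart_quadric_immersion[OF c])
  show "bilinear (induced_metric (chart_X c) x)" if "x \<in> cimg c" for x by (rule metric_bilinear[OF that])
  show "smooth_on (cimg c) (\<lambda>x. induced_metric (chart_X c) x v w)" for v w by (rule smooth_metric)
  fix c' p v w assume c': "c' \<in> LH3_atlas" and p: "p \<in> cdom c \<inter> cdom c'"
  show "induced_metric (chart_X c') (cmap c' p) (ddir (transition c c') (cmap c p) v) (ddir (transition c c') (cmap c p) w) =
      induced_metric (chart_X c) (cmap c p) v w"
    unfolding induced_metric_def ddir_transition[OF c c' p] ..
qed

lemma symplectic_Om: "symplectic_form LH3_atlas Om_field"
  unfolding symplectic_form_def
proof (intro conjI ballI form_tensor_Om)
  fix c x assume c: "c \<in> LH3_atlas" and x: "x \<in> cimg c"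
  interpret quadric_immersion "cimg c" "chart_X c" by (rule chart_quadric_immersion[OF c])
  show "\<forall>v w. Om_field c x v w = - Om_field c x w v" "nondegenerate (Om_field c x)"
    "\<forall>u v w. ddir (\<lambda>y. Om_field c y v w) x u + ddir (\<lambda>y. Om_field c y w u) x v + ddir (\<lambda>y. Om_field c y u v) x w = 0"
    unfolding Om_field_def using form_antisym form_nondegenerate[OF x] form_closed[OF x] by blast+
qed

lemma pseudo_metric_G: "pseudo_metric LH3_atlas G_field"
  unfolding pseudo_metric_def
proof (intro conjI ballI form_tensor_G)
  fix c x assume c: "c \<in> LH3_atlas" and x: "x \<in> cimg c"
  interpret quadric_immersion "cimg c" "chart_X c" by (rule chart_quadric_immersion[OF c])
  show "\<forall>v w. G_field c x v w = G_field c x w v" "nondegenerate (G_field c x)"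
    unfolding G_field_def using metric_sym metric_nondegenerate[OF x] by blast+
qed

lemma compatible_structures:
  assumes c: "c \<in> LH3_atlas" and x: "x \<in> cimg c"
  shows "Om_field c x (J_field c x v) (J_field c x w) = Om_field c x v w"
    "G_field c x v w = Om_field c x (J_field c x v) w"
proof -
  interpret quadric_immersion "cimg c" "chart_X c" by (rule chart_quadric_immersion[OF c])
  show "Om_field c x (J_field c x v) (J_field c x w) = Om_field c x v w"
    "G_field c x v w = Om_field c x (J_field c x v) w"
    unfolding Om_field_def J_field_def G_field_def by (rule form_J_J[OF x] metric_eq[OF x])+
qed

lemma neutral_G: "neutral_metric LH3_atlas G_field"
  unfolding neutral_metric_def G_field_def
  by (intro ballI quadric_immersion.metric_signature[OF chart_quadric_immersion])

lemma scalar_flat_G: "scalar_flat LH3_atlas G_field"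
  unfolding scalar_flat_def G_field_def
  by (intro ballI quadric_immersion.scalar_curvature_0[OF chart_quadric_immersion])

section \<open>Holomorphic and conformally flat coordinates\<close>

context direction
begin

text \<open>With p = q + 1/m the second end point, the structure multiplies dq by
  \<open>e * \<i>\<close> and dp = dq - dm/m^2 by \<open>- e * \<i>\<close>. Solving for dm gives
  this formula, which makes sense at m = 0 too.\<close>

definition base_J :: "complex \<times> complex \<Rightarrow> complex \<times> complex \<Rightarrow> complex \<times> complex" where
  "base_J y v = e *\<^sub>R (2 * \<i> * (fst y)\<^sup>2 * snd v - \<i> * fst v, \<i> * snd v)"

lemma ddir_base_X_base_J:
  "ddir (base_X e) y (base_J y v) = cscale \<i> (ccross (base_X e y) (ddir (base_X e) y v))"
proof -
  let ?Y = "((2 * (fst y * snd v + snd y * fst v),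
      2 * snd v + 4 * fst y * snd y * snd v + 2 * (snd y)\<^sup>2 * fst v), 2 * fst v)"
  let ?X = "((1 + 2 * fst y * snd y, 2 * snd y + 2 * fst y * (snd y)\<^sup>2), 2 * fst y)"
  have "ddir (base_X e) y (base_J y v) = (e * e) *\<^sub>R cscale \<i> (ccross ?X ?Y)"
    unfolding ddir_base_X base_J_def
    by (simp add: cscale_def ccross_def scaleR_conv_of_real algebra_simps power2_eq_square)
  also have "\<dots> = cscale \<i> (ccross (base_X e y) (ddir (base_X e) y v))"
    unfolding ddir_base_X unfolding base_X_def split_beta
    by (simp only: ccross.scaleR_left ccross.scaleR_right cscale.scaleR_right scaleR_scaleR)
  finally show ?thesis .
qed

text \<open>In terms of the end points q and p = q + 1/m, the quadratic form on the right is the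
  imaginary part of 4 dp dq / (p - q)^2.\<close>

lemma base_metric:
  "induced_metric (base_X e) y v w =
     Im (4 * (fst y)\<^sup>2 * snd v * snd w - 2 * (fst v * snd w + fst w * snd v))"
proof -
  have "qform (ddir (base_X e) y v) (ddir (base_X e) y w) =
      of_real (e * e) * (4 * (fst y)\<^sup>2 * snd v * snd w - 2 * (fst v * snd w + fst w * snd v))"
    unfolding ddir_base_X
    by (simp add: qform_def scaleR_conv_of_real field_simps power2_eq_square)
  then show ?thesis by (simp add: induced_metric_def ee)
qed

lemma J_field_base_trans:
  assumes c: "c \<in> LH3_atlas" and y: "y \<in> in_chart c"
  shows "J_field c (base_trans c y) (ddir (base_trans c) y v) = ddir (base_trans c) y (base_J y v)"
proof -
  interpret X: quadric_immersion "cimg c" "chart_X c" by (rule chart_quadric_immersion[OF c])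
  note x = in_chartD[OF y]
  show ?thesis
    unfolding X.DX_eq_iff[OF x, symmetric] J_field_def X.DX_J[OF x] ddir_chart_X[OF c y]
      chart_X_base_trans[OF c y] ddir_base_X_base_J ..
qed

lemma G_field_base_trans:
  assumes c: "c \<in> LH3_atlas" and y: "y \<in> in_chart c"
  shows "G_field c (base_trans c y) (ddir (base_trans c) y v) (ddir (base_trans c) y w) =
     induced_metric (base_X e) y v w"
  unfolding G_field_def induced_metric_def ddir_chart_X[OF c y] ..

definition "coord_chart O' g = (base_geod e ` O', \<lambda>\<gamma>. g (inv (base_geod e) \<gamma>))"

lemma in_chart_coord_chart: "in_chart (coord_chart O' g) = O'"
  using inj_base_geod by (auto simp: in_chart_def coord_chart_def inj_image_mem_iff)

lemma base_trans_coord_chart: "base_trans (coord_chart O' g) = g"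
  using inj_base_geod by (simp add: base_trans_def coord_chart_def fun_eq_iff inv_f_f)

lemma cimg_coord_chart: "cimg (coord_chart O' g) = g ` O'"
  using inj_base_geod by (simp add: coord_chart_def image_image inv_f_f)

lemma coord_chart_in_atlas:
  assumes "open O'" "smooth_on O' g" "inj_on g O'" "\<And>y. y \<in> O' \<Longrightarrow> surj (ddir g y)"
  shows "coord_chart O' g \<in> LH3_atlas"
  unfolding coord_chart_def
  by (rule chart_in_atlas[OF assms]) (simp_all add: inv_f_f inj_base_geod)

subsection \<open>Holomorphic coordinates\<close>

text \<open>
  The end points of a geodesic are \<open>q\<close> and \<open>q + 1 / m\<close>, and the rotation acts on their
  displacements as multiplication by conjugate imaginary units, so one end point has to be conjugated.
\<close>

definition cj :: "real \<Rightarrow> complex \<Rightarrow> complex" where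
  "cj s z = (if s = 1 then z else cnj z)"

lemma bounded_linear_cj: "bounded_linear (cj s)"
  unfolding cj_def[abs_def] by (cases "s = 1") (simp_all add: bounded_linear_ident bounded_linear_cnj)

lemma cj_cj [simp]: "cj s (cj s z) = z"
  by (simp add: cj_def)

definition hol_dom :: "complex \<Rightarrow> (complex \<times> complex) set" where
  "hol_dom q0 = {y. 1 + fst y * (snd y - q0) \<noteq> 0}"

text \<open>Up to conjugation the first entry is 1/(p - q0) with p = q + 1/m the second end point.
  So p may be infinity, only p = q0 is excluded, and exactly one of the two entries is
  conjugated.\<close>

definition hol_coord :: "complex \<Rightarrow> complex \<times> complex \<Rightarrow> complex \<times> complex" where
  "hol_coord q0 y = (cj (- e) (fst y / (1 + fst y * (snd y - q0))), cj e (snd y))"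

lemma open_hol_dom: "open (hol_dom q0)"
  unfolding hol_dom_def by (intro open_Collect_neq continuous_intros)

lemma smooth_hol_coord: "smooth_on (hol_dom q0) (hol_coord q0)"
  unfolding hol_coord_def[abs_def]
  by (intro bounded_linear.smooth_on[OF bounded_linear_cj] smooth_intros open_hol_dom) (auto simp: hol_dom_def)

lemma hol_coord_has_derivative:
  assumes "y \<in> hol_dom q0"
  shows "(hol_coord q0 has_derivative (\<lambda>v. (cj (- e) ((fst v - (fst y)\<^sup>2 * snd v) / (1 + fst y * (snd y - q0))\<^sup>2),
     cj e (snd v)))) (at y)"
proof -
  have n: "1 + fst y * (snd y - q0) \<noteq> 0" using assms by (simp add: hol_dom_def)
  have "((\<lambda>y. fst y / (1 + fst y * (snd y - q0))) has_derivative
      (\<lambda>v. (fst v - (fst y)\<^sup>2 * snd v) / (1 + fst y * (snd y - q0))\<^sup>2)) (at y)"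
    using n by (auto intro!: derivative_eq_intros simp: fun_eq_iff divide_simps power2_eq_square)
       (simp_all add: algebra_simps)
  then show ?thesis unfolding hol_coord_def[abs_def]
    by (intro has_derivative_Pair bounded_linear.has_derivative[OF bounded_linear_cj] has_derivative_snd has_derivative_ident)
qed

lemma ddir_hol_coord:
  assumes "y \<in> hol_dom q0"
  shows "ddir (hol_coord q0) y v =
    (cj (- e) ((fst v - (fst y)\<^sup>2 * snd v) / (1 + fst y * (snd y - q0))\<^sup>2), cj e (snd v))"
  by (simp add: frechet_derivative_at[OF hol_coord_has_derivative[OF assms], symmetric])

lemma inj_hol_coord: "inj_on (hol_coord q0) (hol_dom q0)"
proof (rule inj_onI)
  fix y y' assume y: "y \<in> hol_dom q0" "y' \<in> hol_dom q0" and eq: "hol_coord q0 y = hol_coord q0 y'"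
  then have q: "snd y = snd y'" by (metis cj_cj hol_coord_def prod.inject)
  from eq have "fst y / (1 + fst y * (snd y - q0)) = fst y' / (1 + fst y' * (snd y' - q0))"
    by (metis cj_cj hol_coord_def prod.inject)
  then have "fst y * (1 + fst y' * (snd y' - q0)) = fst y' * (1 + fst y * (snd y - q0))"
    using y by (simp add: hol_dom_def frac_eq_eq)
  then have "fst y = fst y'" unfolding q by (simp add: algebra_simps)
  with q show "y = y'" by (simp add: prod_eq_iff)
qed

lemma surj_ddir_hol_coord: assumes "y \<in> hol_dom q0" shows "surj (ddir (hol_coord q0) y)"
proof (rule surjI)
  fix w
  have n: "1 + fst y * (snd y - q0) \<noteq> 0" using assms by (simp add: hol_dom_def)
  then show "ddir (hol_coord q0) y ((1 + fst y * (snd y - q0))\<^sup>2 * cj (- e) (fst w) + (fst y)\<^sup>2 * cj e (snd w), cj e (snd w)) = w"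
    unfolding ddir_hol_coord[OF assms] by simp
qed

lemma hol_chart: "coord_chart (hol_dom q0) (hol_coord q0) \<in> LH3_atlas"
  by (intro coord_chart_in_atlas open_hol_dom smooth_hol_coord inj_hol_coord surj_ddir_hol_coord)

lemma ddir_hol_coord_base_J:
  assumes "y \<in> hol_dom q0"
  shows "ddir (hol_coord q0) y (base_J y v) =
     (\<i> * fst (ddir (hol_coord q0) y v), \<i> * snd (ddir (hol_coord q0) y v))"
proof -
  have "fst (base_J y v) - (fst y)\<^sup>2 * snd (base_J y v) = - of_real e * (\<i> * (fst v - (fst y)\<^sup>2 * snd v))"
    by (simp add: base_J_def scaleR_conv_of_real algebra_simps)
  then show ?thesis using e
    unfolding ddir_hol_coord[OF assms] by (auto simp: base_J_def cj_def)
qed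

lemma J_field_hol_chart:
  assumes "x \<in> cimg (coord_chart (hol_dom q0) (hol_coord q0))"
  shows "J_field (coord_chart (hol_dom q0) (hol_coord q0)) x w = (\<i> * fst w, \<i> * snd w)"
proof -
  obtain y where y: "y \<in> hol_dom q0" "x = hol_coord q0 y" using assms by (auto simp: cimg_coord_chart)
  obtain v where v: "w = ddir (hol_coord q0) y v" using surj_ddir_hol_coord[OF y(1)] by (rule surjE)
  have "y \<in> in_chart (coord_chart (hol_dom q0) (hol_coord q0))" by (simp add: in_chart_coord_chart y)
  from J_field_base_trans[OF hol_chart this, of v] show ?thesis
    by (simp add: base_trans_coord_chart y v ddir_hol_coord_base_J)
qed

end

lemma complex_structure_J: "complex_structure LH3_atlas J_field"
  unfolding complex_structure_def
proof (intro conjI ballI endo_tensor_J)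
  fix c p assume c: "c \<in> LH3_atlas" and p: "p \<in> cdom c"
  obtain e y where de: "direction e" and y: "p = base_geod e y"
    using chart_point[OF c p] by metis
  interpret direction e by (rule de)
  \<comment> \<open>Taking the end point \<open>snd y\<close> of the given geodesic for
    \<open>q0\<close> puts it into the domain, as its other end point is different.\<close>
  let ?d = "coord_chart (hol_dom (snd y)) (hol_coord (snd y))"
  have "p \<in> cdom ?d" by (simp add: coord_chart_def y hol_dom_def)
  then show "\<exists>d\<in>LH3_atlas. p \<in> cdom d \<and> (\<forall>x\<in>cimg d. \<forall>v. J_field d x v = (\<i> * fst v, \<i> * snd v))"
    using hol_chart J_field_hol_chart by blast
qed

subsection \<open>Conformally flat coordinates\<close>

text \<open>
  The quadric lies in the null cone of the imaginary part of the quadratic form, so its metric is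
  conformal to that of any other section of the cone; here the section where the real part of the
  first coordinate is 1 is used.
\<close>

definition flat_form :: "complex \<times> complex \<Rightarrow> complex \<times> complex \<Rightarrow> real" where
  "flat_form v w = - Im (fst v * snd w + fst w * snd v) / 2"

lemma flat_form_properties:
  "bilinear flat_form" "flat_form v w = flat_form w v" "nondegenerate flat_form"
proof -
  have "linear (\<lambda>v. flat_form v w)" for w
    by (rule linearI) (simp_all add: flat_form_def algebra_simps diff_divide_distrib add_divide_distrib)
  moreover have "linear (flat_form v)" for v
    by (rule linearI) (simp_all add: flat_form_def algebra_simps diff_divide_distrib add_divide_distrib)
  ultimately show "bilinear flat_form" by (simp add: bilinear_def)
  show "flat_form v w = flat_form w v" by (simp add: flat_form_def)
  show "nondegenerate flat_form"
    unfolding nondegenerate_def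
  proof (intro allI impI)
    fix v assume v: "\<forall>w. flat_form v w = 0"
    from v[rule_format, of "(1, 0)"] v[rule_format, of "(\<i>, 0)"] v[rule_format, of "(0, 1)"] v[rule_format, of "(0, \<i>)"]
    show "v = 0" by (simp add: flat_form_def prod_eq_iff complex_eq_iff)
  qed
qed

text \<open>Subtracting \<open>s\<close> and \<open>t\<close> times the radial vector makes the two
  vectors tangent to the section. In the imaginary part of the form the radial vector is orthogonal
  to the cone, so nothing else changes; the new first entries are purely imaginary, their product is
  real, and only the other two entries are seen.\<close>

lemma conformal_section_identity:
  fixes a b c a1 b1 c1 a2 b2 c2 :: complex and r :: real
  assumes r: "r = Re a" "r \<noteq> 0" and bc: "b * c = a\<^sup>2 - 1"
    and d1: "b * c1 + c * b1 = 2 * a * a1" and d2: "b * c2 + c * b2 = 2 * a * a2"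
  shows "r\<^sup>2 * Im ((b1 - of_real (Re a1 / r) * b) / r * ((c2 - of_real (Re a2 / r) * c) / r)
     + (b2 - of_real (Re a2 / r) * b) / r * ((c1 - of_real (Re a1 / r) * c) / r))
     = Im (b1 * c2 + b2 * c1 - 2 * a1 * a2)"
proof -
  define s t where "s = Re a1 / r" and "t = Re a2 / r"
  have s: "Re a1 = s * r" and t: "Re a2 = t * r" using r by (simp_all add: s_def t_def)
  have "(b1 - of_real s * b) / r * ((c2 - of_real t * c) / r) + (b2 - of_real t * b) / r * ((c1 - of_real s * c) / r)
      = (b1 * c2 + b2 * c1 - of_real t * (b * c1 + c * b1) - of_real s * (b * c2 + c * b2) + 2 * of_real (s * t) * (b * c))
        / of_real (r\<^sup>2)"
    using r(2) by (simp add: field_simps power2_eq_square)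
  also have "\<dots> = (b1 * c2 + b2 * c1 - of_real t * (2 * a * a1) - of_real s * (2 * a * a2) + 2 * of_real (s * t) * (a\<^sup>2 - 1))
        / of_real (r\<^sup>2)"
    unfolding bc d1 d2 ..
  finally have "r\<^sup>2 * Im ((b1 - of_real s * b) / r * ((c2 - of_real t * c) / r) + (b2 - of_real t * b) / r * ((c1 - of_real s * c) / r))
     = Im (b1 * c2 + b2 * c1 - of_real t * (2 * a * a1) - of_real s * (2 * a * a2) + 2 * of_real (s * t) * (a\<^sup>2 - 1))"
    using r(2) by (simp only: Im_divide_of_real) simp
  also have "\<dots> = Im (b1 * c2 + b2 * c1 - 2 * a1 * a2)"
    using s t r(1) by (simp add: power2_eq_square algebra_simps)
  finally show ?thesis unfolding s_def t_def .
qed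

context direction
begin

text \<open>With \<open>conf_b\<close> and \<open>2 * fst y\<close>, the entries of
  \<open>base_X\<close> for \<open>e = 1\<close> after translating \<open>q0\<close> to the origin.
  At \<open>snd y = q0\<close> the value is 1, so every base point lies in \<open>conf_dom\<close>
  for a suitable \<open>q0\<close>.\<close>

definition conf_a :: "complex \<Rightarrow> complex \<times> complex \<Rightarrow> complex" where
  "conf_a q0 y = 1 + 2 * fst y * (snd y - q0)"

definition conf_b :: "complex \<Rightarrow> complex \<times> complex \<Rightarrow> complex" where
  "conf_b q0 y = 2 * (snd y - q0) + 2 * fst y * (snd y - q0)\<^sup>2"

definition conf_dom :: "complex \<Rightarrow> (complex \<times> complex) set" where
  "conf_dom q0 = {y. Re (conf_a q0 y) > 0}"

text \<open>After division by Re a the first entry is 1 + i s, and the quadric equation fixes s as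
  half the imaginary part of the product of the two coordinates. Its differential i ds has real
  square, so the metric of the section is minus the imaginary part of the product of the coordinate
  differentials, that is \<open>flat_form\<close>.\<close>

definition conf_coord :: "complex \<Rightarrow> complex \<times> complex \<Rightarrow> complex \<times> complex" where
  "conf_coord q0 y = (conf_b q0 y / of_real (Re (conf_a q0 y)), 2 * fst y / of_real (Re (conf_a q0 y)))"

text \<open>(Re a)^2 in terms of the coordinates, from the real part of b c = a^2 - 1 divided by (Re
  a)^2.\<close>

definition conf_factor :: "complex \<times> complex \<Rightarrow> real" where
  "conf_factor x = 1 / (1 - (Im (fst x * snd x) / 2)\<^sup>2 - Re (fst x * snd x))"

lemma conf_quadric: "conf_b q0 y * (2 * fst y) = (conf_a q0 y)\<^sup>2 - 1"
  by (simp add: conf_a_def conf_b_def power2_eq_square algebra_simps)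

lemma conf_factor_denominator:
  assumes "y \<in> conf_dom q0"
  shows "1 - (Im (fst (conf_coord q0 y) * snd (conf_coord q0 y)) / 2)\<^sup>2 - Re (fst (conf_coord q0 y) * snd (conf_coord q0 y))
     = 1 / (Re (conf_a q0 y))\<^sup>2"
    and "Im (fst (conf_coord q0 y) * snd (conf_coord q0 y)) / 2 = Im (conf_a q0 y) / Re (conf_a q0 y)"
proof -
  define a where "a = conf_a q0 y"
  have r: "Re a > 0" using assms by (simp add: conf_dom_def a_def)
  have p: "fst (conf_coord q0 y) * snd (conf_coord q0 y) = (a\<^sup>2 - 1) / of_real ((Re a)\<^sup>2)"
    using conf_quadric[of q0 y] by (simp add: conf_coord_def a_def power2_eq_square)
  show 1: "Im (fst (conf_coord q0 y) * snd (conf_coord q0 y)) / 2 = Im (conf_a q0 y) / Re (conf_a q0 y)"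
    unfolding p Im_divide_of_real a_def[symmetric] using r by (simp add: power2_eq_square)
  show "1 - (Im (fst (conf_coord q0 y) * snd (conf_coord q0 y)) / 2)\<^sup>2 - Re (fst (conf_coord q0 y) * snd (conf_coord q0 y))
     = 1 / (Re (conf_a q0 y))\<^sup>2"
    unfolding 1 unfolding p Re_divide_of_real a_def[symmetric] using r by (simp add: power2_eq_square field_simps)
qed

lemma conf_factor_eq:
  assumes "y \<in> conf_dom q0" shows "conf_factor (conf_coord q0 y) = (Re (conf_a q0 y))\<^sup>2"
  unfolding conf_factor_def conf_factor_denominator(1)[OF assms] by simp

lemma open_conf_dom: "open (conf_dom q0)"
  unfolding conf_dom_def conf_a_def by (intro open_Collect_less continuous_intros)

lemma smooth_conf_coord: "smooth_on (conf_dom q0) (conf_coord q0)"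
proof -
  have nz: "complex_of_real (Re (1 + 2 * fst y * (snd y - q0))) \<noteq> 0" if "y \<in> conf_dom q0" for y
    using that unfolding of_real_eq_0_iff conf_dom_def conf_a_def mem_Collect_eq by linarith
  have "smooth_on (conf_dom q0) (\<lambda>y. ((2 * (snd y - q0) + 2 * fst y * (snd y - q0)\<^sup>2)
        / of_real (Re (1 + 2 * fst y * (snd y - q0))),
      2 * fst y / of_real (Re (1 + 2 * fst y * (snd y - q0)))))"
    by (intro smooth_intros open_conf_dom nz)
  then show ?thesis unfolding conf_coord_def[abs_def] conf_a_def conf_b_def .
qed

lemma conf_coord_has_derivative:
  assumes "y \<in> conf_dom q0"
  defines "r \<equiv> Re (conf_a q0 y)"
  defines "da \<equiv> \<lambda>v. 2 * (fst y * snd v + (snd y - q0) * fst v)"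
    and "db \<equiv> \<lambda>v. 2 * snd v + 4 * fst y * (snd y - q0) * snd v + 2 * (snd y - q0)\<^sup>2 * fst v"
  shows "(conf_coord q0 has_derivative (\<lambda>v. ((db v - of_real (Re (da v) / r) * conf_b q0 y) / of_real r,
     (2 * fst v - of_real (Re (da v) / r) * (2 * fst y)) / of_real r))) (at y)"
proof -
  have r: "r \<noteq> 0" "complex_of_real r \<noteq> 0" using assms(1) by (auto simp: r_def conf_dom_def)
  have db: "(conf_b q0 has_derivative db) (at y)"
    unfolding conf_b_def[abs_def] db_def
    by (auto intro!: derivative_eq_intros simp: fun_eq_iff algebra_simps)
  have "(conf_a q0 has_derivative da) (at y)"
    unfolding conf_a_def[abs_def] da_def
    by (auto intro!: derivative_eq_intros simp: fun_eq_iff algebra_simps)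
  then have "((\<lambda>y. complex_of_real (Re (conf_a q0 y))) has_derivative (\<lambda>v. of_real (Re (da v)))) (at y)"
    by (intro bounded_linear.has_derivative[OF bounded_linear_of_real] bounded_linear.has_derivative[OF bounded_linear_Re])
  note dr = this
  have quot: "((\<lambda>y. f y / complex_of_real (Re (conf_a q0 y))) has_derivative
      (\<lambda>v. (f' v - of_real (Re (da v) / r) * f y) / of_real r)) (at y)" if "(f has_derivative f') (at y)" for f f'
  proof -
    have "((\<lambda>y. f y / complex_of_real (Re (conf_a q0 y))) has_derivative
      (\<lambda>v. - f y * (inverse (of_real r) * of_real (Re (da v)) * inverse (of_real r)) + f' v / of_real r)) (at y)"
      unfolding r_def by (rule has_derivative_divide[OF that dr]) (use r in \<open>simp add: r_def\<close>)
    moreover have "(\<lambda>v. - f y * (inverse (of_real r) * of_real (Re (da v)) * inverse (of_real r)) + f' v / of_real r)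
      = (\<lambda>v. (f' v - of_real (Re (da v) / r) * f y) / of_real r)"
      using r by (simp add: fun_eq_iff field_simps)
    ultimately show ?thesis by simp
  qed
  have "((\<lambda>y :: complex \<times> complex. 2 * fst y) has_derivative (\<lambda>v. 2 * fst v)) (at y)"
    by (auto intro!: derivative_eq_intros)
  from has_derivative_Pair[OF quot[OF db] quot[OF this]] show ?thesis
    unfolding conf_coord_def[abs_def] .
qed

lemma conf_metric:
  assumes y: "y \<in> conf_dom q0"
  shows "induced_metric (base_X e) y v w =
     conf_factor (conf_coord q0 y) * flat_form (ddir (conf_coord q0) y v) (ddir (conf_coord q0) y w)"
proof -
  define r where "r = Re (conf_a q0 y)"
  define Q where "Q = snd y - q0"
  define m where "m = fst y"
  define a where "a = 1 + 2 * m * Q"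
  define b where "b = 2 * Q + 2 * m * Q\<^sup>2"
  define da where "da v = 2 * (m * snd v + Q * fst v)" for v
  define db where "db v = 2 * snd v + 4 * m * Q * snd v + 2 * Q\<^sup>2 * fst v" for v
  have r: "r = Re a" "r \<noteq> 0" using y by (auto simp: r_def conf_dom_def a_def conf_a_def Q_def m_def)
  have D: "ddir (conf_coord q0) y v = ((db v - of_real (Re (da v) / r) * b) / of_real r,
     (2 * fst v - of_real (Re (da v) / r) * (2 * m)) / of_real r)" for v
    using frechet_derivative_at[OF conf_coord_has_derivative[OF y], symmetric]
    by (simp add: r_def da_def db_def b_def conf_b_def Q_def m_def)
  have bc: "b * (2 * m) = a\<^sup>2 - 1" by (simp add: a_def b_def power2_eq_square algebra_simps)
  have d: "b * (2 * fst v) + (2 * m) * db v = 2 * a * da v" for v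
    by (simp add: a_def b_def da_def db_def power2_eq_square algebra_simps)
  have "conf_factor (conf_coord q0 y) * flat_form (ddir (conf_coord q0) y v) (ddir (conf_coord q0) y w)
     = - (r\<^sup>2 * Im ((db v - of_real (Re (da v) / r) * b) / r * ((2 * fst w - of_real (Re (da w) / r) * (2 * m)) / r)
     + (db w - of_real (Re (da w) / r) * b) / r * ((2 * fst v - of_real (Re (da v) / r) * (2 * m)) / r))) / 2"
    unfolding conf_factor_eq[OF y] flat_form_def D fst_conv snd_conv r_def[symmetric]
    by (simp only: times_divide_eq_right mult_minus_right)
  also have "\<dots> = - Im (db v * (2 * fst w) + db w * (2 * fst v) - 2 * da v * da w) / 2"
    unfolding conformal_section_identity[OF r bc d d] ..
  also have "db v * (2 * fst w) + db w * (2 * fst v) - 2 * da v * da w =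
      - 2 * (4 * (fst y)\<^sup>2 * snd v * snd w - 2 * (fst v * snd w + fst w * snd v))"
    by (simp add: da_def db_def m_def power2_eq_square algebra_simps)
  also have "- Im (- 2 * z) / 2 = Im z" for z by simp
  finally show ?thesis unfolding base_metric ..
qed

text \<open>\<open>conf_factor\<close> returns Re a, and then Im a, b and m follow. Finally b = (q -
  q0) (a + 1) determines q, because Re a > 0 keeps a away from -1.\<close>

lemma inj_conf_coord: "inj_on (conf_coord q0) (conf_dom q0)"
proof (rule inj_onI)
  fix y y' assume y: "y \<in> conf_dom q0" and y': "y' \<in> conf_dom q0" and eq: "conf_coord q0 y = conf_coord q0 y'"
  have pos: "Re (conf_a q0 y) > 0" "Re (conf_a q0 y') > 0" using y y' by (simp_all add: conf_dom_def)
  have "(Re (conf_a q0 y))\<^sup>2 = (Re (conf_a q0 y'))\<^sup>2"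
    using conf_factor_eq[OF y] conf_factor_eq[OF y'] eq by simp
  then have r: "Re (conf_a q0 y) = Re (conf_a q0 y')" using pos by simp
  have "Im (conf_a q0 y) / Re (conf_a q0 y) = Im (conf_a q0 y') / Re (conf_a q0 y')"
    using conf_factor_denominator(2)[OF y] conf_factor_denominator(2)[OF y'] eq by simp
  with r pos have a: "conf_a q0 y = conf_a q0 y'" by (simp add: complex_eq_iff)
  have b: "conf_b q0 y = conf_b q0 y'" and m: "fst y = fst y'"
    using eq r pos by (simp_all add: conf_coord_def)
  have bq: "conf_b q0 z = (snd z - q0) * (conf_a q0 z + 1)" for z
    by (simp add: conf_a_def conf_b_def power2_eq_square algebra_simps)
  have "conf_a q0 y + 1 \<noteq> 0" using pos(1) by (auto simp: complex_eq_iff)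
  then have "snd y = snd y'" using b unfolding bq a by simp
  with m show "y = y'" by (simp add: prod_eq_iff)
qed

text \<open>By \<open>conf_metric\<close> a vector killed by the derivative would be orthogonal to
  everything, against nondegeneracy; equal dimensions turn injectivity into surjectivity.\<close>

lemma surj_ddir_conf_coord: assumes y: "y \<in> conf_dom q0" shows "surj (ddir (conf_coord q0) y)"
proof -
  have l: "linear (ddir (conf_coord q0) y)"
    using smooth_on_has_derivative[OF open_conf_dom smooth_conf_coord y] by (rule has_derivative_linear)
  have "inj (ddir (conf_coord q0) y)"
    unfolding linear_injective_0[OF l]
  proof (intro allI impI)
    fix v assume "ddir (conf_coord q0) y v = 0"
    then have "induced_metric (base_X e) y v w = 0" for w
      by (simp add: conf_metric[OF y] flat_form_def)
    then show "v = 0"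
      using quadric_immersion.metric_nondegenerate[OF base_quadric_immersion UNIV_I[of y]]
      by (simp add: nondegenerate_def)
  qed
  then show ?thesis by (intro linear_injective_imp_surjective[OF l]) simp_all
qed

lemma conf_chart: "coord_chart (conf_dom q0) (conf_coord q0) \<in> LH3_atlas"
  by (intro coord_chart_in_atlas open_conf_dom smooth_conf_coord inj_conf_coord surj_ddir_conf_coord)

lemma conf_chart_properties:
  fixes q0 :: complex
  defines "d \<equiv> coord_chart (conf_dom q0) (conf_coord q0)"
  shows "smooth_on (cimg d) conf_factor" "x \<in> cimg d \<Longrightarrow> 0 < conf_factor x"
    "x \<in> cimg d \<Longrightarrow> G_field d x v w = conf_factor x * flat_form v w"
proof -
  have img: "cimg d = conf_coord q0 ` conf_dom q0" by (simp add: d_def cimg_coord_chart)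
  have o: "open (cimg d)"
    unfolding d_def by (rule quadric_immersion.open_S[OF chart_quadric_immersion[OF conf_chart]])
  have "1 - (Im (fst x * snd x) / 2)\<^sup>2 - Re (fst x * snd x) \<noteq> 0" if x: "x \<in> cimg d" for x
  proof -
    obtain y where y: "y \<in> conf_dom q0" "x = conf_coord q0 y" using x img by auto
    then show ?thesis using conf_factor_denominator(1)[OF y(1)] by (auto simp: conf_dom_def)
  qed
  then show "smooth_on (cimg d) conf_factor"
    unfolding conf_factor_def[abs_def] by (intro smooth_intros o; simp)
  assume x: "x \<in> cimg d"
  then obtain y where y: "y \<in> conf_dom q0" "x = conf_coord q0 y" using img by auto
  show "0 < conf_factor x" using y by (simp add: conf_factor_eq conf_dom_def)
  obtain v' w' where v: "v = ddir (conf_coord q0) y v'" "w = ddir (conf_coord q0) y w'"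
    using surj_ddir_conf_coord[OF y(1)] by (metis surjE)
  have "y \<in> in_chart (coord_chart (conf_dom q0) (conf_coord q0))" by (simp add: in_chart_coord_chart y)
  from G_field_base_trans[OF conf_chart this, of v' w'] show "G_field d x v w = conf_factor x * flat_form v w"
    by (simp add: base_trans_coord_chart y v conf_metric d_def)
qed

end

lemma conformally_flat_G: "conformally_flat LH3_atlas G_field"
  unfolding conformally_flat_def
proof (intro ballI)
  fix c p assume c: "c \<in> LH3_atlas" and p: "p \<in> cdom c"
  obtain e y where de: "direction e" and y: "p = base_geod e y"
    using chart_point[OF c p] by metis
  interpret direction e by (rule de)
  let ?d = "coord_chart (conf_dom (snd y)) (conf_coord (snd y))"
  have "p \<in> cdom ?d" by (simp add: coord_chart_def y conf_dom_def conf_a_def)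
  then show "\<exists>d\<in>LH3_atlas. p \<in> cdom d \<and> (\<exists>lam B. smooth_on (cimg d) lam \<and> (\<forall>x\<in>cimg d. 0 < lam x) \<and>
           bilinear B \<and> (\<forall>v w. B v w = B w v) \<and> nondegenerate B \<and>
           (\<forall>x\<in>cimg d. \<forall>v w. G_field d x v w = lam x * B v w))"
    using conf_chart flat_form_properties conf_chart_properties[where ?q0.0 = "snd y"]
    by (intro bexI[of _ ?d] conjI exI[of _ conf_factor] exI[of _ flat_form]) blast+
qed

lemma kaehler_LH3: "kaehler_structure LH3 LH3_atlas J_field Om_field G_field"
  unfolding kaehler_structure_def
  by (intro conjI ballI allI smooth_atlas_LH3 complex_structure_J symplectic_Om pseudo_metric_G compatible_structures)

section \<open>The structure on the geodesics that are not vertical\<close>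

locale nonvertical =
  fixes xi eta :: complex
  assumes xi: "xi \<noteq> 0"
begin

definition "a0 = (xi, eta)"
definition "rho = 1 / cmod xi"
definition "L = 1 / cnj xi"

lemma rho_pos: "rho > 0"
  using xi by (simp add: rho_def)

lemma L_nonzero: "L \<noteq> 0"
  using xi by (simp add: L_def)

lemma L_norm: "(Re L)\<^sup>2 + (Im L)\<^sup>2 = rho\<^sup>2"
  unfolding cmod_power2[symmetric] by (simp add: L_def rho_def norm_divide power_divide)

lemma cosh_sinh: "(cosh r)\<^sup>2 = 1 + (sinh r)\<^sup>2" for r :: real
  by (simp add: cosh_square_eq)

text \<open>An orthonormal frame along the geodesic; the two normal fields are parallel.\<close>

definition vel :: "real \<Rightarrow> hvec" where
  "vel r = (- (rho * sinh r / (cosh r)\<^sup>2), of_real (1 / (cosh r)\<^sup>2) * L)"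

text \<open>\<open>f\<close> is the coefficient of the normal in the vertical plane of the geodesic,
  \<open>g\<close> that of the horizontal normal.\<close>

definition frame :: "real \<Rightarrow> real \<Rightarrow> real \<Rightarrow> hvec" where
  "frame f g r = (f * rho / (cosh r)\<^sup>2, Complex (f * sinh r / (cosh r)\<^sup>2) (g / cosh r) * L)"

lemma Phi_eq: "Phi a0 r = (rho / cosh r, eta + of_real (sinh r / cosh r) * L)"
  by (simp add: Phi_def a0_def rho_def L_def tanh_def)

lemma Phi_H3: "Phi a0 r \<in> H3"
  using rho_pos by (simp add: Phi_eq H3_def)

lemma has_derivative_rho_cosh: "((\<lambda>r. rho / cosh r) has_real_derivative - (rho * sinh r / (cosh r)\<^sup>2)) (at r)"
  by (auto intro!: derivative_eq_intros simp: power2_eq_square)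

lemma has_derivative_tanh: "((\<lambda>r. sinh r / cosh r) has_real_derivative 1 / (cosh r)\<^sup>2) (at r)" for r :: real
proof -
  have "cosh r * cosh r - sinh r * sinh r = 1"
    using cosh_sinh[of r] by (simp add: power2_eq_square)
  then show ?thesis by (auto intro!: derivative_eq_intros simp: power2_eq_square)
qed

lemma Phi_has_derivative: "(Phi a0 has_vector_derivative vel r) (at r)"
proof -
  have "((\<lambda>r. (rho / cosh r, eta + of_real (sinh r / cosh r) * L)) has_vector_derivative
      (- (rho * sinh r / (cosh r)\<^sup>2), 0 + of_real (1 / (cosh r)\<^sup>2) * L)) (at r)"
    by (intro has_vector_derivative_Pair has_vector_derivative_add has_vector_derivative_const
        has_vector_derivative_mult_left has_vector_derivative_of_real has_derivative_tanh
        has_derivative_rho_cosh[unfolded has_real_derivative_iff_has_vector_derivative])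
  then show ?thesis by (simp add: Phi_eq[abs_def] vel_def)
qed

lemma velocity_Phi: "velocity (Phi a0) r = vel r"
  unfolding velocity_def by (rule vector_derivative_at[OF Phi_has_derivative])

lemma inner_Complex_mult_L:
  "(Complex p q * L) \<bullet> (Complex p' q' * L) = rho\<^sup>2 * (p * p' + q * q')"
proof -
  have "(Complex p q * L) \<bullet> (Complex p' q' * L) = ((Re L)\<^sup>2 + (Im L)\<^sup>2) * (p * p' + q * q')"
    by (simp add: inner_complex_def power2_eq_square algebra_simps)
  then show ?thesis by (simp add: L_norm)
qed

lemma vel_Complex: "vel r = (- (rho * sinh r / (cosh r)\<^sup>2), Complex (1 / (cosh r)\<^sup>2) 0 * L)"
  by (simp add: vel_def complex_of_real_def)

lemma frame_frame: "frame f g r \<bullet> frame f' g' r = (rho / cosh r)\<^sup>2 * (f * f' + g * g')"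
proof -
  define C where "C = cosh r"
  have C: "C > 0" "C\<^sup>2 = 1 + (sinh r)\<^sup>2" by (simp_all add: C_def cosh_sinh)
  have "frame f g r \<bullet> frame f' g' r = rho\<^sup>2 * (f * f' * ((1 + (sinh r)\<^sup>2) / C\<^sup>2) / C\<^sup>2 + g * g' / C\<^sup>2)"
    unfolding frame_def inner_Pair inner_Complex_mult_L C_def[symmetric]
    using C(1) by (simp add: field_simps power2_eq_square)
  also have "(1 + (sinh r)\<^sup>2) / C\<^sup>2 = 1" unfolding C(2)[symmetric] using C(1) by simp
  finally show ?thesis by (simp add: C_def power_divide field_simps)
qed

lemma frame_vel: "frame f g r \<bullet> vel r = 0" "vel r \<bullet> frame f g r = 0"
  by (simp_all add: frame_def vel_Complex inner_Complex_mult_L power2_eq_square)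

lemma vel_vel: "vel r \<bullet> vel r = (rho / cosh r)\<^sup>2"
proof -
  define C where "C = cosh r"
  have C: "C > 0" "C\<^sup>2 = 1 + (sinh r)\<^sup>2" by (simp_all add: C_def cosh_sinh)
  have "vel r \<bullet> vel r = rho\<^sup>2 * ((1 + (sinh r)\<^sup>2) / C\<^sup>2 / C\<^sup>2)"
    unfolding vel_Complex inner_Pair inner_Complex_mult_L C_def[symmetric]
    using C(1) by (simp add: field_simps power2_eq_square)
  also have "(1 + (sinh r)\<^sup>2) / C\<^sup>2 = 1" unfolding C(2)[symmetric] using C(1) by simp
  finally show ?thesis by (simp add: C_def power_divide)
qed

lemma hyp_Phi: "hyp (Phi a0 r) v w = (v \<bullet> w) / (rho / cosh r)\<^sup>2"
  by (simp add: hyp_def Phi_eq)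

lemma rho_cosh_nonzero: "(rho / cosh r)\<^sup>2 \<noteq> 0"
  using rho_pos by simp

lemma hyp_frame: "hyp (Phi a0 r) (frame f g r) (frame f' g' r) = f * f' + g * g'"
  using rho_cosh_nonzero[of r] by (simp add: hyp_Phi frame_frame)

lemma frame_eq_iff: "frame f g r = frame f' g' r \<longleftrightarrow> f = f' \<and> g = g'"
proof -
  have "cosh r \<noteq> 0" by simp
  then show ?thesis using rho_pos L_nonzero by (auto simp: frame_def)
qed

lemma orthogonal_to_vel:
  assumes "w \<bullet> vel r = 0" obtains f g where "w = frame f g r"
proof -
  define p where "p = snd w / L"
  have w: "snd w = p * L" using L_nonzero by (simp add: p_def)
  have C: "cosh r \<noteq> 0" by simp
  have "w \<bullet> vel r = (- (fst w * rho * sinh r) + rho\<^sup>2 * Re p) / (cosh r)\<^sup>2"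
    using inner_Complex_mult_L[of "Re p" "Im p" "1 / (cosh r)\<^sup>2" 0]
    by (simp add: inner_prod_def vel_Complex w diff_divide_distrib)
  with assms C rho_pos have "rho * Re p = fst w * sinh r"
    by (simp add: power2_eq_square)
  then have "Re p = (fst w / rho) * sinh r" using rho_pos by (simp add: field_simps)
  then have "w = frame (fst w / rho * (cosh r)\<^sup>2) (Im p * cosh r) r"
    using C rho_pos w by (simp add: frame_def prod_eq_iff complex_eq_iff)
  then show ?thesis by (rule that)
qed

lemma det_frame:
  "det (vector [coord3 (vel r), coord3 (frame f g r), coord3 (frame f' g' r)] :: real^3^3)
    = (f' * g - f * g') * ((1 + (sinh r)\<^sup>2) * rho ^ 3 / (cosh r) ^ 5)"
proof -
  define k where "k = 1 / cosh r"
  have k: "x / cosh r = x * k" "x / (cosh r)\<^sup>2 = x * k\<^sup>2" "x / (cosh r)^5 = x * k^5" for x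
    by (simp_all add: k_def power_divide)
  have "det (vector [coord3 (vel r), coord3 (frame f g r), coord3 (frame f' g' r)] :: real^3^3)
     = (f' * g - f * g') * (1 + (sinh r)\<^sup>2) * rho * ((Re L)\<^sup>2 + (Im L)\<^sup>2) * k^5"
    unfolding det_3 coord3_def frame_def vel_Complex k
    by (simp add: power2_eq_square eval_nat_numeral algebra_simps)
  then show ?thesis unfolding k L_norm by (simp add: power2_eq_square power3_eq_cube)
qed

lemma det_frame_pos_iff:
  "det (vector [coord3 (vel r), coord3 (frame f g r), coord3 (frame f' g' r)] :: real^3^3) > 0 \<longleftrightarrow> f' * g - f * g' > 0"
proof -
  have "(1 + (sinh r)\<^sup>2) * rho ^ 3 / (cosh r) ^ 5 > 0"
    using rho_pos by (simp add: add_pos_nonneg)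
  moreover have "x * K > 0 \<longleftrightarrow> x > 0" if "K > 0" for x K :: real
    using that by (simp add: zero_less_mult_iff)
  ultimately have "(f' * g - f * g') * ((1 + (sinh r)\<^sup>2) * rho ^ 3 / (cosh r) ^ 5) > 0 \<longleftrightarrow> f' * g - f * g' > 0"
    by blast
  then show ?thesis unfolding det_frame .
qed

text \<open>By \<open>det_frame\<close>, velocity, second normal, first normal is the positive
  order; this places the minus sign in the second slot.\<close>

lemma rot90_frame: "rot90 (Phi a0 r) (vel r) (frame f g r) = frame g (- f) r"
  unfolding rot90_def
proof (rule the_equality)
  have "g * g - f * (- f) > 0" if "frame f g r \<noteq> 0"
  proof -
    have "f \<noteq> 0 \<or> g \<noteq> 0" using that by (auto simp: frame_def prod_eq_iff complex_eq_iff)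
    then show ?thesis by (simp add: sum_squares_gt_zero_iff add.commute)
  qed
  then show "hyp (Phi a0 r) (frame g (- f) r) (vel r) = 0 \<and> hyp (Phi a0 r) (frame g (- f) r) (frame f g r) = 0 \<and>
     hyp (Phi a0 r) (frame g (- f) r) (frame g (- f) r) = hyp (Phi a0 r) (frame f g r) (frame f g r) \<and>
     (frame f g r \<noteq> 0 \<longrightarrow> det (vector [coord3 (vel r), coord3 (frame f g r), coord3 (frame g (- f) r)] :: real^3^3) > 0)"
    unfolding det_frame_pos_iff hyp_frame by (simp add: hyp_Phi frame_vel)
next
  fix w
  assume w: "hyp (Phi a0 r) w (vel r) = 0 \<and> hyp (Phi a0 r) w (frame f g r) = 0 \<and>
     hyp (Phi a0 r) w w = hyp (Phi a0 r) (frame f g r) (frame f g r) \<and>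
     (frame f g r \<noteq> 0 \<longrightarrow> det (vector [coord3 (vel r), coord3 (frame f g r), coord3 w] :: real^3^3) > 0)"
  then have "w \<bullet> vel r = 0" using rho_cosh_nonzero[of r] by (simp add: hyp_Phi)
  then obtain x y where wxy: "w = frame x y r" by (rule orthogonal_to_vel)
  have o: "x * f + y * g = 0" and n: "x * x + y * y = f * f + g * g"
    and d: "frame f g r \<noteq> 0 \<Longrightarrow> x * g - f * y > 0"
    using w unfolding wxy hyp_frame det_frame_pos_iff by auto
  \<comment> \<open>Lagrange's identity with orthogonality and equal lengths gives \<open>D\<close>
    up to sign, the orientation selects the sign, and then the squared distance between
    \<open>(x, y)\<close> and \<open>(g, - f)\<close> is 0.\<close>
  define D where "D = x * g - f * y"
  have "D * D + (x * f + y * g) * (x * f + y * g) = (x * x + y * y) * (f * f + g * g)"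
    by (simp add: D_def algebra_simps)
  then have DD: "D * D = (f * f + g * g) * (f * f + g * g)" by (simp add: o n)
  have D0: "D \<ge> 0"
  proof (cases "frame f g r = 0")
    case True
    moreover have "frame 0 0 r = 0" by (simp add: frame_def zero_prod_def zero_complex.code[symmetric])
    ultimately have "f = 0" "g = 0" using frame_eq_iff[of f g r 0 0] by simp_all
    then show ?thesis by (simp add: D_def)
  next
    case False
    then show ?thesis using d by (simp add: D_def)
  qed
  have "\<bar>D\<bar> = \<bar>f * f + g * g\<bar>"
    using DD by (metis abs_mult_self_eq power2_abs power2_eq_iff_nonneg power2_eq_square abs_ge_zero)
  then have "D = f * f + g * g" using D0 by simp
  then have "(x - g) * (x - g) + (y + f) * (y + f) = 0" using n by (simp add: D_def algebra_simps)
  then have "x = g" "y = - f" by (auto simp: sum_squares_eq_zero_iff)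
  then show "w = frame g (- f) r" by (simp add: wxy)
qed

lemma cov_deriv_frame:
  assumes V: "\<And>r. V r = frame (f r) (g r) r"
    and f: "(f has_real_derivative f') (at r)" and g: "(g has_real_derivative g') (at r)"
  shows "cov_deriv hyp (Phi a0) V r = frame f' g' r"
proof -
  define C S where "C = cosh r" and "S = sinh r"
  have C: "C > 0" "C * C = 1 + S * S" using cosh_sinh[of r] by (simp_all add: C_def S_def power2_eq_square)
  have d1: "((\<lambda>r. f r * rho / (cosh r)\<^sup>2) has_real_derivative (f' * rho / C\<^sup>2 - 2 * f r * rho * S / C^3)) (at r)"
    using C(1) unfolding C_def S_def
    by (auto intro!: derivative_eq_intros f simp: field_simps power2_eq_square power3_eq_cube)
  have d2: "((\<lambda>r. f r * sinh r / (cosh r)\<^sup>2) has_real_derivative (f' * S / C\<^sup>2 + f r * (C\<^sup>2 - 2 * S\<^sup>2) / C^3)) (at r)"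
    using C(1) unfolding C_def S_def
    by (auto intro!: derivative_eq_intros f simp: field_simps power2_eq_square power3_eq_cube)
  have d3: "((\<lambda>r. g r / cosh r) has_real_derivative (g' / C - g r * S / C\<^sup>2)) (at r)"
    using C(1) unfolding C_def S_def
    by (auto intro!: derivative_eq_intros g simp: field_simps power2_eq_square)
  have dC: "((\<lambda>r. Complex (f r * sinh r / (cosh r)\<^sup>2) (g r / cosh r)) has_vector_derivative
      Complex (f' * S / C\<^sup>2 + f r * (C\<^sup>2 - 2 * S\<^sup>2) / C^3) (g' / C - g r * S / C\<^sup>2)) (at r)"
    unfolding has_vector_derivative_complex_iff using d2 d3 by simp
  let ?dV = "(f' * rho / C\<^sup>2 - 2 * f r * rho * S / C^3,
      Complex (f' * S / C\<^sup>2 + f r * (C\<^sup>2 - 2 * S\<^sup>2) / C^3) (g' / C - g r * S / C\<^sup>2) * L)"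
  from dC have "(V has_vector_derivative ?dV) (at r)"
    unfolding V[abs_def] frame_def using d1
    by (intro has_vector_derivative_Pair has_vector_derivative_mult_left)
       (simp_all add: has_real_derivative_iff_has_vector_derivative)
  then have dV: "vector_derivative V (at r) = ?dV"
    by (rule vector_derivative_at)
  have "christoffel hyp (Phi a0 r) (vel r) (V r) = - (1 / fst (Phi a0 r)) *\<^sub>R (fst (vel r) *\<^sub>R V r + fst (V r) *\<^sub>R vel r)"
    unfolding christoffel_hyp[OF Phi_H3] V frame_vel by (simp add: algebra_simps) (simp add: zero_prod_def)
  also have "\<dots> = (2 * f r * rho * S / C^3, Complex (f r * (S\<^sup>2 - 1) / C^3) (g r * S / C\<^sup>2) * L)"
    unfolding V using rho_pos C(1)
    by (simp add: Phi_eq vel_Complex frame_def C_def[symmetric] S_def[symmetric] prod_eq_iff complex_eq_iff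
        field_simps power2_eq_square power3_eq_cube)
  finally have ch: "christoffel hyp (Phi a0 r) (vel r) (V r) =
      (2 * f r * rho * S / C^3, Complex (f r * (S\<^sup>2 - 1) / C^3) (g r * S / C\<^sup>2) * L)" .
  \<comment> \<open>Here the derivative of the first normal cancels against its Christoffel term, so
    that only the derivatives of the coefficients survive.\<close>
  have "(C\<^sup>2 - 2 * S\<^sup>2) + (S\<^sup>2 - 1) = 0" using C(2) by (simp add: power2_eq_square)
  then have "f r * (C\<^sup>2 - 2 * S\<^sup>2) / C^3 + f r * (S\<^sup>2 - 1) / C^3 = 0"
    by (metis add_divide_distrib distrib_left div_0 mult_zero_right)
  then have c: "f' * S / C\<^sup>2 + f r * (C\<^sup>2 - 2 * S\<^sup>2) / C^3 + f r * (S\<^sup>2 - 1) / C^3 = f' * S / C\<^sup>2" by simp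
  show ?thesis
    unfolding cov_deriv_def velocity_Phi dV ch add_Pair distrib_right[symmetric] complex_add c
    by (simp add: frame_def C_def S_def)
qed

text \<open>\<open>al\<close> and \<open>be\<close> rescale the components so that the Jacobi
  fields, solutions of f'' = f in curvature -1, have the simple coefficients \<open>jf\<close> and
  \<open>jg\<close>.\<close>

definition al :: "complex \<times> complex \<Rightarrow> complex" where "al X = cnj (fst X / xi)"
definition be :: "complex \<times> complex \<Rightarrow> complex" where "be X = snd X * cnj xi"
definition jf :: "complex \<times> complex \<Rightarrow> real \<Rightarrow> real" where "jf X r = sinh r * Re (be X) - cosh r * Re (al X)"
definition jg :: "complex \<times> complex \<Rightarrow> real \<Rightarrow> real" where "jg X r = cosh r * Im (be X) - sinh r * Im (al X)"

lemma DPhi: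
  "ddir (\<lambda>b. Phi b r) a0 X = (- (rho * Re (al X) / cosh r), (be X - of_real (sinh r / cosh r) * al X) * L)"
proof -
  have n: "((\<lambda>b :: complex \<times> complex. cmod (fst b)) has_derivative (\<lambda>X. fst X \<bullet> sgn xi)) (at a0)"
  proof (rule has_derivative_compose[OF bounded_linear_imp_has_derivative[OF bounded_linear_fst]])
    show "(cmod has_derivative (\<lambda>h. h \<bullet> sgn xi)) (at (fst a0))"
      using has_derivative_norm[OF xi] by (simp add: a0_def)
  qed
  have "((\<lambda>b :: complex \<times> complex. 1 / (cmod (fst b) * cosh r)) has_derivative
      (\<lambda>X. - (rho * Re (al X) / cosh r))) (at a0)"
  proof -
    have "((\<lambda>b :: complex \<times> complex. inverse (cmod (fst b)) * (1 / cosh r)) has_derivative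
        (\<lambda>X. - (inverse (cmod xi) * (fst X \<bullet> sgn xi) * inverse (cmod xi)) * (1 / cosh r))) (at a0)"
      using xi Deriv.has_derivative_inverse[OF _ n] by (intro has_derivative_mult_left) (simp add: a0_def)
    moreover have "inverse (cmod xi) * (fst X \<bullet> sgn xi) * inverse (cmod xi) = rho * Re (al X)" for X :: "complex \<times> complex"
    proof -
      have "Re (al X) = (fst X \<bullet> xi) / (cmod xi)\<^sup>2"
        by (simp add: al_def complex_div_cnj[of "fst X" xi] inner_complex_def)
      then show ?thesis using xi by (simp add: rho_def sgn_div_norm divide_inverse power2_eq_square)
    qed
    ultimately show ?thesis by (simp add: divide_inverse)
  qed
  moreover have "((\<lambda>b :: complex \<times> complex. snd b + of_real (tanh r) / cnj (fst b)) has_derivative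
      (\<lambda>X. (be X - of_real (sinh r / cosh r) * al X) * L)) (at a0)"
  proof -
    have "((\<lambda>b :: complex \<times> complex. snd b + of_real (tanh r) * inverse (cnj (fst b))) has_derivative
      (\<lambda>X. snd X + of_real (tanh r) * - (inverse (cnj xi) * cnj (fst X) * inverse (cnj xi)))) (at a0)"
      using xi
      by (intro has_derivative_add has_derivative_snd has_derivative_ident has_derivative_mult_right)
         (auto intro!: Deriv.has_derivative_inverse[THEN has_derivative_eq_rhs] bounded_linear.has_derivative[OF bounded_linear_cnj]
           has_derivative_fst has_derivative_ident simp: a0_def)
    moreover have "snd X + of_real (tanh r) * - (inverse (cnj xi) * cnj (fst X) * inverse (cnj xi)) =
       (be X - of_real (sinh r / cosh r) * al X) * L" for X :: "complex \<times> complex"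
      using xi by (simp add: be_def al_def L_def tanh_def field_simps)
    ultimately show ?thesis by (simp add: divide_inverse)
  qed
  ultimately have "((\<lambda>b. Phi b r) has_derivative
      (\<lambda>X. (- (rho * Re (al X) / cosh r), (be X - of_real (sinh r / cosh r) * al X) * L))) (at a0)"
    unfolding Phi_def split_beta by (rule has_derivative_Pair)
  from frechet_derivative_at[OF this, symmetric] show ?thesis by simp
qed

lemma h_map_eq: "h_map a0 X r = frame (jf X r) (jg X r) r"
proof -
  define C S where "C = cosh r" and "S = sinh r"
  have C: "C > 0" "C * C = 1 + S * S" using cosh_sinh[of r] by (simp_all add: C_def S_def power2_eq_square)
  define D where "D = ddir (\<lambda>b. Phi b r) a0 X"
  have D: "D = (- (rho * Re (al X) / C), Complex (Re (be X) - S / C * Re (al X)) (Im (be X) - S / C * Im (al X)) * L)"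
    unfolding D_def DPhi C_def[symmetric] S_def[symmetric]
    by (simp add: prod_eq_iff complex_eq_iff)
  have "D \<bullet> vel r = rho\<^sup>2 * (S * Re (al X) / C^3 + (Re (be X) - S / C * Re (al X)) / C\<^sup>2)"
    unfolding D vel_Complex C_def[symmetric] S_def[symmetric] inner_Pair inner_Complex_mult_L
    using C(1) by (simp add: field_simps power2_eq_square power3_eq_cube)
  also have "\<dots> = (rho / C)\<^sup>2 * Re (be X)"
    using C(1) by (simp add: field_simps power2_eq_square power3_eq_cube)
  finally have Dv: "D \<bullet> vel r = (rho / C)\<^sup>2 * Re (be X)" .
  have "h_map a0 X r = D - Re (be X) *\<^sub>R vel r"
    unfolding h_map_def perp_proj_def velocity_Phi D_def[symmetric] hyp_Phi Dv vel_vel C_def[symmetric]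
    using rho_pos C(1) by simp
  also have "\<dots> = frame (jf X r) (jg X r) r"
  proof -
    have 1: "- (rho * Re (al X) / C) + Re (be X) * (rho * S / C\<^sup>2) = (S * Re (be X) - C * Re (al X)) * rho / C\<^sup>2"
      using C(1) by (simp add: field_simps power2_eq_square)
    have "Re (be X) - S / C * Re (al X) - Re (be X) / C\<^sup>2 = (C * C - 1) * Re (be X) / C\<^sup>2 - S * C * Re (al X) / C\<^sup>2"
      using C(1) by (simp add: field_simps power2_eq_square)
    also have "\<dots> = (S * Re (be X) - C * Re (al X)) * S / C\<^sup>2"
      unfolding C(2) by (simp add: algebra_simps diff_divide_distrib)
    finally have 2: "Re (be X) - S / C * Re (al X) - Re (be X) / C\<^sup>2 = (S * Re (be X) - C * Re (al X)) * S / C\<^sup>2" .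
    have 3: "Im (be X) - S / C * Im (al X) = (C * Im (be X) - S * Im (al X)) / C"
      using C(1) by (simp add: field_simps)
    have "D - Re (be X) *\<^sub>R vel r = (- (rho * Re (al X) / C) + Re (be X) * (rho * S / C\<^sup>2),
       Complex (Re (be X) - S / C * Re (al X) - Re (be X) / C\<^sup>2) (Im (be X) - S / C * Im (al X)) * L)"
      unfolding D vel_Complex C_def[symmetric] S_def[symmetric]
      by (simp add: prod_eq_iff complex_eq_iff algebra_simps)
    then show ?thesis unfolding 1 2 3 by (simp add: frame_def jf_def jg_def C_def S_def)
  qed
  finally show ?thesis .
qed

lemma al_be_eqI: "al X = al Y \<Longrightarrow> be X = be Y \<Longrightarrow> X = Y"
  using xi by (simp add: al_def be_def prod_eq_iff)

text \<open>The value at \<open>r = 0\<close> shows Re \<open>al\<close> and Im \<open>be\<close>;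
  the value at \<open>r = 1\<close> then supplies the other two parts, as \<open>sinh 1\<close> is
  nonzero.\<close>

lemma inj_h_map: "inj (h_map a0)"
proof (rule injI)
  fix X Y assume "h_map a0 X = h_map a0 Y"
  then have "h_map a0 X r = h_map a0 Y r" for r by simp
  then have fg: "jf X r = jf Y r" "jg X r = jg Y r" for r
    unfolding h_map_eq frame_eq_iff by auto
  have 0: "Re (al X) = Re (al Y)" "Im (be X) = Im (be Y)"
    using fg[of 0] by (simp_all add: jf_def jg_def)
  have "sinh 1 \<noteq> (0 :: real)" by simp
  then have "Re (be X) = Re (be Y)" "Im (al X) = Im (al Y)"
    using fg[of 1] 0 by (simp_all add: jf_def jg_def)
  with 0 show "X = Y" by (intro al_be_eqI complex_eqI)
qed

text \<open>Solved from the relations of \<open>al_be_J0\<close>: rotating the two normals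
  interchanges \<open>al\<close> and \<open>be\<close> with a factor \<open>\<i>\<close>.\<close>

definition J0 :: "complex \<times> complex \<Rightarrow> complex \<times> complex" where
  "J0 X = (- \<i> * xi\<^sup>2 * cnj (snd X), \<i> * cnj (fst X) / (cnj xi)\<^sup>2)"

lemma al_be_J0: "al (J0 X) = \<i> * be X" "be (J0 X) = \<i> * al X"
  using xi by (simp_all add: al_def be_def J0_def power2_eq_square)

lemma J_U_eq: "J_U a0 X = J0 X"
proof -
  have "h_map a0 (J0 X) = (\<lambda>r. rot90 (Phi a0 r) (velocity (Phi a0) r) (h_map a0 X r))"
    unfolding fun_eq_iff h_map_eq velocity_Phi rot90_frame frame_eq_iff
    by (simp add: jf_def jg_def al_be_J0)
  then show ?thesis unfolding J_U_def by (metis inv_f_f[OF inj_h_map])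
qed

lemma cov_deriv_h_map:
  "cov_deriv hyp (Phi a0) (h_map a0 X) r =
     frame (cosh r * Re (be X) - sinh r * Re (al X)) (sinh r * Im (be X) - cosh r * Im (al X)) r"
proof (rule cov_deriv_frame)
  show "h_map a0 X r = frame (jf X r) (jg X r) r" for r by (rule h_map_eq)
  show "(jf X has_real_derivative cosh r * Re (be X) - sinh r * Re (al X)) (at r)"
    unfolding jf_def[abs_def] by (auto intro!: derivative_eq_intros)
  show "(jg X has_real_derivative sinh r * Im (be X) - cosh r * Im (al X)) (at r)"
    unfolding jg_def[abs_def] by (auto intro!: derivative_eq_intros)
qed

text \<open>The expression is a Wronskian; \<open>r\<close> enters only through the factor cosh^2 -
  sinh^2 = 1, so the definite description picks a genuine value.\<close>

lemma Omega_U_eq: "Omega_U a0 X Y = Re (be X * al Y - al X * be Y)"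
proof -
  have w: "hyp (Phi a0 r) (h_map a0 X r) (cov_deriv hyp (Phi a0) (h_map a0 Y) r)
       - hyp (Phi a0 r) (h_map a0 Y r) (cov_deriv hyp (Phi a0) (h_map a0 X) r)
     = Re (be X * al Y - al X * be Y)" for r
  proof -
    have "hyp (Phi a0 r) (h_map a0 X r) (cov_deriv hyp (Phi a0) (h_map a0 Y) r)
       - hyp (Phi a0 r) (h_map a0 Y r) (cov_deriv hyp (Phi a0) (h_map a0 X) r)
      = ((cosh r)\<^sup>2 - (sinh r)\<^sup>2) * Re (be X * al Y - al X * be Y)"
      unfolding cov_deriv_h_map h_map_eq hyp_frame
      by (simp add: jf_def jg_def power2_eq_square algebra_simps)
    then show ?thesis by (simp add: cosh_sinh)
  qed
  show ?thesis unfolding Omega_U_def w by (rule the_equality) auto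
qed

lemma G_U_eq: "G_U a0 X Y = Im (be X * be Y - al X * al Y)"
  by (simp add: G_U_def J_U_eq Omega_U_eq al_be_J0 algebra_simps)

subsection \<open>Comparison with the base chart\<close>

text \<open>The geodesic runs from \<open>eta - 1 / cnj xi\<close> to
  \<open>eta + 1 / cnj xi\<close>. The first of these is q, and m is the reciprocal of their
  difference.\<close>

definition y0 :: "complex \<times> complex" where "y0 = (cnj xi / 2, eta - 1 / cnj xi)"

lemma geod_of_eq: "geod_of a0 = base_geod 1 y0"
proof -
  interpret direction 1 by standard simp
  define b where "b = (Phi a0 0, velocity (Phi a0) 0)"
  have b: "b = ((rho, eta), (0, L))"
    by (simp add: b_def velocity_Phi Phi_eq vel_def)
  have "norm (0 :: real, L) = rho" by (simp add: norm_Pair L_def rho_def norm_divide)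
  then have u: "b \<in> unit_tangent" using rho_pos by (simp add: b unit_tangent_iff)
  have "xi * cnj xi * complex_of_real (rho\<^sup>2) = 1"
    using xi by (simp add: rho_def complex_norm_square[symmetric] power_divide)
  then have "cnj L / of_real (rho\<^sup>2) = cnj xi"
    using xi rho_pos by (simp add: L_def field_simps)
  then have "moment b = ((eta * cnj xi, eta\<^sup>2 * cnj xi - L), cnj xi)"
    unfolding b moment_def split by simp
  moreover have "\<dots> = base_X 1 y0"
    using xi by (simp add: base_X_def y0_def L_def field_simps power2_eq_square)
  ultimately have "moment b = base_X 1 y0" by simp
  then have "embed (geod_of a0) = embed (base_geod 1 y0)"
    by (simp add: geod_of_def b_def[symmetric] embed_flow_proj u embed_base_geod)
  then show ?thesis
    using inj_onD[OF inj_embed] flow_proj_LH3[OF u] base_geod_LH3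
    by (metis geod_of_def b_def)
qed

end

section \<open>The non-vertical geodesics inside the base coordinates for
  \<open>e = 1\<close>\<close>

interpretation forward: direction 1
  by standard simp

definition nonvert_dom :: "(complex \<times> complex) set" where
  "nonvert_dom = {y. fst y \<noteq> 0}"

text \<open>Inverts the passage to \<open>y0\<close>: the second entry is the midpoint of the end
  points.\<close>

definition nonvert_coord :: "complex \<times> complex \<Rightarrow> complex \<times> complex" where
  "nonvert_coord y = (2 * cnj (fst y), snd y + 1 / (2 * fst y))"

definition nonvert_inv :: "complex \<times> complex \<Rightarrow> complex \<times> complex" where
  "nonvert_inv x = (cnj (fst x) / 2, snd x - 1 / cnj (fst x))"

lemma nonvert_inv_coord: "y \<in> nonvert_dom \<Longrightarrow> nonvert_inv (nonvert_coord y) = y"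
  by (simp add: nonvert_inv_def nonvert_coord_def)

lemma nonvert_coord_inv: "x \<in> coord_range \<Longrightarrow> nonvert_coord (nonvert_inv x) = x"
  by (simp add: nonvert_inv_def nonvert_coord_def)

lemma coord_range_iff: "x \<in> coord_range \<longleftrightarrow> fst x \<noteq> 0"
  by (cases x) (simp add: coord_range_def)

lemma nonvert_inv_dom: "x \<in> coord_range \<Longrightarrow> nonvert_inv x \<in> nonvert_dom"
  by (simp add: nonvert_inv_def nonvert_dom_def coord_range_iff)

lemma nonvert_coord_range: "y \<in> nonvert_dom \<Longrightarrow> nonvert_coord y \<in> coord_range"
  by (simp add: nonvert_coord_def nonvert_dom_def coord_range_iff)

lemma geod_of_base: assumes "x \<in> coord_range" shows "geod_of x = base_geod 1 (nonvert_inv x)"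
proof -
  interpret nonvertical "fst x" "snd x" by standard (use assms in \<open>simp add: coord_range_iff\<close>)
  show ?thesis using geod_of_eq by (simp add: a0_def y0_def nonvert_inv_def)
qed

lemma open_nonvert_dom: "open nonvert_dom"
  unfolding nonvert_dom_def by (intro open_Collect_neq continuous_intros)

lemma smooth_nonvert_coord: "smooth_on nonvert_dom nonvert_coord"
  unfolding nonvert_coord_def[abs_def]
  by (intro smooth_intros open_nonvert_dom) (simp add: nonvert_dom_def)

lemma inj_nonvert_coord: "inj_on nonvert_coord nonvert_dom"
  by (rule inj_on_inverseI[of _ nonvert_inv]) (rule nonvert_inv_coord)

lemma ddir_nonvert_coord:
  assumes "y \<in> nonvert_dom"
  shows "ddir nonvert_coord y v = (2 * cnj (fst v), snd v - fst v / (2 * (fst y)\<^sup>2))"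
proof -
  have n: "fst y \<noteq> 0" using assms by (simp add: nonvert_dom_def)
  have "((\<lambda>y. snd y + 1 / (2 * fst y)) has_derivative (\<lambda>v. snd v - fst v / (2 * (fst y)\<^sup>2))) (at y)"
    using n by (auto intro!: derivative_eq_intros simp: fun_eq_iff field_simps power2_eq_square)
  moreover have "((\<lambda>y :: complex \<times> complex. 2 * cnj (fst y)) has_derivative (\<lambda>v. 2 * cnj (fst v))) (at y)"
    by (intro has_derivative_mult_right bounded_linear.has_derivative[OF bounded_linear_cnj] has_derivative_fst has_derivative_ident)
  ultimately have "(nonvert_coord has_derivative (\<lambda>v. (2 * cnj (fst v), snd v - fst v / (2 * (fst y)\<^sup>2)))) (at y)"
    unfolding nonvert_coord_def[abs_def] by (intro has_derivative_Pair)
  from frechet_derivative_at[OF this, symmetric] show ?thesis by simp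
qed

definition nonvert_lift :: "complex \<times> complex \<Rightarrow> complex \<times> complex \<Rightarrow> complex \<times> complex" where
  "nonvert_lift y X = (cnj (fst X) / 2, snd X + cnj (fst X) / (4 * (fst y)\<^sup>2))"

lemma ddir_nonvert_lift: "y \<in> nonvert_dom \<Longrightarrow> ddir nonvert_coord y (nonvert_lift y X) = X"
  by (simp add: ddir_nonvert_coord nonvert_lift_def)

text \<open>The base coordinates for \<open>e = 1\<close> omit only geodesics pointing straight
  down. Among the others, being non-vertical means that the third entry of the moment, hence
  \<open>m\<close>, is nonzero.\<close>

lemma U_set_eq: "U_set = base_geod 1 ` nonvert_dom"
proof (intro set_eqI iffI)
  fix \<gamma> assume \<gamma>: "\<gamma> \<in> U_set"
  then obtain a where a: "a \<in> unit_tangent" "\<gamma> = flow_proj a" by (auto simp: U_set_def LH3_eq)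
  with \<gamma> obtain b where b: "b \<in> unit_tangent" "moment b = moment a" "snd (snd b) \<noteq> 0"
    by (auto simp: U_set_def flow_proj_eq)
  have "norm (snd b) + fst (snd b) \<noteq> 0"
  proof
    assume "norm (snd b) + fst (snd b) = 0"
    then have "norm (snd b) = - fst (snd b)" by simp
    then have "(norm (snd b))\<^sup>2 = (fst (snd b))\<^sup>2" by simp
    then show False using b(3) by (simp add: norm_hvec)
  qed
  then have bd: "b \<in> base_dom 1"
    using unit_subset_slit[OF b(1)] by (simp add: base_dom_def slit_tangent_iff)
  have "\<gamma> = flow_proj b" using a b by (simp add: flow_proj_eq)
  also have "\<dots> = slit_proj b" using slit_proj_eq[OF unit_subset_slit[OF b(1)]] normalize_unit_id[OF b(1)] by simp
  also have "\<dots> = base_geod 1 (base_coord 1 b)"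
    using forward.slit_proj_eq_base_geod_iff[OF unit_subset_slit[OF b(1)]] bd by simp
  finally have "\<gamma> = base_geod 1 (base_coord 1 b)" .
  moreover have "base_coord 1 b \<in> nonvert_dom"
    using b(3) bd by (simp add: nonvert_dom_def base_coord_def base_dom_def)
  ultimately show "\<gamma> \<in> base_geod 1 ` nonvert_dom" by blast
next
  fix \<gamma> assume "\<gamma> \<in> base_geod 1 ` nonvert_dom"
  then obtain y where y: "y \<in> nonvert_dom" "\<gamma> = base_geod 1 y" by blast
  define a where "a = normalize (sect 1 1 1 y)"
  have a: "a \<in> unit_tangent" unfolding a_def by (intro normalize_unit forward.sect_slit) simp_all
  have \<gamma>: "\<gamma> = flow_proj a" using slit_proj_eq[OF forward.sect_slit] by (simp add: y base_geod_def a_def)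
  have "snd (embed \<gamma>) \<noteq> 0"
    using y by (simp add: forward.embed_base_geod base_X_def split_beta nonvert_dom_def)
  then have "snd (snd a) \<noteq> 0" by (auto simp: \<gamma> embed_flow_proj[OF a] moment_def split_beta)
  moreover have "a \<in> \<gamma>" using a by (simp add: \<gamma> flow_proj_eq)
  ultimately show "\<gamma> \<in> U_set" using flow_proj_LH3[OF a] by (simp add: U_set_def \<gamma> split_beta) blast
qed

lemma geod_of_bij: "bij_betw geod_of coord_range U_set"
  unfolding bij_betw_def
proof
  show "inj_on geod_of coord_range"
  proof (rule inj_onI)
    fix x x' assume x: "x \<in> coord_range" "x' \<in> coord_range" "geod_of x = geod_of x'"
    then have "nonvert_inv x = nonvert_inv x'" using forward.inj_base_geod by (simp add: geod_of_base inj_eq)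
    then show "x = x'" using nonvert_coord_inv x by metis
  qed
  have "nonvert_inv ` coord_range = nonvert_dom"
  proof
    show "nonvert_inv ` coord_range \<subseteq> nonvert_dom" using nonvert_inv_dom by blast
    show "nonvert_dom \<subseteq> nonvert_inv ` coord_range"
    proof
      fix y assume "y \<in> nonvert_dom"
      then show "y \<in> nonvert_inv ` coord_range"
        using nonvert_inv_coord nonvert_coord_range by (intro image_eqI[of _ _ "nonvert_coord y"]) simp_all
    qed
  qed
  then show "geod_of ` coord_range = U_set"
    unfolding U_set_eq by (metis (no_types, lifting) geod_of_base image_cong image_image)
qed

lemma U_chart_base_geod: assumes "y \<in> nonvert_dom" shows "cmap U_chart (base_geod 1 y) = nonvert_coord y"
proof -
  have "geod_of (nonvert_coord y) = base_geod 1 y"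
    using assms by (simp add: geod_of_base nonvert_coord_range nonvert_inv_coord)
  then show ?thesis
    using inv_into_f_f[OF bij_betw_imp_inj_on[OF geod_of_bij] nonvert_coord_range[OF assms]]
    by (simp add: U_chart_def)
qed

lemma U_chart_in_atlas: "U_chart \<in> LH3_atlas"
  unfolding U_chart_def
proof (rule forward.chart_in_atlas[OF open_nonvert_dom smooth_nonvert_coord inj_nonvert_coord _ U_set_eq])
  show "surj (ddir nonvert_coord y)" if "y \<in> nonvert_dom" for y
    by (rule surjI[of _ "nonvert_lift y"]) (rule ddir_nonvert_lift[OF that])
  show "inv_into coord_range geod_of (base_geod 1 y) = nonvert_coord y" if "y \<in> nonvert_dom" for y
    using U_chart_base_geod[OF that] by (simp add: U_chart_def)
qed

lemma U_chart_fields: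
  assumes a: "a \<in> coord_range"
  shows "J_field U_chart a X = J_U a X" "G_field U_chart a X Y = G_U a X Y" "Om_field U_chart a X Y = Omega_U a X Y"
proof -
  interpret nonvertical "fst a" "snd a" by standard (use a in \<open>simp add: coord_range_iff\<close>)
  have a0: "a0 = a" by (simp add: a0_def)
  define y where "y = nonvert_inv a"
  have y: "y \<in> nonvert_dom" "nonvert_coord y = a"
    unfolding y_def by (rule nonvert_inv_dom[OF a], rule nonvert_coord_inv[OF a])
  have fy: "fst y = cnj (fst a) / 2" by (simp add: y_def nonvert_inv_def)
  have in_chart: "forward.in_chart U_chart = nonvert_dom"
    using forward.inj_base_geod by (auto simp: forward.in_chart_def U_chart_def U_set_eq inj_image_mem_iff)
  have T: "forward.base_trans U_chart y' = nonvert_coord y'" if "y' \<in> nonvert_dom" for y'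
    using U_chart_base_geod[OF that] by (simp add: forward.base_trans_def)
  have "(forward.base_trans U_chart has_derivative ddir nonvert_coord y) (at y)"
    by (rule has_derivative_transform_within_open[OF
          smooth_on_has_derivative[OF open_nonvert_dom smooth_nonvert_coord y(1)] open_nonvert_dom y(1) T[symmetric]])
  then have dT: "ddir (forward.base_trans U_chart) y = ddir nonvert_coord y"
    by (rule frechet_derivative_at[symmetric])
  have yc: "y \<in> forward.in_chart U_chart" by (simp add: in_chart y)
  note J = forward.J_field_base_trans[OF U_chart_in_atlas yc, unfolded dT T[OF y(1)] y(2)]
  note G = forward.G_field_base_trans[OF U_chart_in_atlas yc, unfolded dT T[OF y(1)] y(2)]
  have JX: "J_field U_chart a X = J0 X" for X
  proof -
    have "J_field U_chart a X = ddir nonvert_coord y (forward.base_J y (nonvert_lift y X))"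
      using J[of "nonvert_lift y X"] by (simp add: ddir_nonvert_lift y)
    also have "\<dots> = J0 X"
      using xi by (simp add: ddir_nonvert_coord y forward.base_J_def nonvert_lift_def J0_def fy field_simps power2_eq_square)
    finally show ?thesis .
  qed
  show "J_field U_chart a X = J_U a X" using JX J_U_eq[of X] by (simp add: a0)
  have GX: "G_field U_chart a X Y = Im (be X * be Y - al X * al Y)" for X Y
  proof -
    have "G_field U_chart a X Y = induced_metric (base_X 1) y (nonvert_lift y X) (nonvert_lift y Y)"
      using G[of "nonvert_lift y X" "nonvert_lift y Y"] by (simp add: ddir_nonvert_lift y)
    also have "\<dots> = Im (be X * be Y - al X * al Y)"
    proof -
      have "4 * (fst y)\<^sup>2 * snd (nonvert_lift y X) * snd (nonvert_lift y Y)
          - 2 * (fst (nonvert_lift y X) * snd (nonvert_lift y Y) + fst (nonvert_lift y Y) * snd (nonvert_lift y X))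
        = be X * be Y - al X * al Y"
        using xi by (simp add: nonvert_lift_def fy be_def al_def field_simps power2_eq_square)
      then show ?thesis by (simp only: forward.base_metric)
    qed
    finally show ?thesis .
  qed
  show "G_field U_chart a X Y = G_U a X Y" using GX G_U_eq[of X Y] by (simp add: a0)
  have ac: "a \<in> cimg U_chart" using forward.in_chartD[OF yc] T[OF y(1)] y(2) by simp
  \<comment> \<open>The general relation between form, metric and complex structure reduces this to
    the two fields already computed.\<close>
  have "Om_field U_chart a X Y = - G_field U_chart a (J_field U_chart a X) Y"
    unfolding Om_field_def G_field_def J_field_def
    by (rule quadric_immersion.form_eq[OF chart_quadric_immersion[OF U_chart_in_atlas] ac])
  also have "\<dots> = Re (be X * al Y - al X * be Y)"
    by (simp add: JX GX al_be_J0)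
  finally show "Om_field U_chart a X Y = Omega_U a X Y" using Omega_U_eq[of X Y] by (simp add: a0)
qed

lemma extends_from_U_fields: "extends_from_U J_field Om_field G_field"
proof -
  have "bij_betw (cmap U_chart) U_set coord_range"
    using bij_betw_inv_into[OF geod_of_bij] by (simp add: U_chart_def)
  then show ?thesis unfolding extends_from_U_def using U_chart_in_atlas U_chart_fields by blast
qed

theorem theorem2:
  shows "\<exists>J Om G. kaehler_structure LH3 LH3_atlas J Om G \<and> extends_from_U J Om G \<and>
           neutral_metric LH3_atlas G \<and> conformally_flat LH3_atlas G \<and> scalar_flat LH3_atlas G"
  using kaehler_LH3 extends_from_U_fields neutral_G conformally_flat_G scalar_flat_G by blast

end
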